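(* Let $\mathcal H_0,\mathcal K,\mathcal G$ be Hilbert spaces, let $R\in\mathcal L(\mathcal K)$ and $T_0\in\mathcal L(\mathcal H_0)$ be contractions of class $C_{10}$, let $U\in\mathcal L(\mathcal G)$ be unitary, and let $(Y,U)$ be a unitary asymptote of $R$. Suppose there exists $\mathcal E\in\operatorname{Hlat}U$ such that $$\{0\}\neq\mathcal M:=\{y\in\mathcal K: Yy\in\mathcal E\}\neq\mathcal K,$$ and set $\mathcal K_0=\mathcal K\ominus\mathcal M$, $R_0=P_{\mathcal K_0}R|_{\mathcal K_0}$. Suppose that $T_0$ is quasianalytic, that $J\in\mathcal L(\mathcal H_0,\mathcal K)$ is a quasiaffinity with $JT_0=RJ$, and that $(YJ,U)$ is a unitary asymptote of $T_0$. Suppose moreover that $$\lim_{n\to\infty}(R^ny_1,R^ny_2)=(Yy_1,Yy_2)\ \ (y_1,y_2\in\mathcal K),\qquad \lim_{n\to\infty}(T_0^nx_1,T_0^nx_2)=(YJx_1,YJx_2)\ \ (x_1,x_2\in\mathcal H_0).$$ Let $0<c<1$ and let $X_0=cP_{\mathcal K_0}J\in\mathcal L(\mathcal H_0,\mathcal K_0)$. Let $K\in\mathcal L(\mathcal K_0,H^2_\infty)$ be such that $$\begin{pmatrix}S_\infty & K\\ 0& R_0\end{pmatrix}\cong S_\infty$$ (such $K$ exists because $R_0$ is a contraction of class $C_{\cdot0}$). Define $T$ on $H^2_\infty\oplus\mathcal H_0$ by $$T=\begin{pmatrix}S_\infty & KX_0\\ 0& T_0\end{pmatrix}.$$ Then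 $T$ is similar to a contraction, $T\sim S_\infty$, and an isometric asymptote of $T$ contains a non-trivial unitary summand (that is, if $(X,V)$ is an isometric asymptote of $T$, then the isometry $V$ is an orthogonal sum of two isometries one of which is a unitary operator on a non-zero space).
   Context: All Hilbert spaces are complex and separable; operators and transformations are linear and bounded; $\mathcal L(\mathcal H,\mathcal K)$ is the space of transformations from $\mathcal H$ to $\mathcal K$, $\mathcal L(\mathcal H)=\mathcal L(\mathcal H,\mathcal H)$. $P_{\mathcal M}$ is the orthogonal projection onto $\mathcal M$. $S_\infty$ is the unilateral shift of (countably) infinite multiplicity, i.e. the orthogonal sum of countably many copies of multiplication by $z$ on the Hardy space $H^2$ of the unit disc, acting on $H^2_\infty=\oplus_{k=1}^\infty H^2$. $\cong$ is unitary equivalence. A quasiaffinity is a transformation with zero kernel and dense range; $T\prec R$ means there is a quasiaffinity $X$ with $XT=RX$; $T\sim R$ means $T\prec R$ and $R\prec T$. A contraction (or power bounded operator) $T$ is of class $C_{1\cdot}$ if $\inf_n\|T^nx\|>0$ for every $x\neq0$, of class $C_{0\cdot}$ if $\|T^nx\|\to0$ for every $x$, of class $C_{\cdot a}$ if $T^*$ is of class $C_{a\cdot}$, and of class $C_{ab}$ if it is of classes $C_{a\cdot}$ and $C_{\cdot b}$. $\operatorname{Hlat}U$ is the lattice of hyperinvariant subspaces of $U$: closed subspaces $\mathcal E$ with $A\mathcal E\subset\mathcal E$ for every operator $A$ commuting with $U$. An isometric (resp. unitary) asymptote of $T\in\mathcal L(\mathcal H)$ is a pair $(X,U)$, where $U\in\mathcal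 L(\mathcal K)$ is an isometry (resp. a unitary operator) and $X\in\mathcal L(\mathcal H,\mathcal K)$ satisfies $XT=UX$, such that for any other pair $(Y,V)$, where $V\in\mathcal L(\mathcal K')$ is an isometry (resp. unitary) and $Y\in\mathcal L(\mathcal H,\mathcal K')$ satisfies $YT=VY$, there exists a unique $Z\in\mathcal L(\mathcal K,\mathcal K')$ with $ZU=VZ$ and $Y=ZX$. Power bounded operators always have isometric and unitary asymptotes, unique up to similarity. An operator $T\in\mathcal L(\mathcal H)$ with unitary asymptote $(X,U)$, $U\in\mathcal L(\mathcal K)$, is called quasianalytic if $\{x\in\mathcal H: Xx\in\mathcal E\}=\{0\}$ for every $\mathcal E\in\operatorname{Hlat}U$ with $\mathcal E\neq\mathcal K$. *)

theory Defs
  imports "HOL-Complex_Analysis.Complex_Analysis"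
begin

section \<open>Separable complex Hilbert spaces\<close>

text \<open>The inner product \<open>cinner\<close> is linear in its first argument; its real part is the real
  inner product, so norm, distance and topology are those of the library.\<close>

class complex_inner = real_inner +
  fixes scaleC :: "complex \<Rightarrow> 'a \<Rightarrow> 'a" (infixr "*\<^sub>C" 75)
    and cinner :: "'a \<Rightarrow> 'a \<Rightarrow> complex"
  assumes scaleC_add_right: "c *\<^sub>C (x + y) = c *\<^sub>C x + c *\<^sub>C y"
    and scaleC_add_left: "(c + d) *\<^sub>C x = c *\<^sub>C x + d *\<^sub>C x"
    and scaleC_scaleC: "c *\<^sub>C (d *\<^sub>C x) = (c * d) *\<^sub>C x"
    and scaleC_of_real: "complex_of_real r *\<^sub>C x = r *\<^sub>R x"
    and cinner_commute: "cinner x y = cnj (cinner y x)"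
    and cinner_add_left: "cinner (x + y) z = cinner x z + cinner y z"
    and cinner_scaleC_left: "cinner (c *\<^sub>C x) y = c * cinner x y"
    and Re_cinner: "Re (cinner x y) = inner x y"

class complex_hilbert = complex_inner + complete_space + second_countable_topology

lemma cinner_add_right: "cinner x (y + z) = cinner x y + cinner x (z::'a::complex_inner)"
  by (metis cinner_add_left cinner_commute complex_cnj_add)

lemma cinner_scaleC_right: "cinner x (c *\<^sub>C y) = cnj c * cinner x (y::'a::complex_inner)"
  by (metis cinner_scaleC_left cinner_commute complex_cnj_mult)

lemma cinner_self: "cinner x (x::'a::complex_inner) = complex_of_real ((norm x)\<^sup>2)"
proof -
  have "Im (cinner x x) = 0"
    using arg_cong[OF cinner_commute[of x x], of Im] by simp
  then show ?thesis
    by (simp add: complex_eq_iff Re_cinner power2_norm_eq_inner)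
qed

lemma norm_scaleC: "norm (c *\<^sub>C (x::'a::complex_inner)) = cmod c * norm x"
proof -
  have "complex_of_real ((norm (c *\<^sub>C x))\<^sup>2) = c * cnj c * complex_of_real ((norm x)\<^sup>2)"
    by (simp only: cinner_self[symmetric] cinner_scaleC_left cinner_scaleC_right ac_simps)
  also have "\<dots> = complex_of_real ((cmod c * norm x)\<^sup>2)"
    by (simp add: complex_mult_cnj cmod_power2 power_mult_distrib)
  finally have "(norm (c *\<^sub>C x))\<^sup>2 = (cmod c * norm x)\<^sup>2"
    by (simp only: of_real_eq_iff)
  then show ?thesis
    by (simp add: power2_eq_iff_nonneg)
qed

lemma cinner_Cauchy_Schwarz: "cmod (cinner x y) \<le> norm x * norm (y::'a::complex_inner)"
proof (cases "cinner x y = 0")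
  case False
  define c where "c = cnj (cinner x y) / complex_of_real (cmod (cinner x y))"
  have 1: "cmod c = 1" using False by (simp add: c_def norm_divide)
  have "cinner (c *\<^sub>C x) y = complex_of_real (cmod (cinner x y))"
    using False complex_norm_square[of "cinner x y"]
    by (simp add: cinner_scaleC_left c_def field_simps power2_eq_square)
  then have "cmod (cinner x y) = inner (c *\<^sub>C x) y"
    by (metis Re_cinner Re_complex_of_real)
  also have "\<dots> \<le> norm (c *\<^sub>C x) * norm y" by (rule norm_cauchy_schwarz)
  finally show ?thesis by (simp add: norm_scaleC 1)
qed simp

lemma countable_dense_imp_subbasis:
  fixes D :: "'a::metric_space set"
  assumes "countable D" and dense: "\<And>x e. e > 0 \<Longrightarrow> \<exists>d\<in>D. dist x d < e"
  shows "\<exists>B::'a set set. countable B \<and> open = generate_topology B"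
proof (intro exI conjI ext)
  let ?B = "(\<lambda>(d, n). ball d (inverse (real (Suc n)))) ` (D \<times> (UNIV::nat set))"
  show "countable ?B" using assms(1) by blast
  have open_B: "open b" if "b \<in> ?B" for b using that by auto
  fix S :: "'a set"
  show "open S = generate_topology ?B S"
  proof
    assume S: "open S"
    have basis: "\<exists>b\<in>?B. x \<in> b \<and> b \<subseteq> S" if x: "x \<in> S" for x
    proof -
      obtain e where e: "e > 0" "ball x e \<subseteq> S"
        using S x open_contains_ball by blast
      obtain n where n: "inverse (real (Suc n)) < e / 2"
        using reals_Archimedean[of "e / 2"] e by auto
      obtain d where d: "d \<in> D" "dist x d < inverse (real (Suc n))"
        using dense[of "inverse (real (Suc n))" x] by auto
      have "ball d (inverse (real (Suc n))) \<subseteq> ball x e"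
      proof
        fix z assume "z \<in> ball d (inverse (real (Suc n)))"
        then have "dist d z < inverse (real (Suc n))" by simp
        then have "dist x z < e"
          using dist_triangle[of x z d] d(2) n by linarith
        then show "z \<in> ball x e" by simp
      qed
      moreover have "x \<in> ball d (inverse (real (Suc n)))"
        using d(2) by (simp add: dist_commute)
      moreover have "ball d (inverse (real (Suc n))) \<in> ?B"
        using d(1) by (intro image_eqI[of _ _ "(d, n)"]) auto
      ultimately show ?thesis
        using e(2) by (intro bexI[of _ "ball d (inverse (real (Suc n)))"] conjI) auto
    qed
    have Union: "S = \<Union>{b\<in>B. b \<subseteq> S}"
      if "\<And>x. x \<in> S \<Longrightarrow> \<exists>b\<in>B. x \<in> b \<and> b \<subseteq> S" for B
      using that by blast
    have "S = \<Union>{b\<in>?B. b \<subseteq> S}" by (rule Union[OF basis])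
    moreover have "generate_topology ?B (\<Union>{b\<in>?B. b \<subseteq> S})"
      by (intro generate_topology.UN generate_topology.Basis) blast
    ultimately show "generate_topology ?B S" by simp
  next
    assume "generate_topology ?B S"
    then show "open S"
      by induction (auto intro: open_B)
  qed
qed

instantiation complex :: complex_hilbert
begin

definition scaleC_complex :: "complex \<Rightarrow> complex \<Rightarrow> complex"
  where "scaleC_complex c z = c * z"

definition cinner_complex :: "complex \<Rightarrow> complex \<Rightarrow> complex"
  where "cinner_complex z w = z * cnj w"

instance
  by standard
    (simp_all add: scaleC_complex_def cinner_complex_def algebra_simps scaleR_conv_of_real
      inner_complex_def)

end

instantiation prod :: (complex_inner, complex_inner) complex_inner
begin

definition scaleC_prod :: "complex \<Rightarrow> 'a \<times> 'b \<Rightarrow> 'a \<times> 'b"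
  where "scaleC_prod c p = (c *\<^sub>C fst p, c *\<^sub>C snd p)"

definition cinner_prod :: "'a \<times> 'b \<Rightarrow> 'a \<times> 'b \<Rightarrow> complex"
  where "cinner_prod p q = cinner (fst p) (fst q) + cinner (snd p) (snd q)"

instance
proof
  fix x y :: "'a \<times> 'b"
  show "cinner x y = cnj (cinner y x)"
    unfolding cinner_prod_def complex_cnj_add by (simp only: cinner_commute[symmetric])
qed (simp_all add: scaleC_prod_def cinner_prod_def scaleC_add_right scaleC_add_left
    scaleC_scaleC scaleC_of_real cinner_add_left cinner_scaleC_left Re_cinner
    inner_prod_def prod_eq_iff algebra_simps)

end

instance prod :: (complex_hilbert, complex_hilbert) complex_hilbert ..

section \<open>Countable orthogonal sums\<close>

typedef (overloaded) 'a hsum =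
  "{x :: nat \<Rightarrow> 'a::complex_inner. summable (\<lambda>k. (norm (x k))\<^sup>2)}"
  morphisms hsum_nth Abs_hsum
  by (rule exI[of _ "\<lambda>_. 0"]) simp

setup_lifting type_definition_hsum

lemma summable_hsum: "summable (\<lambda>k. (norm (hsum_nth x k))\<^sup>2)"
  using hsum_nth[of x] by simp

lemma hsum_eqI: "(\<And>k. hsum_nth x k = hsum_nth y k) \<Longrightarrow> x = y"
  by (metis ext hsum_nth_inject)

lemma summable_norm_add_sq:
  fixes x y :: "nat \<Rightarrow> 'a::real_inner"
  assumes "summable (\<lambda>k. (norm (x k))\<^sup>2)" "summable (\<lambda>k. (norm (y k))\<^sup>2)"
  shows "summable (\<lambda>k. (norm (x k + y k))\<^sup>2)"
proof (rule summable_comparison_test')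
  show "summable (\<lambda>k. 2 * (norm (x k))\<^sup>2 + 2 * (norm (y k))\<^sup>2)"
    by (intro summable_add summable_mult assms)
  fix k
  have "(norm (x k + y k))\<^sup>2 \<le> (norm (x k) + norm (y k))\<^sup>2"
    by (intro power_mono norm_triangle_ineq norm_ge_zero)
  also have "\<dots> \<le> 2 * (norm (x k))\<^sup>2 + 2 * (norm (y k))\<^sup>2"
    using zero_le_power2[of "norm (x k) - norm (y k)"]
    by (simp add: power2_eq_square algebra_simps)
  finally show "norm ((norm (x k + y k))\<^sup>2) \<le> 2 * (norm (x k))\<^sup>2 + 2 * (norm (y k))\<^sup>2"
    by simp
qed

instantiation hsum :: (complex_inner) real_vector
begin

lift_definition zero_hsum :: "'a hsum" is "\<lambda>_. 0" by simp
lift_definition plus_hsum :: "'a hsum \<Rightarrow> 'a hsum \<Rightarrow> 'a hsum" is "\<lambda>x y k. x k + y k"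
  by (rule summable_norm_add_sq)
lift_definition uminus_hsum :: "'a hsum \<Rightarrow> 'a hsum" is "\<lambda>x k. - x k" by simp
lift_definition minus_hsum :: "'a hsum \<Rightarrow> 'a hsum \<Rightarrow> 'a hsum" is "\<lambda>x y k. x k - y k"
  using summable_norm_add_sq[of _ "\<lambda>k. - _ k"] by simp
lift_definition scaleR_hsum :: "real \<Rightarrow> 'a hsum \<Rightarrow> 'a hsum" is "\<lambda>r x k. r *\<^sub>R x k"
  by (simp add: power_mult_distrib summable_mult)

instance
  by standard (transfer; simp add: fun_eq_iff algebra_simps)+

end

lemma summable_cinner_hsum: "summable (\<lambda>k. cinner (hsum_nth x k) (hsum_nth y k))"
proof (rule summable_comparison_test')
  show "summable (\<lambda>k. (norm (hsum_nth x k))\<^sup>2 + (norm (hsum_nth y k))\<^sup>2)"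
    by (intro summable_add summable_hsum)
  fix k
  let ?a = "norm (hsum_nth x k)" and ?b = "norm (hsum_nth y k)"
  have "cmod (cinner (hsum_nth x k) (hsum_nth y k)) \<le> ?a * ?b"
    by (rule cinner_Cauchy_Schwarz)
  also have "\<dots> \<le> ?a\<^sup>2 + ?b\<^sup>2"
  proof -
    have "0 \<le> ?a * ?b" by simp
    then show ?thesis
      using zero_le_power2[of "?a - ?b"] unfolding power2_diff by linarith
  qed
  finally show "norm (cinner (hsum_nth x k) (hsum_nth y k)) \<le> ?a\<^sup>2 + ?b\<^sup>2" .
qed

lemma summable_inner_hsum: "summable (\<lambda>k. inner (hsum_nth x k) (hsum_nth y k))"
  using summable_Re[OF summable_cinner_hsum[of x y]] by (simp add: Re_cinner)

instantiation hsum :: (complex_inner) real_inner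
begin

definition inner_hsum :: "'a hsum \<Rightarrow> 'a hsum \<Rightarrow> real"
  where "inner_hsum x y = (\<Sum>k. inner (hsum_nth x k) (hsum_nth y k))"
definition norm_hsum :: "'a hsum \<Rightarrow> real"
  where "norm_hsum x = sqrt (inner x x)"
definition sgn_hsum :: "'a hsum \<Rightarrow> 'a hsum"
  where "sgn_hsum x = inverse (norm x) *\<^sub>R x"
definition dist_hsum :: "'a hsum \<Rightarrow> 'a hsum \<Rightarrow> real"
  where "dist_hsum x y = norm (x - y)"
definition uniformity_hsum :: "('a hsum \<times> 'a hsum) filter"
  where "uniformity_hsum = (INF e\<in>{0<..}. principal {(x, y). dist x y < e})"
definition open_hsum :: "'a hsum set \<Rightarrow> bool"
  where "open_hsum U \<longleftrightarrow> (\<forall>x\<in>U. eventually (\<lambda>(x', y). x' = x \<longrightarrow> y \<in> U) uniformity)"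

instance
proof
  fix x y z :: "'a hsum" and r :: real and U :: "'a hsum set"
  show "inner x y = inner y x"
    by (simp add: inner_hsum_def inner_commute)
  show "inner (x + y) z = inner x z + inner y z"
    by (simp add: inner_hsum_def plus_hsum.rep_eq inner_add_left
        suminf_add[symmetric] summable_inner_hsum)
  show "inner (r *\<^sub>R x) y = r * inner x y"
    by (simp add: inner_hsum_def scaleR_hsum.rep_eq suminf_mult summable_inner_hsum)
  show "0 \<le> inner x x"
    by (simp add: inner_hsum_def suminf_nonneg summable_inner_hsum)
  have "inner x x = 0 \<longleftrightarrow> (\<forall>k. inner (hsum_nth x k) (hsum_nth x k) = 0)"
    unfolding inner_hsum_def by (rule suminf_eq_zero_iff[OF summable_inner_hsum]) simp
  also have "\<dots> \<longleftrightarrow> x = 0"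
    by (auto simp: zero_hsum.rep_eq intro: hsum_eqI)
  finally show "inner x x = 0 \<longleftrightarrow> x = 0" .
qed (simp_all add: norm_hsum_def sgn_hsum_def dist_hsum_def uniformity_hsum_def open_hsum_def)

end

lemma norm_hsum_sq: "(norm x)\<^sup>2 = (\<Sum>k. (norm (hsum_nth x k))\<^sup>2)"
  by (simp add: power2_norm_eq_inner inner_hsum_def)

instantiation hsum :: (complex_inner) complex_inner
begin

lift_definition scaleC_hsum :: "complex \<Rightarrow> 'a hsum \<Rightarrow> 'a hsum" is "\<lambda>c x k. c *\<^sub>C x k"
  by (simp add: norm_scaleC power_mult_distrib summable_mult)

definition cinner_hsum :: "'a hsum \<Rightarrow> 'a hsum \<Rightarrow> complex"
  where "cinner_hsum x y = (\<Sum>k. cinner (hsum_nth x k) (hsum_nth y k))"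

instance
proof
  fix x y z :: "'a hsum" and c d :: complex and r :: real
  show "c *\<^sub>C (x + y) = c *\<^sub>C x + c *\<^sub>C y"
    by transfer (simp add: scaleC_add_right)
  show "(c + d) *\<^sub>C x = c *\<^sub>C x + d *\<^sub>C x"
    by transfer (simp add: scaleC_add_left)
  show "c *\<^sub>C (d *\<^sub>C x) = (c * d) *\<^sub>C x"
    by transfer (simp add: scaleC_scaleC)
  show "complex_of_real r *\<^sub>C x = r *\<^sub>R x"
    by transfer (simp add: scaleC_of_real)
  have "cnj (cinner y x) = (\<Sum>k. cnj (cinner (hsum_nth y k) (hsum_nth x k)))"
    unfolding cinner_hsum_def
    by (rule bounded_linear.suminf[OF bounded_linear_cnj summable_cinner_hsum])
  then show "cinner x y = cnj (cinner y x)"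
    by (simp add: cinner_hsum_def cinner_commute[symmetric])
  show "cinner (x + y) z = cinner x z + cinner y z"
    by (simp add: cinner_hsum_def plus_hsum.rep_eq cinner_add_left
        suminf_add[symmetric] summable_cinner_hsum)
  show "cinner (c *\<^sub>C x) y = c * cinner x y"
    by (simp add: cinner_hsum_def scaleC_hsum.rep_eq cinner_scaleC_left
        suminf_mult summable_cinner_hsum)
  show "Re (cinner x y) = inner x y"
    by (simp add: cinner_hsum_def inner_hsum_def Re_suminf summable_cinner_hsum Re_cinner)
qed

end

lemma sum_norm_sq_le_hsum: "(\<Sum>k<n. (norm (hsum_nth x k))\<^sup>2) \<le> (norm x)\<^sup>2"
  unfolding norm_hsum_sq by (rule sum_le_suminf[OF summable_hsum]) auto

lemma norm_hsum_nth_le: "norm (hsum_nth x k) \<le> norm x"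
proof -
  have "(norm (hsum_nth x k))\<^sup>2 \<le> (\<Sum>j<Suc k. (norm (hsum_nth x j))\<^sup>2)"
    by (simp add: sum_nonneg)
  also have "\<dots> \<le> (norm x)\<^sup>2" by (rule sum_norm_sq_le_hsum)
  finally show ?thesis by (simp add: power2_le_iff_abs_le)
qed

instance hsum :: (complex_hilbert) complex_hilbert
proof
  fix X :: "nat \<Rightarrow> 'a hsum" assume X: "Cauchy X"
  have "Cauchy (\<lambda>n. hsum_nth (X n) k)" for k
  proof (rule metric_CauchyI)
    fix e :: real assume "e > 0"
    then obtain M where M: "\<And>m n. m \<ge> M \<Longrightarrow> n \<ge> M \<Longrightarrow> dist (X m) (X n) < e"
      using metric_CauchyD[OF X] by blast
    have "dist (hsum_nth (X m) k) (hsum_nth (X n) k) < e" if "m \<ge> M" "n \<ge> M" for m n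
      using norm_hsum_nth_le[of "X m - X n" k] M[OF that]
      by (simp add: dist_norm minus_hsum.rep_eq)
    then show "\<exists>M. \<forall>m\<ge>M. \<forall>n\<ge>M. dist (hsum_nth (X m) k) (hsum_nth (X n) k) < e" by blast
  qed
  then have "\<forall>k. \<exists>l. (\<lambda>n. hsum_nth (X n) k) \<longlonglongrightarrow> l"
    using Cauchy_convergent convergent_def by blast
  then obtain L where L: "\<And>k. (\<lambda>n. hsum_nth (X n) k) \<longlonglongrightarrow> L k" by metis
  have bound: "(\<Sum>k<j. (norm (hsum_nth (X m) k - L k))\<^sup>2) \<le> e\<^sup>2"
    if "e > 0" and M: "\<And>m n. m \<ge> M \<Longrightarrow> n \<ge> M \<Longrightarrow> dist (X m) (X n) < e" and "m \<ge> M"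
    for e M m j
  proof (rule tendsto_upperbound)
    show "(\<lambda>n. \<Sum>k<j. (norm (hsum_nth (X m) k - hsum_nth (X n) k))\<^sup>2)
        \<longlonglongrightarrow> (\<Sum>k<j. (norm (hsum_nth (X m) k - L k))\<^sup>2)"
      by (intro tendsto_intros L)
    have "(\<Sum>k<j. (norm (hsum_nth (X m) k - hsum_nth (X n) k))\<^sup>2) \<le> e\<^sup>2" if "n \<ge> M" for n
    proof -
      have "(\<Sum>k<j. (norm (hsum_nth (X m) k - hsum_nth (X n) k))\<^sup>2) \<le> (norm (X m - X n))\<^sup>2"
        using sum_norm_sq_le_hsum[of "X m - X n" j] by (simp add: minus_hsum.rep_eq)
      also have "\<dots> \<le> e\<^sup>2"
        using M[OF \<open>m \<ge> M\<close> that] by (intro power_mono) (simp_all add: dist_norm)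
      finally show ?thesis .
    qed
    then show "\<forall>\<^sub>F n in sequentially.
        (\<Sum>k<j. (norm (hsum_nth (X m) k - hsum_nth (X n) k))\<^sup>2) \<le> e\<^sup>2"
      by (auto simp: eventually_sequentially)
  qed simp
  have summ: "summable (\<lambda>k. (norm (hsum_nth (X m) k - L k))\<^sup>2)"
    if "e > 0" and M: "\<And>m n. m \<ge> M \<Longrightarrow> n \<ge> M \<Longrightarrow> dist (X m) (X n) < e" and "m \<ge> M"
    for e M m
    by (rule bounded_imp_summable[where B = "e\<^sup>2"])
      (use bound[OF that, of "Suc _"] in \<open>simp_all add: lessThan_Suc_atMost\<close>)
  obtain M1 where M1: "\<And>m n. m \<ge> M1 \<Longrightarrow> n \<ge> M1 \<Longrightarrow> dist (X m) (X n) < 1"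
    using metric_CauchyD[OF X, of 1] by auto
  have "summable (\<lambda>k. (norm (hsum_nth (X M1) k + - (hsum_nth (X M1) k - L k)))\<^sup>2)"
  proof (intro summable_norm_add_sq summable_hsum)
    show "summable (\<lambda>k. (norm (- (hsum_nth (X M1) k - L k)))\<^sup>2)"
      unfolding norm_minus_cancel by (rule summ[of 1 M1 M1]) (use M1 in auto)
  qed
  then have "summable (\<lambda>k. (norm (L k))\<^sup>2)" by simp
  then have nth: "hsum_nth (Abs_hsum L) = L" by (simp add: Abs_hsum_inverse)
  have "X \<longlonglongrightarrow> Abs_hsum L"
  proof (rule metric_LIMSEQ_I)
    fix r :: real assume r: "r > 0"
    then obtain M where M: "\<And>m n. m \<ge> M \<Longrightarrow> n \<ge> M \<Longrightarrow> dist (X m) (X n) < r / 2"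
      using metric_CauchyD[OF X, of "r / 2"] by auto
    have "dist (X m) (Abs_hsum L) < r" if m: "m \<ge> M" for m
    proof -
      have "(norm (X m - Abs_hsum L))\<^sup>2 \<le> (r / 2)\<^sup>2"
        unfolding norm_hsum_sq minus_hsum.rep_eq nth
        by (rule suminf_le_const[OF summ[OF _ M m] bound[OF _ M m]]) (use r in simp_all)
      then have "norm (X m - Abs_hsum L) \<le> r / 2"
        using r by (simp add: power2_le_iff_abs_le)
      then show ?thesis using r by (simp add: dist_norm)
    qed
    then show "\<exists>M. \<forall>m\<ge>M. dist (X m) (Abs_hsum L) < r" by blast
  qed
  then show "convergent X" by (auto simp: convergent_def)
next
  obtain D :: "'a set" where D: "countable D" "\<And>S. open S \<Longrightarrow> S \<noteq> {} \<Longrightarrow> \<exists>d\<in>D. d \<in> S"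
    using countable_dense_exists by blast
  define emb :: "'a list \<Rightarrow> 'a hsum"
    where "emb l = Abs_hsum (\<lambda>k. if k < length l then l ! k else 0)" for l
  have nth_emb: "hsum_nth (emb l) = (\<lambda>k. if k < length l then l ! k else 0)" for l
  proof -
    have "summable (\<lambda>k. (norm (if k < length l then l ! k else 0))\<^sup>2)"
      by (rule summable_finite[of "{..<length l}"]) auto
    then show ?thesis by (simp add: emb_def Abs_hsum_inverse)
  qed
  show "\<exists>B::'a hsum set set. countable B \<and> open = generate_topology B"
  proof (rule countable_dense_imp_subbasis)
    show "countable (emb ` lists D)" using D(1) by auto
    fix x :: "'a hsum" and e :: real assume e: "e > 0"
    have "0 < e\<^sup>2 / 2" using e by simp
    from suminf_exist_split[OF this summable_hsum]
    obtain N where "norm (\<Sum>i. (norm (hsum_nth x (i + N)))\<^sup>2) < e\<^sup>2 / 2" by blast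
    then have N: "(\<Sum>i. (norm (hsum_nth x (i + N)))\<^sup>2) < e\<^sup>2 / 2"
      unfolding real_norm_def by linarith
    define \<delta> where "\<delta> = e / (2 * sqrt (real (Suc N)))"
    have \<delta>: "\<delta> > 0" using e by (simp add: \<delta>_def)
    have "\<delta>\<^sup>2 = e\<^sup>2 / (4 * real (Suc N))"
      by (simp add: \<delta>_def power_divide power_mult_distrib)
    also have "\<dots> * real N = e\<^sup>2 / 4 * (real N / real (Suc N))" by simp
    also have "\<dots> \<le> e\<^sup>2 / 4 * 1" by (intro mult_left_mono) auto
    finally have \<delta>N: "\<delta>\<^sup>2 * real N \<le> e\<^sup>2 / 4" by simp
    have "\<exists>d. d \<in> D \<and> dist (hsum_nth x k) d < \<delta>" for k
      using D(2)[of "ball (hsum_nth x k) \<delta>"] \<delta> by (auto simp: Bex_def)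
    then obtain d where d: "\<And>k. d k \<in> D" "\<And>k. dist (hsum_nth x k) (d k) < \<delta>"
      by metis
    let ?l = "map d [0..<N]"
    let ?f = "\<lambda>k. (norm (hsum_nth (x - emb ?l) k))\<^sup>2"
    have "(norm (x - emb ?l))\<^sup>2 = (\<Sum>i. ?f (i + N)) + (\<Sum>i<N. ?f i)"
      unfolding norm_hsum_sq by (rule suminf_split_initial_segment[OF summable_hsum])
    also have "(\<Sum>i. ?f (i + N)) = (\<Sum>i. (norm (hsum_nth x (i + N)))\<^sup>2)"
      by (simp add: minus_hsum.rep_eq nth_emb)
    also have "(\<Sum>i<N. ?f i) \<le> (\<Sum>i<N. \<delta>\<^sup>2)"
    proof (rule sum_mono)
      fix i assume "i \<in> {..<N}"
      then show "?f i \<le> \<delta>\<^sup>2"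
        using d(2)[of i] by (simp add: minus_hsum.rep_eq nth_emb dist_norm power_mono)
    qed
    also have "(\<Sum>i<N. \<delta>\<^sup>2) \<le> e\<^sup>2 / 4" using \<delta>N by (simp add: mult.commute)
    finally have "(norm (x - emb ?l))\<^sup>2 < e\<^sup>2"
      using N e zero_less_power[OF e, of 2] by linarith
    then have "dist x (emb ?l) < e"
      using e by (simp add: dist_norm power2_less_imp_less)
    then show "\<exists>d\<in>emb ` lists D. dist x d < e"
      using d(1) by (intro bexI[of _ "emb ?l"] imageI) auto
  qed
qed

type_synonym ell2 = "complex hsum"

section \<open>The Hardy space of the disc and the shift of infinite multiplicity\<close>

text \<open>The functions are set to \<open>0\<close> off the open unit disc, so that equality of elements of the
  type is equality of functions on the disc.\<close>

definition taylor :: "(complex \<Rightarrow> complex) \<Rightarrow> nat \<Rightarrow> complex"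
  where "taylor f n = (deriv ^^ n) f 0 / fact n"

typedef hardy =
  "{f :: complex \<Rightarrow> complex. f holomorphic_on ball 0 1 \<and> (\<forall>z. z \<notin> ball 0 1 \<longrightarrow> f z = 0)
      \<and> summable (\<lambda>n. (cmod (taylor f n))\<^sup>2)}"
  morphisms hardy_fun Abs_hardy
proof (intro exI CollectI conjI)
  have "taylor (\<lambda>_. 0) n = 0" for n
    unfolding taylor_def by (cases n) (simp_all add: higher_deriv_const)
  then show "summable (\<lambda>n. (cmod (taylor (\<lambda>_. 0) n))\<^sup>2)" by simp
qed auto

setup_lifting type_definition_hardy

lemma hardy_holomorphic: "hardy_fun f holomorphic_on ball 0 1"
  and hardy_zero_outside: "z \<notin> ball 0 1 \<Longrightarrow> hardy_fun f z = 0"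
  and summable_hardy: "summable (\<lambda>n. (cmod (taylor (hardy_fun f) n))\<^sup>2)"
  using hardy_fun[of f] by auto

lemma taylor_add:
  assumes "f holomorphic_on ball 0 1" "g holomorphic_on ball 0 1"
  shows "taylor (\<lambda>z. f z + g z) n = taylor f n + taylor g n"
  unfolding taylor_def
  by (subst higher_deriv_add[OF assms]) (simp_all add: add_divide_distrib)

lemma taylor_cmult:
  assumes "f holomorphic_on ball 0 1"
  shows "taylor (\<lambda>z. c * f z) n = c * taylor f n"
  unfolding taylor_def by (subst higher_deriv_cmult[OF assms]) simp_all

lemma taylor_mult_z:
  assumes "f holomorphic_on ball 0 1"
  shows "taylor (\<lambda>z. z * f z) 0 = 0" "taylor (\<lambda>z. z * f z) (Suc n) = taylor f n"
proof -
  show "taylor (\<lambda>z. z * f z) 0 = 0" by (simp add: taylor_def)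
  have "(deriv ^^ Suc n) (\<lambda>z. z * f z) 0 =
      (\<Sum>i = 0..Suc n. of_nat (Suc n choose i) * (deriv ^^ i) (\<lambda>w. w) 0 * (deriv ^^ (Suc n - i)) f 0)"
    by (rule higher_deriv_mult[of _ "ball 0 1"]) (use assms in auto)
  also have "\<dots> = (\<Sum>i\<in>{1}. of_nat (Suc n choose i) * (deriv ^^ i) (\<lambda>w. w) 0 * (deriv ^^ (Suc n - i)) f 0)"
    by (rule sum.mono_neutral_right) auto
  also have "\<dots> = of_nat (Suc n) * (deriv ^^ n) f 0" by simp
  finally show "taylor (\<lambda>z. z * f z) (Suc n) = taylor f n"
    by (simp add: taylor_def divide_simps del: of_nat_Suc)
qed

lemma taylor_power_series:
  assumes "f holomorphic_on ball 0 1" "z \<in> ball 0 1"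
  shows "(\<lambda>n. taylor f n * z ^ n) sums f z"
  using holomorphic_power_series[OF assms] by (simp add: taylor_def)

lemma hardy_eqI:
  assumes "\<And>n. taylor (hardy_fun f) n = taylor (hardy_fun g) n"
  shows "f = g"
proof -
  have "hardy_fun f z = hardy_fun g z" for z
  proof (cases "z \<in> ball 0 1")
    case True
    then show ?thesis
      using taylor_power_series[OF hardy_holomorphic[of f] True]
        taylor_power_series[OF hardy_holomorphic[of g] True] assms
      by (simp add: sums_unique2)
  qed (simp add: hardy_zero_outside)
  then show ?thesis by (metis ext hardy_fun_inject)
qed

instantiation hardy :: real_vector
begin

lift_definition zero_hardy :: hardy is "\<lambda>_. 0"
proof -
  have "taylor (\<lambda>_. 0) n = 0" for n
    using taylor_cmult[of "\<lambda>_. 0" 0 n] by simp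
  then show "?thesis" by simp
qed

lift_definition plus_hardy :: "hardy \<Rightarrow> hardy \<Rightarrow> hardy" is "\<lambda>f g z. f z + g z"
  by (auto intro!: holomorphic_intros simp: taylor_add summable_norm_add_sq)

lift_definition scaleR_hardy :: "real \<Rightarrow> hardy \<Rightarrow> hardy" is "\<lambda>r f z. complex_of_real r * f z"
  by (auto intro!: holomorphic_intros summable_mult
      simp: taylor_cmult norm_mult power_mult_distrib)

definition uminus_hardy :: "hardy \<Rightarrow> hardy" where "uminus_hardy f = (- 1) *\<^sub>R f"
definition minus_hardy :: "hardy \<Rightarrow> hardy \<Rightarrow> hardy" where "minus_hardy f g = f + - g"

instance
proof
  fix f g :: hardy
  show "f - g = f + - g" by (rule minus_hardy_def)
  show "- f + f = 0"
    unfolding uminus_hardy_def by transfer auto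
qed (transfer; simp add: fun_eq_iff algebra_simps)+

end

text \<open>The isometry of \<open>H\<^sup>2\<close> onto \<open>\<ell>\<^sup>2\<close> given by the Taylor coefficients; the inner product of
  \<open>H\<^sup>2\<close> is defined by it.\<close>

lift_definition hardy_coeffs :: "hardy \<Rightarrow> ell2" is taylor by simp

lemma hardy_coeffs_inject: "hardy_coeffs f = hardy_coeffs g \<longleftrightarrow> f = g"
  by (metis hardy_coeffs.rep_eq hardy_eqI)

lemma hardy_coeffs_add: "hardy_coeffs (f + g) = hardy_coeffs f + hardy_coeffs g"
  by (rule hsum_eqI)
    (simp add: hardy_coeffs.rep_eq plus_hsum.rep_eq plus_hardy.rep_eq taylor_add hardy_holomorphic)

lemma hardy_coeffs_scaleR: "hardy_coeffs (r *\<^sub>R f) = r *\<^sub>R hardy_coeffs f"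
  by (rule hsum_eqI)
    (simp add: hardy_coeffs.rep_eq scaleR_hsum.rep_eq scaleR_hardy.rep_eq taylor_cmult
      hardy_holomorphic scaleR_conv_of_real)

lemma hardy_coeffs_diff: "hardy_coeffs (f - g) = hardy_coeffs f - hardy_coeffs g"
  using hardy_coeffs_add[of f "(- 1) *\<^sub>R g"] hardy_coeffs_scaleR[of "- 1" g] by simp

lemma hardy_coeffs_zero: "hardy_coeffs 0 = 0"
  using hardy_coeffs_scaleR[of 0 0] by simp

instantiation hardy :: complex_inner
begin

lift_definition scaleC_hardy :: "complex \<Rightarrow> hardy \<Rightarrow> hardy" is "\<lambda>c f z. c * f z"
  by (auto intro!: holomorphic_intros summable_mult
      simp: taylor_cmult norm_mult power_mult_distrib)

definition cinner_hardy :: "hardy \<Rightarrow> hardy \<Rightarrow> complex"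
  where "cinner_hardy f g = (\<Sum>n. taylor (hardy_fun f) n * cnj (taylor (hardy_fun g) n))"
definition inner_hardy :: "hardy \<Rightarrow> hardy \<Rightarrow> real"
  where "inner_hardy f g = Re (cinner f g)"
definition norm_hardy :: "hardy \<Rightarrow> real"
  where "norm_hardy f = sqrt (inner f f)"
definition sgn_hardy :: "hardy \<Rightarrow> hardy"
  where "sgn_hardy f = inverse (norm f) *\<^sub>R f"
definition dist_hardy :: "hardy \<Rightarrow> hardy \<Rightarrow> real"
  where "dist_hardy f g = norm (f - g)"
definition uniformity_hardy :: "(hardy \<times> hardy) filter"
  where "uniformity_hardy = (INF e\<in>{0<..}. principal {(f, g). dist f g < e})"
definition open_hardy :: "hardy set \<Rightarrow> bool"
  where "open_hardy U \<longleftrightarrow> (\<forall>f\<in>U. eventually (\<lambda>(f', g). f' = f \<longrightarrow> g \<in> U) uniformity)"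

lemma cinner_hardy_coeffs: "cinner f g = cinner (hardy_coeffs f) (hardy_coeffs g)"
  by (simp add: cinner_hardy_def cinner_hsum_def cinner_complex_def hardy_coeffs.rep_eq)

lemma inner_hardy_coeffs: "inner f g = inner (hardy_coeffs f) (hardy_coeffs g)"
  by (simp add: inner_hardy_def cinner_hardy_coeffs Re_cinner)

lemma hardy_coeffs_scaleC: "hardy_coeffs (c *\<^sub>C f) = c *\<^sub>C hardy_coeffs f"
  by (rule hsum_eqI)
    (simp add: hardy_coeffs.rep_eq scaleC_hsum.rep_eq scaleC_hardy.rep_eq taylor_cmult
      hardy_holomorphic scaleC_complex_def)

instance
proof
  fix f g h :: hardy and c d :: complex and r :: real
  show "inner f g = inner g f"
    by (simp add: inner_hardy_coeffs inner_commute)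
  show "inner (f + g) h = inner f h + inner g h"
    by (simp add: inner_hardy_coeffs hardy_coeffs_add inner_add_left)
  show "inner (r *\<^sub>R f) g = r * inner f g"
    by (simp add: inner_hardy_coeffs hardy_coeffs_scaleR)
  show "0 \<le> inner f f"
    by (simp add: inner_hardy_coeffs)
  show "inner f f = 0 \<longleftrightarrow> f = 0"
    using hardy_coeffs_inject[of f 0] by (simp add: inner_hardy_coeffs hardy_coeffs_zero)
  show "c *\<^sub>C (f + g) = c *\<^sub>C f + c *\<^sub>C g"
    by transfer (simp add: algebra_simps)
  show "(c + d) *\<^sub>C f = c *\<^sub>C f + d *\<^sub>C f"
    by transfer (simp add: algebra_simps)
  show "c *\<^sub>C (d *\<^sub>C f) = (c * d) *\<^sub>C f"
    by transfer (simp add: algebra_simps)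
  show "complex_of_real r *\<^sub>C f = r *\<^sub>R f"
    by transfer simp
  show "cinner f g = cnj (cinner g f)"
    unfolding cinner_hardy_coeffs by (rule cinner_commute)
  show "cinner (f + g) h = cinner f h + cinner g h"
    by (simp add: cinner_hardy_coeffs hardy_coeffs_add cinner_add_left)
  show "cinner (c *\<^sub>C f) g = c * cinner f g"
    by (simp add: cinner_hardy_coeffs hardy_coeffs_scaleC cinner_scaleC_left)
  show "Re (cinner f g) = inner f g"
    by (simp add: inner_hardy_def)
qed (simp_all add: norm_hardy_def sgn_hardy_def dist_hardy_def uniformity_hardy_def open_hardy_def)

end

lemma norm_hardy_coeffs: "norm (hardy_coeffs f) = norm f"
  by (simp add: norm_eq_sqrt_inner inner_hardy_coeffs)

lemma dist_hardy_coeffs: "dist (hardy_coeffs f) (hardy_coeffs g) = dist f g"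
  by (simp add: dist_norm norm_hardy_coeffs flip: hardy_coeffs_diff)

lemma surj_hardy_coeffs: "surj hardy_coeffs"
proof (rule surjI)
  fix a :: ell2
  define F where "F = Abs_fps (hsum_nth a)"
  have a_le: "cmod (hsum_nth a n) \<le> norm a" for n by (rule norm_hsum_nth_le)
  have sums: "summable (\<lambda>n. hsum_nth a n * z ^ n)" if "cmod z < 1" for z
  proof (rule summable_comparison_test')
    show "summable (\<lambda>n. norm a * cmod z ^ n)"
      using that by (intro summable_mult summable_geometric) simp
    show "norm (hsum_nth a n * z ^ n) \<le> norm a * cmod z ^ n" for n
      by (simp add: norm_mult norm_power mult_right_mono a_le)
  qed
  have radius: "fps_conv_radius F \<ge> 1"
    unfolding fps_conv_radius_def
  proof (rule conv_radius_geI_ex)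
    fix r :: real assume "0 < r" "ereal r < 1"
    then show "\<exists>z. norm z = r \<and> summable (\<lambda>n. fps_nth F n * z ^ n)"
      by (intro exI[of _ "complex_of_real r"]) (simp add: F_def sums)
  qed
  define f where "f z = (if z \<in> ball 0 1 then eval_fps F z else 0)" for z
  have "eval_fps F holomorphic_on ball 0 1"
    using radius by (intro holomorphic_on_eval_fps) (force simp: in_eball_iff
        intro: less_le_trans[of _ 1])
  then have hol: "f holomorphic_on ball 0 1"
    by (rule holomorphic_transform) (simp add: f_def)
  have "f has_fps_expansion F"
    unfolding has_fps_expansion_def
  proof
    show "0 < fps_conv_radius F" by (rule less_le_trans[OF _ radius]) simp
    have "\<forall>\<^sub>F z in nhds 0. z \<in> ball 0 (1::real)"
      by (rule eventually_nhds_in_open) auto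
    then show "\<forall>\<^sub>F z in nhds 0. eval_fps F z = f z"
      by eventually_elim (simp add: f_def)
  qed
  then have tay: "taylor f = hsum_nth a"
    by (simp add: fun_eq_iff taylor_def F_def flip: fps_nth_fps_expansion)
  have "hardy_fun (Abs_hardy f) = f"
    using hol summable_hsum[of a] by (intro Abs_hardy_inverse) (simp add: f_def tay)
  then show "hardy_coeffs (Abs_hardy f) = a"
    by (intro hsum_eqI) (simp add: hardy_coeffs.rep_eq tay)
qed

instance hardy :: complex_hilbert
proof
  fix X :: "nat \<Rightarrow> hardy" assume "Cauchy X"
  then have "Cauchy (\<lambda>n. hardy_coeffs (X n))"
    by (simp add: Cauchy_def dist_hardy_coeffs)
  then obtain a where "(\<lambda>n. hardy_coeffs (X n)) \<longlonglongrightarrow> a"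
    using Cauchy_convergent convergent_def by blast
  moreover obtain f where "a = hardy_coeffs f" using surj_hardy_coeffs by (metis surjD)
  ultimately have "X \<longlonglongrightarrow> f" by (simp add: lim_sequentially dist_hardy_coeffs)
  then show "convergent X" by (auto simp: convergent_def)
next
  obtain D :: "ell2 set" where D: "countable D" "\<And>S. open S \<Longrightarrow> S \<noteq> {} \<Longrightarrow> \<exists>d\<in>D. d \<in> S"
    using countable_dense_exists by blast
  show "\<exists>B::hardy set set. countable B \<and> open = generate_topology B"
  proof (rule countable_dense_imp_subbasis)
    show "countable (inv hardy_coeffs ` D)" using D(1) by blast
    fix f :: hardy and e :: real assume "e > 0"
    then obtain d where d: "d \<in> D" "d \<in> ball (hardy_coeffs f) e"
      using D(2)[of "ball (hardy_coeffs f) e"] by auto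
    moreover have "hardy_coeffs (inv hardy_coeffs d) = d"
      by (rule surj_f_inv_f[OF surj_hardy_coeffs])
    ultimately show "\<exists>d\<in>inv hardy_coeffs ` D. dist f d < e"
      by (intro bexI[of _ "inv hardy_coeffs d"]) (auto simp flip: dist_hardy_coeffs)
  qed
qed

lift_definition mult_z :: "hardy \<Rightarrow> hardy" is "\<lambda>f z. z * f z"
proof (intro conjI)
  fix f :: "complex \<Rightarrow> complex"
  assume f: "f holomorphic_on ball 0 1 \<and> (\<forall>z. z \<notin> ball 0 1 \<longrightarrow> f z = 0)
    \<and> summable (\<lambda>n. (cmod (taylor f n))\<^sup>2)"
  then show "(\<lambda>z. z * f z) holomorphic_on ball 0 1" by (auto intro!: holomorphic_intros)
  show "\<forall>z. z \<notin> ball 0 1 \<longrightarrow> z * f z = 0" using f by auto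
  have "summable (\<lambda>n. (cmod (taylor (\<lambda>z. z * f z) (Suc n)))\<^sup>2)"
    using f by (simp add: taylor_mult_z)
  then show "summable (\<lambda>n. (cmod (taylor (\<lambda>z. z * f z) n))\<^sup>2)"
    by (subst (asm) summable_Suc_iff)
qed

lemma norm_mult_z: "norm (mult_z f) = norm f"
proof -
  let ?t = "taylor (hardy_fun f)" and ?s = "taylor (hardy_fun (mult_z f))"
  have s: "?s 0 = 0" "?s (Suc n) = ?t n" for n
    by (simp_all add: mult_z.rep_eq taylor_mult_z hardy_holomorphic)
  have "(norm (mult_z f))\<^sup>2 = (\<Sum>n. (cmod (?s n))\<^sup>2)"
    by (simp add: norm_hsum_sq hardy_coeffs.rep_eq flip: norm_hardy_coeffs)
  also have "\<dots> = (\<Sum>n. (cmod (?t n))\<^sup>2)"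
    using suminf_split_head[OF summable_hardy[of "mult_z f"]] by (simp add: s)
  also have "\<dots> = (norm f)\<^sup>2"
    by (simp add: norm_hsum_sq hardy_coeffs.rep_eq flip: norm_hardy_coeffs)
  finally show ?thesis by (simp add: power2_eq_iff_nonneg)
qed

lift_definition S_inf :: "hardy hsum \<Rightarrow> hardy hsum" is "\<lambda>x k. mult_z (x k)"
  by (simp add: norm_mult_z)

section \<open>Subspaces and operators\<close>

text \<open>A Hilbert space is a closed subspace of a type of class \<open>complex_hilbert\<close>, most often the
  whole type.  A transformation on a subspace is a function on the type of which only the
  restriction to the subspace matters.\<close>

definition csubspaces :: "'a::complex_hilbert set set"
  where "csubspaces = {A. closed A \<and> 0 \<in> A \<and> (\<forall>x\<in>A. \<forall>y\<in>A. x + y \<in> A) \<and> (\<forall>c. \<forall>x\<in>A. c *\<^sub>C x \<in> A)}"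

definition orth :: "'a::complex_hilbert set \<Rightarrow> 'a set"
  where "orth A = {x. \<forall>y\<in>A. cinner x y = 0}"

definition proj :: "'a::complex_hilbert set \<Rightarrow> 'a \<Rightarrow> 'a"
  where "proj A x = (THE p. p \<in> A \<and> x - p \<in> orth A)"

definition ops :: "'a::complex_hilbert set \<Rightarrow> 'b::complex_hilbert set \<Rightarrow> ('a \<Rightarrow> 'b) set"
  where "ops A B = {T. T ` A \<subseteq> B \<and> (\<forall>x\<in>A. \<forall>y\<in>A. T (x + y) = T x + T y)
    \<and> (\<forall>c. \<forall>x\<in>A. T (c *\<^sub>C x) = c *\<^sub>C T x) \<and> (\<exists>M. \<forall>x\<in>A. norm (T x) \<le> M * norm x)}"

definition isometry_on :: "'a::complex_hilbert set \<Rightarrow> ('a \<Rightarrow> 'a) \<Rightarrow> bool"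
  where "isometry_on A V \<longleftrightarrow> V \<in> ops A A \<and> (\<forall>x\<in>A. norm (V x) = norm x)"

definition unitary_on :: "'a::complex_hilbert set \<Rightarrow> ('a \<Rightarrow> 'a) \<Rightarrow> bool"
  where "unitary_on A U \<longleftrightarrow> isometry_on A U \<and> U ` A = A"

text \<open>Unitary equivalence of \<open>T \<in> ops A A\<close> and \<open>R \<in> ops B B\<close>.\<close>

definition unitarily_equiv ::
    "'a::complex_hilbert set \<Rightarrow> ('a \<Rightarrow> 'a) \<Rightarrow> 'b::complex_hilbert set \<Rightarrow> ('b \<Rightarrow> 'b) \<Rightarrow> bool"
  where "unitarily_equiv A T B R \<longleftrightarrow> (\<exists>W\<in>ops A B. (\<forall>x\<in>A. norm (W x) = norm x) \<and> W ` A = B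
    \<and> (\<forall>x\<in>A. W (T x) = R (W x)))"

definition adj :: "('a::complex_hilbert \<Rightarrow> 'b::complex_hilbert) \<Rightarrow> 'b \<Rightarrow> 'a"
  where "adj T = (THE S. \<forall>x y. cinner (T x) y = cinner x (S y))"

definition contraction :: "('a::complex_hilbert \<Rightarrow> 'a) \<Rightarrow> bool"
  where "contraction T \<longleftrightarrow> T \<in> ops UNIV UNIV \<and> (\<forall>x. norm (T x) \<le> norm x)"

definition class_C1_dot :: "('a::complex_hilbert \<Rightarrow> 'a) \<Rightarrow> bool"
  where "class_C1_dot T \<longleftrightarrow> (\<forall>x. x \<noteq> 0 \<longrightarrow> (INF n. norm ((T ^^ n) x)) > 0)"

definition class_C0_dot :: "('a::complex_hilbert \<Rightarrow> 'a) \<Rightarrow> bool"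
  where "class_C0_dot T \<longleftrightarrow> (\<forall>x. (\<lambda>n. norm ((T ^^ n) x)) \<longlonglongrightarrow> 0)"

definition class_C10 :: "('a::complex_hilbert \<Rightarrow> 'a) \<Rightarrow> bool"
  where "class_C10 T \<longleftrightarrow> class_C1_dot T \<and> class_C0_dot (adj T)"

definition quasiaffinity :: "('a::complex_hilbert \<Rightarrow> 'b::complex_hilbert) \<Rightarrow> bool"
  where "quasiaffinity X \<longleftrightarrow> X \<in> ops UNIV UNIV \<and> {x. X x = 0} = {0} \<and> closure (range X) = UNIV"

definition quasiaffine_transform ::
    "('a::complex_hilbert \<Rightarrow> 'a) \<Rightarrow> ('b::complex_hilbert \<Rightarrow> 'b) \<Rightarrow> bool"
  where "quasiaffine_transform T R \<longleftrightarrow> (\<exists>X. quasiaffinity X \<and> (\<forall>x. X (T x) = R (X x)))"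

definition quasisimilar :: "('a::complex_hilbert \<Rightarrow> 'a) \<Rightarrow> ('b::complex_hilbert \<Rightarrow> 'b) \<Rightarrow> bool"
  where "quasisimilar T R \<longleftrightarrow> quasiaffine_transform T R \<and> quasiaffine_transform R T"

definition similar :: "('a::complex_hilbert \<Rightarrow> 'a) \<Rightarrow> ('b::complex_hilbert \<Rightarrow> 'b) \<Rightarrow> bool"
  where "similar T R \<longleftrightarrow> (\<exists>X\<in>ops UNIV UNIV. bij X \<and> inv X \<in> ops UNIV UNIV \<and> (\<forall>x. X (T x) = R (X x)))"

definition similar_to_contraction :: "('a::complex_hilbert \<Rightarrow> 'a) \<Rightarrow> bool"
  where "similar_to_contraction T \<longleftrightarrow> (\<exists>C::'a \<Rightarrow> 'a. contraction C \<and> similar T C)"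

definition Hlat :: "('a::complex_hilbert \<Rightarrow> 'a) \<Rightarrow> 'a set set"
  where "Hlat U = {E \<in> csubspaces. \<forall>A\<in>ops UNIV UNIV. (\<forall>x. A (U x) = U (A x)) \<longrightarrow> A ` E \<subseteq> E}"

section \<open>Asymptotes\<close>

text \<open>The universal property quantifies over all separable Hilbert spaces \<open>K'\<close>.  As a formula
  cannot quantify over types, \<open>K'\<close> ranges over the closed subspaces of \<open>\<ell>\<^sup>2\<close>; every separable
  Hilbert space is unitarily equivalent to one of these, and the property is invariant under
  replacing \<open>K'\<close> by a unitarily equivalent space.\<close>

definition isometric_asymptote ::
    "('h::complex_hilbert \<Rightarrow> 'h) \<Rightarrow> ('h \<Rightarrow> 'k::complex_hilbert) \<Rightarrow> ('k \<Rightarrow> 'k) \<Rightarrow> bool"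
  where "isometric_asymptote T X U \<longleftrightarrow>
    isometry_on UNIV U \<and> X \<in> ops UNIV UNIV \<and> (\<forall>x. X (T x) = U (X x)) \<and>
    (\<forall>(K' :: ell2 set) V Y.
      K' \<in> csubspaces \<and> isometry_on K' V \<and> Y \<in> ops UNIV K' \<and> (\<forall>x. Y (T x) = V (Y x)) \<longrightarrow>
      (\<exists>!Z. Z \<in> ops UNIV K' \<and> (\<forall>u. Z (U u) = V (Z u)) \<and> (\<forall>x. Y x = Z (X x))))"

definition unitary_asymptote ::
    "('h::complex_hilbert \<Rightarrow> 'h) \<Rightarrow> ('h \<Rightarrow> 'k::complex_hilbert) \<Rightarrow> ('k \<Rightarrow> 'k) \<Rightarrow> bool"
  where "unitary_asymptote T X U \<longleftrightarrow>
    unitary_on UNIV U \<and> X \<in> ops UNIV UNIV \<and> (\<forall>x. X (T x) = U (X x)) \<and>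
    (\<forall>(K' :: ell2 set) V Y.
      K' \<in> csubspaces \<and> unitary_on K' V \<and> Y \<in> ops UNIV K' \<and> (\<forall>x. Y (T x) = V (Y x)) \<longrightarrow>
      (\<exists>!Z. Z \<in> ops UNIV K' \<and> (\<forall>u. Z (U u) = V (Z u)) \<and> (\<forall>x. Y x = Z (X x))))"

text \<open>Quasianalyticity of \<open>T\<close>, tested on a given unitary asymptote \<open>(X, U)\<close> of \<open>T\<close>; the choice is
  immaterial since unitary asymptotes are unique up to similarity.\<close>

definition quasianalytic ::
    "('h::complex_hilbert \<Rightarrow> 'h) \<Rightarrow> ('h \<Rightarrow> 'k::complex_hilbert) \<Rightarrow> ('k \<Rightarrow> 'k) \<Rightarrow> bool"
  where "quasianalytic T X U \<longleftrightarrow> unitary_asymptote T X U \<and>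
    (\<forall>E\<in>Hlat U. E \<noteq> UNIV \<longrightarrow> {x. X x \<in> E} = {0})"

definition has_unitary_summand :: "('a::complex_hilbert \<Rightarrow> 'a) \<Rightarrow> bool"
  where "has_unitary_summand V \<longleftrightarrow>
    (\<exists>L\<in>csubspaces. L \<noteq> {0} \<and> unitary_on L V \<and> isometry_on (orth L) V)"

end

theory Submission
  imports Defs "HOL-Library.Nat_Bijection"
begin

text \<open>
  Put \<open>W\<^sub>0 = (S_inf, K; 0, R0)\<close>, an operator unitarily equivalent to \<open>S_inf\<close> and hence an isometry.
  Since \<open>X0\<close> intertwines \<open>T0\<close> with \<open>R0\<close>, the operator \<open>I \<oplus> X0\<close> intertwines \<open>T\<close> with \<open>W\<^sub>0\<close>, and \<open>T\<close> preserves
  the seminorm given by \<open>\<parallel>h\<parallel>\<^sup>2 + \<parallel>X0 x\<parallel>\<^sup>2\<close>.  Each of the three assertions rests on this.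

  \<^item> Adding \<open>L \<parallel>x\<parallel>\<^sup>2\<close> to the seminorm gives an equivalent Hilbert norm in which \<open>T\<close> is a
  contraction (\<open>similar_to_contraction_triangular\<close>).  The similarity is the square root of a positive
  operator, found as a fixed point (\<open>renorming_operator\<close>).

  \<^item> \<open>I \<oplus> X0\<close> is a quasiaffinity: \<open>X0\<close> has dense range because \<open>J\<close> has, and it is injective because
  \<open>X0 x = 0\<close> means \<open>Y (J x) \<in> E\<close>, which quasianalyticity of \<open>T0\<close> forbids for \<open>x \<noteq> 0\<close>.  So \<open>T \<prec> S_inf\<close>.
  Conversely, a contraction \<open>C\<close> with \<open>C \<prec> S_inf\<close> always satisfies \<open>S_inf \<prec> C\<close>
  (\<open>S_inf_quasiaffine_transform\<close>).  To see this one sends \<open>\<Sum>n. S_inf\<^sup>n f\<^sub>n\<close>, with \<open>f\<^sub>n\<close> in the wandering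
  subspace of constants, to \<open>\<Sum>n. C\<^sup>n (I - C C\<^sup>*) c f\<^sub>n\<close>.  The defect operator makes the series converge,
  and the range is dense as soon as that of \<open>c\<close> is.  Injectivity requires that the range of \<open>c\<close> meet the
  range of \<open>C\<close> only in \<open>0\<close>.  Such a \<open>c\<close> exists because the kernel of \<open>C\<^sup>*\<close> is infinite dimensional,
  by an explicit pair of injective operators on \<open>\<ell>\<^sup>2\<close> whose ranges, one of them dense, meet only in \<open>0\<close>
  (\<open>wandering_map_exists\<close>).

  \<^item> The limit of \<open>\<parallel>T\<^sup>n (h, x)\<parallel>\<^sup>2\<close> in the new norm is a combination of \<open>\<parallel>h\<parallel>\<^sup>2 + \<parallel>X0 x\<parallel>\<^sup>2\<close> and \<open>\<parallel>Y (J x)\<parallel>\<^sup>2\<close>.  Hence the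
  isometric asymptote is, up to similarity, the restriction of \<open>W\<^sub>0 \<oplus> U\<close> to the closure of all
  \<open>(h, X0 x, Y (J x))\<close>.  Approximating \<open>y \<in> M\<close> by vectors \<open>J x\<close> shows that this closure
  contains \<open>0 \<oplus> 0 \<oplus> N\<close>, where \<open>N\<close> is the closure of \<open>Y M\<close>, and \<open>N \<noteq> {0}\<close>.  It remains to see that
  \<open>U N = N\<close> (\<open>invariant_subspace_reducing\<close>).  If not, \<open>N \<ominus> U N\<close> contains a vector \<open>w \<noteq> 0\<close> whose orbit under \<open>U\<close> is
  orthogonal.  Then \<open>w \<in> E\<close>, and operators commuting with \<open>U\<close> move \<open>w\<close> to any vector whose orbit satisfies
  a Bessel inequality (\<open>hyperinvariant_wandering\<close>).  All vectors \<open>Y (I - R R\<^sup>*) x\<close> are of this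
  kind and their orbits span the range of \<open>Y\<close>, because \<open>R\<close> is of class \<open>C\<^bsub>\<cdot>0\<^esub>\<close>.  So \<open>E\<close> would contain
  the range of \<open>Y\<close>, contrary to \<open>M\<close> being proper.  Working with Bessel inequalities replaces the
  spectral theorem for \<open>U\<close> and the absolute continuity of its spectral measure.
\<close>

section \<open>Bounded operators and the inner product\<close>


instance complex_hilbert \<subseteq> banach ..

lemma ops_UNIV_iff:
  "T \<in> ops UNIV UNIV \<longleftrightarrow> bounded_linear T \<and> (\<forall>c x. T (c *\<^sub>C x) = c *\<^sub>C T x)"
proof
  assume T: "T \<in> ops UNIV UNIV"
  then have add: "T (x + y) = T x + T y" and sc: "T (c *\<^sub>C x) = c *\<^sub>C T x" for x y c
    by (auto simp: ops_def)
  obtain B where B: "norm (T x) \<le> B * norm x" for x using T by (auto simp: ops_def)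
  have "bounded_linear T"
    using sc[of "complex_of_real _"] by (intro bounded_linear_intro[where K = B])
      (simp_all add: add scaleC_of_real B mult.commute)
  with sc show "bounded_linear T \<and> (\<forall>c x. T (c *\<^sub>C x) = c *\<^sub>C T x)" by blast
next
  assume "bounded_linear T \<and> (\<forall>c x. T (c *\<^sub>C x) = c *\<^sub>C T x)"
  then interpret bounded_linear T by blast
  obtain B where "norm (T x) \<le> norm x * B" for x using bounded by blast
  with \<open>_ \<and> _\<close> show "T \<in> ops UNIV UNIV"
    by (auto simp: ops_def add intro!: exI[of _ B] simp: mult.commute)
qed

lemma ops_linear: "T \<in> ops UNIV UNIV \<Longrightarrow> bounded_linear T"
  and ops_scaleC: "T \<in> ops UNIV UNIV \<Longrightarrow> T (c *\<^sub>C x) = c *\<^sub>C T x"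
  by (simp_all add: ops_UNIV_iff)

lemmas ops_simps = ops_linear[THEN bounded_linear.linear, THEN linear_add]
  ops_linear[THEN bounded_linear.linear, THEN linear_diff]
  ops_linear[THEN bounded_linear.linear, THEN linear_0]
  ops_linear[THEN bounded_linear.linear, THEN linear_neg]
  ops_linear[THEN bounded_linear.linear, THEN linear_cmul]
  ops_linear[THEN bounded_linear.linear, THEN linear_sum]
  ops_scaleC

lemma bounded_linear_scaleC: "bounded_linear (\<lambda>x::'a::complex_inner. c *\<^sub>C x)"
proof (rule bounded_linear_intro[where K = "cmod c"])
  show "c *\<^sub>C (r *\<^sub>R x) = r *\<^sub>R (c *\<^sub>C x)" for r and x :: 'a
    by (metis scaleC_of_real scaleC_scaleC mult.commute)
qed (simp_all add: scaleC_add_right norm_scaleC mult.commute)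

lemma bounded_linear_cinner_left: "bounded_linear (\<lambda>x::'a::complex_inner. cinner x y)"
proof (rule bounded_linear_intro[where K = "norm y"])
  show "cinner (r *\<^sub>R x) y = r *\<^sub>R cinner x y" for r and x :: 'a
    by (simp add: cinner_scaleC_left scaleR_conv_of_real flip: scaleC_of_real)
qed (simp_all add: cinner_add_left cinner_Cauchy_Schwarz)

lemma bounded_linear_cinner_right: "bounded_linear (\<lambda>x::'a::complex_inner. cinner y x)"
  unfolding cinner_commute[of y]
  by (rule bounded_linear_compose[OF bounded_linear_cnj bounded_linear_cinner_left])

lemmas cinner_simps =
  cinner_add_left cinner_add_right cinner_scaleC_left cinner_scaleC_right
  bounded_linear_cinner_left[THEN bounded_linear.linear, THEN linear_diff]
  bounded_linear_cinner_left[THEN bounded_linear.linear, THEN linear_0]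
  bounded_linear_cinner_left[THEN bounded_linear.linear, THEN linear_neg]
  bounded_linear_cinner_left[THEN bounded_linear.linear, THEN linear_cmul]
  bounded_linear_cinner_right[THEN bounded_linear.linear, THEN linear_diff]
  bounded_linear_cinner_right[THEN bounded_linear.linear, THEN linear_0]
  bounded_linear_cinner_right[THEN bounded_linear.linear, THEN linear_neg]
  bounded_linear_cinner_right[THEN bounded_linear.linear, THEN linear_cmul]

lemmas cinner_sum_left = bounded_linear_cinner_left[THEN bounded_linear.linear, THEN linear_sum]
lemmas cinner_sum_right = bounded_linear_cinner_right[THEN bounded_linear.linear, THEN linear_sum]

lemma cinner_self_eq_0: "cinner x x = 0 \<longleftrightarrow> (x::'a::complex_inner) = 0"
  by (simp add: cinner_self)

lemma scaleC_simps:
  fixes x y :: "'a::complex_inner"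
  shows "c *\<^sub>C (x - y) = c *\<^sub>C x - c *\<^sub>C y" "c *\<^sub>C (0::'a) = 0" "c *\<^sub>C (- x) = - (c *\<^sub>C x)"
    "0 *\<^sub>C x = 0" "1 *\<^sub>C x = x" "(-1) *\<^sub>C x = - x"
  using bounded_linear_scaleC[THEN bounded_linear.linear, THEN linear_diff, of c x y]
    bounded_linear_scaleC[THEN bounded_linear.linear, THEN linear_0, of c]
    bounded_linear_scaleC[THEN bounded_linear.linear, THEN linear_neg, of c x]
    scaleC_of_real[of 0 x] scaleC_of_real[of 1 x] scaleC_of_real[of "-1" x] by simp_all

lemma norm_add_sq:
  "(norm (x + y))\<^sup>2 = (norm x)\<^sup>2 + 2 * Re (cinner x y) + (norm (y::'a::complex_inner))\<^sup>2"
  by (simp add: power2_norm_eq_inner Re_cinner inner_add_left inner_add_right inner_commute)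

lemma tendsto_scaleC [tendsto_intros]:
  "(f \<longlongrightarrow> (l::'a::complex_inner)) F \<Longrightarrow> ((\<lambda>x. c *\<^sub>C f x) \<longlongrightarrow> c *\<^sub>C l) F"
  by (rule bounded_linear.tendsto[OF bounded_linear_scaleC])

lemma tendsto_cinner_right: "(f \<longlongrightarrow> l) F \<Longrightarrow> ((\<lambda>x. cinner y (f x)) \<longlongrightarrow> cinner y l) F"
  by (rule bounded_linear.tendsto[OF bounded_linear_cinner_right])

lemma ops_ident: "(\<lambda>x. x) \<in> ops UNIV UNIV"
  by (simp add: ops_UNIV_iff bounded_linear_ident)

lemma ops_compose: "S \<in> ops UNIV UNIV \<Longrightarrow> T \<in> ops UNIV UNIV \<Longrightarrow> (\<lambda>x. S (T x)) \<in> ops UNIV UNIV"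
  by (auto simp: ops_UNIV_iff intro: bounded_linear_compose)

lemma ops_add: "S \<in> ops UNIV UNIV \<Longrightarrow> T \<in> ops UNIV UNIV \<Longrightarrow> (\<lambda>x. S x + T x) \<in> ops UNIV UNIV"
  by (auto simp: ops_UNIV_iff scaleC_add_right intro: bounded_linear_add)

lemma ops_diff: "S \<in> ops UNIV UNIV \<Longrightarrow> T \<in> ops UNIV UNIV \<Longrightarrow> (\<lambda>x. S x - T x) \<in> ops UNIV UNIV"
  by (auto simp: ops_UNIV_iff scaleC_simps intro: bounded_linear_sub)

lemma ops_scale: "T \<in> ops UNIV UNIV \<Longrightarrow> (\<lambda>x. c *\<^sub>C T x) \<in> ops UNIV UNIV"
  by (auto simp: ops_UNIV_iff scaleC_scaleC mult.commute
      intro: bounded_linear_compose[OF bounded_linear_scaleC])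

lemma ops_funpow: "(T::'a::complex_hilbert \<Rightarrow> 'a) \<in> ops UNIV UNIV \<Longrightarrow> T ^^ n \<in> ops UNIV UNIV"
proof (induction n)
  case 0
  have "T ^^ 0 = (\<lambda>x. x)" by auto
  then show ?case by (simp only: ops_UNIV_iff bounded_linear_ident) simp
next
  case (Suc n)
  then show ?case using ops_compose[of T "T ^^ n"] by (simp add: o_def)
qed

lemma ops_tendsto: "T \<in> ops UNIV UNIV \<Longrightarrow> (f \<longlongrightarrow> l) F \<Longrightarrow> ((\<lambda>x. T (f x)) \<longlongrightarrow> T l) F"
  by (rule bounded_linear.tendsto[OF ops_linear])

lemma ops_bound:
  assumes "T \<in> ops UNIV UNIV" obtains B where "B > 0" "\<And>x. norm (T x) \<le> B * norm x"
  using bounded_linear.pos_bounded[OF ops_linear[OF assms]] by (metis mult.commute)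

section \<open>Orthogonal projections and adjoints\<close>

lemma csubspaces_diff: "A \<in> csubspaces \<Longrightarrow> x \<in> A \<Longrightarrow> y \<in> A \<Longrightarrow> x - y \<in> A"
  using scaleC_simps(6)[of y] unfolding csubspaces_def mem_Collect_eq
  by (metis diff_conv_add_uminus)

lemma orth_csubspaces: "orth A \<in> csubspaces"
proof -
  have "closed (orth A)"
    unfolding orth_def Ball_def
    by (intro closed_Collect_all closed_Collect_imp closed_Collect_eq open_Collect_const
        continuous_intros linear_continuous_on bounded_linear_cinner_left)
  then show ?thesis by (auto simp: csubspaces_def orth_def cinner_simps)
qed

lemma orthD: "x \<in> orth A \<Longrightarrow> y \<in> A \<Longrightarrow> cinner x y = 0"
  and orthD': "x \<in> orth A \<Longrightarrow> y \<in> A \<Longrightarrow> cinner y x = 0"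
  unfolding orth_def by (auto simp: cinner_commute[of y x])

text \<open>The distance from a point to a closed subspace is attained: by the parallelogram identity a
  minimising sequence is Cauchy, because the midpoint of two of its members lies in the subspace
  and so is no closer than the infimum.\<close>

lemma minimizer_exists:
  fixes A :: "'a::complex_hilbert set"
  assumes A: "A \<in> csubspaces"
  shows "\<exists>p\<in>A. \<forall>a\<in>A. norm (x - p) \<le> norm (x - a)"
proof -
  define d where "d = (INF a\<in>A. norm (x - a))"
  have ne: "A \<noteq> {}" and cl: "closed A" using A by (auto simp: csubspaces_def)
  have d: "d \<le> norm (x - a)" if "a \<in> A" for a
    unfolding d_def by (rule cINF_lower[OF _ that]) (auto intro: bdd_belowI[of _ 0])
  have d0: "0 \<le> d" unfolding d_def by (rule cINF_greatest[OF ne]) simp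
  have "bdd_below ((\<lambda>a. norm (x - a)) ` A)" by (rule bdd_belowI[of _ 0]) auto
  then have "\<exists>a\<in>A. norm (x - a) < d + inverse (real (Suc n))" for n
    using cINF_less_iff[OF ne, of "\<lambda>a. norm (x - a)" "d + inverse (real (Suc n))"]
    by (simp add: d_def)
  then obtain a where aA: "a n \<in> A" and a: "norm (x - a n) < d + inverse (real (Suc n))" for n
    by metis
  have lim: "(\<lambda>n. norm (x - a n)) \<longlonglongrightarrow> d"
  proof (rule tendsto_sandwich[OF _ _ tendsto_const])
    show "(\<lambda>n. d + inverse (real (Suc n))) \<longlonglongrightarrow> d"
      using tendsto_add[OF tendsto_const LIMSEQ_inverse_real_of_nat, of d] by simp
  qed (use d aA a in \<open>auto intro!: always_eventually intro: less_imp_le\<close>)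
  have par: "(norm (a m - a n))\<^sup>2 \<le> 2 * (norm (x - a m))\<^sup>2 + 2 * (norm (x - a n))\<^sup>2 - 4 * d\<^sup>2" for m n
  proof -
    have "(1/2) *\<^sub>R (a m + a n) \<in> A"
      using A aA[of m] aA[of n] unfolding csubspaces_def mem_Collect_eq by (metis scaleC_of_real)
    from d[OF this] have "d\<^sup>2 \<le> (norm (x - (1/2) *\<^sub>R (a m + a n)))\<^sup>2"
      using d0 by (intro power_mono)
    then show ?thesis
      unfolding power2_norm_eq_inner
      by (simp add: algebra_simps inner_commute)
  qed
  have "Cauchy a"
  proof (rule metric_CauchyI)
    fix e :: real assume e: "e > 0"
    have "(\<lambda>n. (norm (x - a n))\<^sup>2) \<longlonglongrightarrow> d\<^sup>2" by (intro tendsto_intros lim)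
    then have "\<forall>\<^sub>F n in sequentially. (norm (x - a n))\<^sup>2 < d\<^sup>2 + e\<^sup>2 / 4"
      by (rule order_tendstoD) (use e in simp)
    then obtain N where N: "\<And>n. n \<ge> N \<Longrightarrow> (norm (x - a n))\<^sup>2 < d\<^sup>2 + e\<^sup>2 / 4"
      by (auto simp: eventually_sequentially)
    have "dist (a m) (a n) < e" if "m \<ge> N" "n \<ge> N" for m n
    proof -
      have "(norm (a m - a n))\<^sup>2 < e\<^sup>2" using par[of m n] N[OF that(1)] N[OF that(2)] by linarith
      then show ?thesis using e by (simp add: dist_norm power2_less_imp_less)
    qed
    then show "\<exists>N. \<forall>m\<ge>N. \<forall>n\<ge>N. dist (a m) (a n) < e" by blast
  qed
  then obtain p where p: "a \<longlonglongrightarrow> p" using Cauchy_convergent convergent_def by blast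
  have "p \<in> A" using closed_sequentially[OF cl] aA p by blast
  moreover have "norm (x - p) = d"
    by (rule LIMSEQ_unique[OF _ lim]) (intro tendsto_intros p)
  ultimately show ?thesis using d by auto
qed

text \<open>If \<open>x - p\<close> had a component along some \<open>a\<close> of the subspace, then moving \<open>p\<close> in
  the direction of \<open>a\<close> would decrease the distance.\<close>

lemma orthogonal_decomposition:
  assumes A: "A \<in> csubspaces"
  shows "\<exists>p\<in>A. x - p \<in> orth A"
proof -
  obtain p where p: "p \<in> A" "\<And>a. a \<in> A \<Longrightarrow> norm (x - p) \<le> norm (x - a)"
    using minimizer_exists[OF A] by blast
  have "cinner (x - p) a = 0" if a: "a \<in> A" for a
  proof (cases "a = 0")
    case False
    define c where "c = cinner (x - p) a / complex_of_real ((norm a)\<^sup>2)"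
    have "p + c *\<^sub>C a \<in> A" using A a p(1) by (auto simp: csubspaces_def)
    from p(2)[OF this] have "(norm (x - p))\<^sup>2 \<le> (norm (x - p + - (c *\<^sub>C a)))\<^sup>2"
      by (intro power_mono) (simp_all add: algebra_simps)
    also have "\<dots> = (norm (x - p))\<^sup>2 - 2 * Re (cnj c * cinner (x - p) a) + (cmod c * norm a)\<^sup>2"
      by (simp only: norm_add_sq) (simp add: cinner_simps norm_scaleC)
    also have "cnj c * cinner (x - p) a = complex_of_real ((cmod (cinner (x - p) a))\<^sup>2 / (norm a)\<^sup>2)"
      by (simp add: c_def mult.commute flip: complex_norm_square)
    also have "cmod c * norm a = cmod (cinner (x - p) a) / norm a"
      using False by (simp add: c_def norm_divide norm_mult power2_eq_square)
    finally have "(cmod (cinner (x - p) a))\<^sup>2 / (norm a)\<^sup>2 \<le> 0" by (simp add: power_divide)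
    then show ?thesis using False by (simp add: divide_le_0_iff)
  qed (simp add: cinner_simps)
  then show ?thesis using p(1) by (auto simp: orth_def)
qed

lemma proj_unique:
  assumes A: "A \<in> csubspaces" and "p \<in> A" "x - p \<in> orth A" "q \<in> A" "x - q \<in> orth A"
  shows "p = q"
proof -
  have "p - q \<in> A" using csubspaces_diff assms by blast
  moreover have "p - q \<in> orth A"
    using csubspaces_diff[OF orth_csubspaces assms(5,3)] by simp
  ultimately have "cinner (p - q) (p - q) = 0" by (simp add: orthD)
  then show ?thesis by (simp add: cinner_self_eq_0)
qed

lemma proj:
  assumes A: "A \<in> csubspaces"
  shows proj_in: "proj A x \<in> A" and proj_orth: "x - proj A x \<in> orth A"
proof -
  have "\<exists>!p. p \<in> A \<and> x - p \<in> orth A"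
    using orthogonal_decomposition[OF A] proj_unique[OF A] by blast
  from theI'[OF this] show "proj A x \<in> A" "x - proj A x \<in> orth A" by (simp_all add: proj_def)
qed

lemma proj_eqI: "A \<in> csubspaces \<Longrightarrow> p \<in> A \<Longrightarrow> x - p \<in> orth A \<Longrightarrow> proj A x = p"
  using proj_unique proj_in proj_orth by blast

lemma proj_ops: assumes A: "A \<in> csubspaces" shows "proj A \<in> ops UNIV UNIV"
proof -
  have add: "proj A (x + y) = proj A x + proj A y" for x y
  proof (rule proj_eqI[OF A])
    show "proj A x + proj A y \<in> A"
      using A proj_in[OF A] by (simp add: csubspaces_def)
    have "x - proj A x + (y - proj A y) \<in> orth A"
      using orth_csubspaces proj_orth[OF A] unfolding csubspaces_def mem_Collect_eq by blast
    then show "x + y - (proj A x + proj A y) \<in> orth A" by (simp add: algebra_simps)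
  qed
  have sc: "proj A (c *\<^sub>C x) = c *\<^sub>C proj A x" for c x
  proof (rule proj_eqI[OF A])
    show "c *\<^sub>C proj A x \<in> A" using A proj_in[OF A] by (simp add: csubspaces_def)
    have "c *\<^sub>C (x - proj A x) \<in> orth A"
      using orth_csubspaces proj_orth[OF A] unfolding csubspaces_def mem_Collect_eq by blast
    then show "c *\<^sub>C x - c *\<^sub>C proj A x \<in> orth A" by (simp add: scaleC_simps)
  qed
  have "norm (proj A x) \<le> 1 * norm x" for x
  proof -
    have "(norm (proj A x + (x - proj A x)))\<^sup>2 = (norm (proj A x))\<^sup>2 + (norm (x - proj A x))\<^sup>2"
      by (simp only: norm_add_sq) (simp add: orthD'[OF proj_orth[OF A] proj_in[OF A]])
    then have "(norm (proj A x))\<^sup>2 \<le> (norm x)\<^sup>2" by simp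
    then show ?thesis by (simp add: power2_le_iff_abs_le)
  qed
  then show ?thesis unfolding ops_def mem_Collect_eq using add sc by blast
qed

lemma orth_orth: assumes A: "A \<in> csubspaces" shows "orth (orth A) = A"
proof
  show "A \<subseteq> orth (orth A)" using orthD'[of _ A] by (auto simp: orth_def[of "orth A"])
  show "orth (orth A) \<subseteq> A"
  proof
    fix x assume x: "x \<in> orth (orth A)"
    have "proj A x \<in> orth (orth A)" using \<open>A \<subseteq> _\<close> proj_in[OF A] by blast
    then have "x - proj A x \<in> orth (orth A)" using csubspaces_diff[OF orth_csubspaces] x by blast
    then have "cinner (x - proj A x) (x - proj A x) = 0" using proj_orth[OF A] by (rule orthD)
    then show "x \<in> A" using proj_in[OF A, of x] by (simp add: cinner_self_eq_0)
  qed
qed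

lemma csubspaces_kernel:
  assumes T: "T \<in> ops UNIV UNIV" and E: "E \<in> csubspaces"
  shows "{x. T x \<in> E} \<in> csubspaces"
proof -
  have "closed (T -` E)"
    using E by (intro continuous_closed_vimage) (auto simp: csubspaces_def
        intro: linear_continuous_at ops_linear[OF T])
  then show ?thesis
    using E by (auto simp: csubspaces_def vimage_def ops_simps[OF T])
qed

text \<open>A vector orthogonal to the kernel represents the functional up to a scalar, as the kernel
  has codimension at most one.\<close>

lemma Riesz:
  fixes f :: "'a::complex_hilbert \<Rightarrow> complex"
  assumes f: "f \<in> ops UNIV UNIV"
  shows "\<exists>z. \<forall>x. f x = cinner x z"
proof (cases "\<forall>x. f x = 0")
  case True
  then show ?thesis by (auto simp: cinner_simps intro: exI[of _ 0])
next
  case False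
  let ?A = "{x. f x \<in> {0}}"
  have A: "?A \<in> csubspaces"
    by (rule csubspaces_kernel[OF f]) (auto simp: csubspaces_def scaleC_simps)
  obtain x0 where "f x0 \<noteq> 0" using False by blast
  define u where "u = x0 - proj ?A x0"
  have u: "u \<in> orth ?A" unfolding u_def by (rule proj_orth[OF A])
  have fu: "f u \<noteq> 0" using \<open>f x0 \<noteq> 0\<close> proj_in[OF A, of x0] by (simp add: u_def ops_simps[OF f])
  then have "u \<noteq> 0" by (auto simp: ops_simps[OF f])
  have "f x = cinner x ((cnj (f u) / complex_of_real ((norm u)\<^sup>2)) *\<^sub>C u)" for x
  proof -
    have "x - (f x / f u) *\<^sub>C u \<in> ?A"
      using fu by (simp add: ops_simps[OF f] scaleC_complex_def)
    from orthD'[OF u this] have "cinner x u = f x / f u * complex_of_real ((norm u)\<^sup>2)"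
      by (simp add: cinner_simps cinner_self)
    then show ?thesis using fu \<open>u \<noteq> 0\<close> by (simp add: cinner_simps)
  qed
  then show ?thesis by blast
qed

lemma cinner_eqI: "(\<And>x. cinner x y = cinner x z) \<Longrightarrow> y = (z::'a::complex_inner)"
  using cinner_self_eq_0[of "y - z"] by (simp add: cinner_simps)

text \<open>The description of \<open>adj T\<close> by \<open>THE\<close> is meaningful: existence is Riesz' theorem applied
  to \<open>x \<mapsto> (T x, y)\<close>, uniqueness is nondegeneracy of the inner product.\<close>

lemma adj:
  assumes T: "T \<in> ops UNIV UNIV"
  shows cinner_adj: "cinner (T x) y = cinner x (adj T y)"
proof -
  have "\<exists>z. \<forall>x. cinner (T x) y = cinner x z" for y
  proof (rule Riesz)
    show "(\<lambda>x. cinner (T x) y) \<in> ops UNIV UNIV"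
      unfolding ops_UNIV_iff
      by (auto simp: ops_simps[OF T] cinner_simps scaleC_complex_def
          intro: bounded_linear_compose[OF bounded_linear_cinner_left ops_linear[OF T]])
  qed
  then have "\<forall>y. \<exists>z. \<forall>x. cinner (T x) y = cinner x z" by blast
  from choice[OF this] obtain S where S: "\<forall>x y. cinner (T x) y = cinner x (S y)" by blast
  have "\<exists>!S. \<forall>x y. cinner (T x) y = cinner x (S y)"
  proof (rule ex1I[of _ S])
    fix S' assume S': "\<forall>x y. cinner (T x) y = cinner x (S' y)"
    show "S' = S"
    proof (rule ext, rule cinner_eqI)
      show "cinner x (S' y) = cinner x (S y)" for x y
        using S[rule_format, of x y] S'[rule_format, of x y] by simp
    qed
  qed (rule S)
  from theI'[OF this] show ?thesis unfolding adj_def by blast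
qed

lemma cinner_adj': "T \<in> ops UNIV UNIV \<Longrightarrow> cinner (adj T y) x = cinner y (T x)"
  by (metis cinner_adj cinner_commute)

lemma adj_ops_bound:
  assumes T: "T \<in> ops UNIV UNIV" and B: "\<And>x. norm (T x) \<le> B * norm x" and "B \<ge> 0"
  shows "adj T \<in> ops UNIV UNIV" "norm (adj T y) \<le> B * norm y"
proof -
  have bd: "norm (adj T y) \<le> B * norm y" for y
  proof -
    have "(norm (adj T y))\<^sup>2 = cmod (cinner (T (adj T y)) y)"
      by (simp only: cinner_adj[OF T] cinner_self norm_of_real) simp
    also have "\<dots> \<le> norm (T (adj T y)) * norm y" by (rule cinner_Cauchy_Schwarz)
    also have "\<dots> \<le> B * norm (adj T y) * norm y" by (intro mult_right_mono B) simp
    finally have "norm (adj T y) * norm (adj T y) \<le> norm (adj T y) * (B * norm y)"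
      by (simp add: power2_eq_square mult_ac)
    then show ?thesis using \<open>B \<ge> 0\<close> by (cases "adj T y = 0") auto
  qed
  then show "norm (adj T y) \<le> B * norm y" .
  have "adj T (x + y) = adj T x + adj T y" "adj T (c *\<^sub>C x) = c *\<^sub>C adj T x" for x y c
    by (rule cinner_eqI, simp add: cinner_simps flip: cinner_adj[OF T])+
  with bd show "adj T \<in> ops UNIV UNIV" unfolding ops_def by auto
qed

lemma adj_ops: "T \<in> ops UNIV UNIV \<Longrightarrow> adj T \<in> ops UNIV UNIV"
  using adj_ops_bound(1)[of T] ops_bound[of T] by (metis less_imp_le)

lemma csubspaces_closure:
  assumes "0 \<in> A" and add: "\<And>x y. x \<in> A \<Longrightarrow> y \<in> A \<Longrightarrow> x + y \<in> A"
    and scale: "\<And>c x. x \<in> A \<Longrightarrow> c *\<^sub>C x \<in> A"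
  shows "closure A \<in> csubspaces"
  unfolding csubspaces_def mem_Collect_eq
proof (intro conjI ballI allI)
  show "0 \<in> closure A" using assms(1) closure_subset by blast
next
  fix x y assume "x \<in> closure A" "y \<in> closure A"
  then obtain f g where f: "\<forall>n. f n \<in> A" "f \<longlonglongrightarrow> x" and g: "\<forall>n. g n \<in> A" "g \<longlonglongrightarrow> y"
    unfolding closure_sequential by blast
  have "(\<lambda>n. f n + g n) \<longlonglongrightarrow> x + y" by (intro tendsto_intros f g)
  then show "x + y \<in> closure A"
    unfolding closure_sequential using f(1) g(1) add by (intro exI[of _ "\<lambda>n. f n + g n"]) auto
next
  fix x c assume "x \<in> closure A"
  then obtain f where f: "\<forall>n. f n \<in> A" "f \<longlonglongrightarrow> x"
    unfolding closure_sequential by blast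
  have "(\<lambda>n. c *\<^sub>C f n) \<longlonglongrightarrow> c *\<^sub>C x" by (intro tendsto_intros f)
  then show "c *\<^sub>C x \<in> closure A"
    unfolding closure_sequential using f(1) scale by (intro exI[of _ "\<lambda>n. c *\<^sub>C f n"]) auto
qed simp

text \<open>By the projection theorem a closed subspace with trivial orthogonal complement is everything.\<close>

lemma dense_rangeI:
  assumes T: "T \<in> ops UNIV UNIV" and 0: "\<And>y. (\<And>x. cinner y (T x) = 0) \<Longrightarrow> y = 0"
  shows "closure (range T) = UNIV"
proof -
  have "T a + T b \<in> range T" "c *\<^sub>C T a \<in> range T" "0 \<in> range T" for a b c
    using rangeI[of T "a + b"] rangeI[of T "c *\<^sub>C a"] rangeI[of T 0] by (simp_all add: ops_simps[OF T])
  note sub = this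
  have cl: "closure (range T) \<in> csubspaces"
    by (rule csubspaces_closure) (use sub in \<open>force+\<close>)
  have "orth (closure (range T)) = {0}"
  proof -
    have "y = 0" if "y \<in> orth (closure (range T))" for y
      by (rule 0, rule orthD[OF that], rule subsetD[OF closure_subset], rule rangeI)
    then show ?thesis by (auto simp: orth_def cinner_simps)
  qed
  then have "orth (orth (closure (range T))) = UNIV" by (auto simp: orth_def cinner_simps)
  with orth_orth[OF cl] show ?thesis by simp
qed

lemma dense_orth_zero:
  assumes "closure A = UNIV" "\<And>a. a \<in> A \<Longrightarrow> cinner y a = 0"
  shows "y = 0"
proof -
  obtain f where f: "\<And>n. f n \<in> A" "f \<longlonglongrightarrow> y"
    using assms(1) closure_sequential[of y A] by auto
  have "(\<lambda>n. cinner y (f n)) \<longlonglongrightarrow> cinner y y" by (rule tendsto_cinner_right[OF f(2)])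
  then have "cinner y y = 0" using assms(2)[OF f(1)] by (simp add: LIMSEQ_const_iff)
  then show ?thesis by (simp add: cinner_self_eq_0)
qed

lemma adj_injective:
  assumes X: "quasiaffinity X" and y: "adj X y = 0" shows "y = 0"
proof (rule dense_orth_zero)
  show "closure (range X) = UNIV" using X by (simp add: quasiaffinity_def)
  have ops: "X \<in> ops UNIV UNIV" using X by (simp add: quasiaffinity_def)
  fix a assume "a \<in> range X"
  then obtain x where "a = X x" by blast
  then show "cinner y a = 0" using cinner_adj'[OF ops, of y x] by (simp add: y cinner_simps)
qed


section \<open>A square root near the identity\<close>

text \<open>The equation \<open>2 Z = D + Z\<^sup>2\<close> says \<open>(I - Z)\<^sup>2 = I - D\<close>.  The map
  \<open>Z \<mapsto> (D + Z\<^sup>2) / 2\<close> is a contraction of ratio \<open>1/2\<close> of the ball of radius \<open>1/2\<close>, since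
  \<open>(3/4 + 1/4) / 2 = 1/2\<close> and \<open>Z\<^sup>2 - W\<^sup>2 = Z (Z - W) + (Z - W) W\<close>.  The selfadjoint complex-linear
  operators form a closed set preserved by the map, so the Banach fixed point theorem yields a
  selfadjoint square root of \<open>I - D\<close> near the identity.\<close>

lemma selfadjoint_quadratic_fixpoint:
  fixes D :: "'a::complex_hilbert \<Rightarrow> 'a"
  assumes D: "D \<in> ops UNIV UNIV" and sa: "\<And>x y. cinner (D x) y = cinner x (D y)"
    and bd: "\<And>x. norm (D x) \<le> 3/4 * norm x"
  obtains Z where "Z \<in> ops UNIV UNIV" "\<And>x y. cinner (Z x) y = cinner x (Z y)"
    "\<And>x. norm (Z x) \<le> 1/2 * norm x" "\<And>x. 2 *\<^sub>R Z x = D x + Z (Z x)"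
proof -
  define d where "d = Blinfun D"
  have d: "blinfun_apply d x = D x" for x
    by (simp add: d_def bounded_linear_Blinfun_apply ops_linear[OF D])
  have nd: "norm d \<le> 3/4"
    by (rule norm_blinfun_bound, simp, unfold d, rule bd)
  define s :: "('a \<Rightarrow>\<^sub>L 'a) set" where
    "s = {Z. norm Z \<le> 1/2 \<and> (\<forall>c x. blinfun_apply Z (c *\<^sub>C x) = c *\<^sub>C blinfun_apply Z x)
       \<and> (\<forall>x y. cinner (blinfun_apply Z x) y = cinner x (blinfun_apply Z y))}"
  define f where "f Z = (1/2) *\<^sub>R (d + (Z o\<^sub>L Z))" for Z
  have ev: "bounded_linear (\<lambda>Z. blinfun_apply Z x)" for x :: 'a
    by (rule blinfun.bounded_linear_left)
  have "closed s"
    unfolding s_def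
    by (intro closed_Collect_conj closed_Collect_all closed_Collect_le closed_Collect_eq
        continuous_intros linear_continuous_on ev bounded_linear_compose[OF bounded_linear_scaleC ev]
        bounded_linear_compose[OF bounded_linear_cinner_left ev]
        bounded_linear_compose[OF bounded_linear_cinner_right ev])
  have "\<exists>!Z\<in>s. f Z = Z"
  proof (rule Banach_fix)
    show "complete s" using \<open>closed s\<close> by (simp add: complete_eq_closed)
    show "s \<noteq> {}" by (auto simp: s_def cinner_simps scaleC_simps intro!: exI[of _ 0])
    show "f ` s \<subseteq> s"
    proof
      fix W assume "W \<in> f ` s"
      then obtain Z where Z: "Z \<in> s" "W = f Z" by blast
      have "norm (Z o\<^sub>L Z) \<le> norm Z * norm Z" by (rule norm_blinfun_compose)
      also have "\<dots> \<le> 1/2 * (1/2)" using Z(1) by (intro mult_mono) (auto simp: s_def)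
      finally have "norm (d + (Z o\<^sub>L Z)) \<le> 1" using norm_triangle_ineq[of d "Z o\<^sub>L Z"] nd by linarith
      then have n: "norm W \<le> 1/2" by (simp add: Z(2) f_def)
      have W: "blinfun_apply W x = (1/2) *\<^sub>R (D x + blinfun_apply Z (blinfun_apply Z x))" for x
        by (simp add: Z(2) f_def blinfun.add_left blinfun.scaleR_left d)
      have "c *\<^sub>C (1/2) *\<^sub>R x = (1/2) *\<^sub>R c *\<^sub>C (x::'a)" for c x
        using linear_cmul[OF bounded_linear.linear[OF bounded_linear_scaleC[of c]], of "1/2" x] .
      then show "W \<in> s"
        using n Z(1) unfolding s_def mem_Collect_eq W
        by (auto simp: sa cinner_simps ops_scaleC[OF D] scaleC_add_right)
    qed
    show "dist (f Z) (f W) \<le> 1/2 * dist Z W" if "Z \<in> s" "W \<in> s" for Z W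
    proof -
      have "f Z - f W = (1/2) *\<^sub>R ((Z o\<^sub>L (Z - W)) + ((Z - W) o\<^sub>L W))"
        by (rule blinfun_eqI) (simp add: f_def blinfun.bilinear_simps algebra_simps)
      then have "norm (f Z - f W) \<le> 1/2 * (norm (Z o\<^sub>L (Z - W)) + norm ((Z - W) o\<^sub>L W))"
        using norm_triangle_ineq[of "Z o\<^sub>L (Z - W)" "(Z - W) o\<^sub>L W"] by simp
      also have "\<dots> \<le> 1/2 * (norm Z * norm (Z - W) + norm (Z - W) * norm W)"
        by (intro mult_left_mono add_mono norm_blinfun_compose) simp
      also have "\<dots> \<le> 1/2 * (1/2 * norm (Z - W) + norm (Z - W) * (1/2))"
        using that by (intro mult_left_mono add_mono mult_right_mono) (auto simp: s_def)
      finally show ?thesis by (simp add: dist_norm)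
    qed
  qed auto
  then obtain Z where Z: "Z \<in> s" "f Z = Z" by blast
  show thesis
  proof (rule that[of "blinfun_apply Z"])
    show "blinfun_apply Z \<in> ops UNIV UNIV"
      using Z(1) by (auto simp: ops_UNIV_iff s_def blinfun.bounded_linear_right)
    show "norm (blinfun_apply Z x) \<le> 1/2 * norm x" for x
    proof -
      have "norm (blinfun_apply Z x) \<le> norm Z * norm x" by (rule norm_blinfun)
      also have "\<dots> \<le> 1/2 * norm x" using Z(1) by (intro mult_right_mono) (auto simp: s_def)
      finally show ?thesis .
    qed
    show "2 *\<^sub>R blinfun_apply Z x = D x + blinfun_apply Z (blinfun_apply Z x)" for x
    proof -
      have "2 *\<^sub>R blinfun_apply (f Z) x = D x + blinfun_apply Z (blinfun_apply Z x)"
        by (simp add: f_def blinfun.add_left blinfun.scaleR_left d)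
      then show ?thesis by (simp add: Z(2))
    qed
  qed (use Z(1) in \<open>auto simp: s_def\<close>)
qed

lemma ops_inv:
  fixes G :: "'a::complex_hilbert \<Rightarrow> 'b::complex_hilbert"
  assumes G: "G \<in> ops UNIV UNIV" and "bij G" and m: "m > 0" "\<And>x. norm x \<le> m * norm (G x)"
  shows "inv G \<in> ops UNIV UNIV"
proof -
  have i: "G (inv G y) = y" "inv G (G x) = x" for x y
    using \<open>bij G\<close> by (simp_all add: bij_is_surj surj_f_inv_f bij_is_inj)
  have "inv G (x + y) = inv G x + inv G y" for x y
    by (metis i ops_simps(1)[OF G])
  moreover have "inv G (c *\<^sub>C x) = c *\<^sub>C inv G x" for c x by (metis i ops_scaleC[OF G])
  moreover have "norm (inv G y) \<le> m * norm y" for y by (metis i m(2))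
  ultimately show ?thesis unfolding ops_def by auto
qed

text \<open>The Hilbert norm \<open>(L \<parallel>x\<parallel>\<^sup>2 + \<parallel>B x\<parallel>\<^sup>2)\<^sup>1\<^sup>/\<^sup>2\<close> is carried to the original one by an
  invertible operator, namely \<open>(L + B\<^sup>* B)\<^sup>1\<^sup>/\<^sup>2\<close>.  For \<open>L\<close> large compared with \<open>\<parallel>B\<parallel>\<^sup>2\<close> this is
  \<open>L\<^sup>1\<^sup>/\<^sup>2\<close> times a square root of a small perturbation of the identity.\<close>

lemma renorming_operator:
  fixes B :: "'a::complex_hilbert \<Rightarrow> 'b::complex_hilbert"
  assumes B: "B \<in> ops UNIV UNIV"
  obtains G :: "'a \<Rightarrow> 'a" and L :: real where
    "G \<in> ops UNIV UNIV" "bij G" "inv G \<in> ops UNIV UNIV" "L \<ge> 0"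
    "\<And>x. (norm (G x))\<^sup>2 = L * (norm x)\<^sup>2 + (norm (B x))\<^sup>2"
proof -
  obtain b where b: "b > 0" "\<And>x. norm (B x) \<le> b * norm x" using ops_bound[OF B] by blast
  \<comment> \<open>This value makes the perturbation \<open>D = - B\<^sup>* B / L\<close> below of norm at most one half.\<close>
  define L where "L = 2 * b\<^sup>2"
  have L: "L > 0" using b by (simp add: L_def)
  define D where "D x = complex_of_real (- (1/L)) *\<^sub>C adj B (B x)" for x
  have D: "D \<in> ops UNIV UNIV"
    unfolding D_def by (intro ops_scale ops_compose[OF adj_ops[OF B] B])
  have DL: "cinner (D x) y = complex_of_real (- (1/L)) * cinner (B x) (B y)"
       "cinner x (D y) = complex_of_real (- (1/L)) * cinner (B x) (B y)" for x y
    by (simp_all add: D_def cinner_simps cinner_adj'[OF B] cinner_adj[OF B])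
  have "norm (D x) \<le> 3/4 * norm x" for x
  proof -
    have "norm (adj B (B x)) \<le> b * norm (B x)" using adj_ops_bound(2)[OF B b(2)] b(1) by simp
    also have "\<dots> \<le> b * (b * norm x)" using b by (intro mult_left_mono) auto
    finally have "1/L * norm (adj B (B x)) \<le> 1/L * (b * (b * norm x))"
      using L by (intro mult_left_mono) auto
    also have "\<dots> = 1/2 * norm x" using b(1) by (simp add: L_def power2_eq_square)
    also have "1/L * norm (adj B (B x)) = norm (D x)"
      using L by (simp only: D_def norm_scaleC norm_of_real) simp
    finally have "norm (D x) \<le> 1/2 * norm x" .
    then show ?thesis using norm_ge_zero[of x] by linarith
  qed
  from selfadjoint_quadratic_fixpoint[OF D _ this] obtain Z where Z: "Z \<in> ops UNIV UNIV"
    and sa: "\<And>x y. cinner (Z x) y = cinner x (Z y)"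
    and half: "\<And>x. norm (Z x) \<le> 1/2 * norm x" and eq: "\<And>x. 2 *\<^sub>R Z x = D x + Z (Z x)"
    using DL by metis
  define G where "G x = complex_of_real (sqrt L) *\<^sub>C (x - Z x)" for x
  have G: "G \<in> ops UNIV UNIV"
    unfolding G_def by (intro ops_scale ops_diff ops_ident Z)
  have nG: "(norm (G x))\<^sup>2 = L * (norm x)\<^sup>2 + (norm (B x))\<^sup>2" for x
  proof -
    have "(norm (x - Z x))\<^sup>2 = (norm x)\<^sup>2 - Re (cinner x (2 *\<^sub>R Z x)) + (norm (Z x))\<^sup>2"
      using norm_add_sq[of x "- Z x"] by (simp add: cinner_simps)
    also have "Re (cinner x (2 *\<^sub>R Z x)) = - (1/L) * (norm (B x))\<^sup>2 + Re (cinner x (Z (Z x)))"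
      by (simp add: eq cinner_simps DL cinner_self)
    also have "cinner x (Z (Z x)) = complex_of_real ((norm (Z x))\<^sup>2)"
      by (simp add: cinner_self flip: sa)
    finally have "(norm (x - Z x))\<^sup>2 = (norm x)\<^sup>2 + 1/L * (norm (B x))\<^sup>2" by simp
    then show ?thesis using L by (simp add: G_def norm_scaleC power_mult_distrib field_simps)
  qed
  have lower: "norm x \<le> 1 / sqrt L * norm (G x)" for x
  proof -
    have "(sqrt L * norm x)\<^sup>2 \<le> (norm (G x))\<^sup>2" using L by (simp add: nG power_mult_distrib)
    then have "sqrt L * norm x \<le> norm (G x)" by (rule power2_le_imp_le) simp
    then show ?thesis using L by (simp add: field_simps)
  qed
  have "inj G"
  proof (rule injI)
    fix x y assume "G x = G y"
    then have "norm (x - y) \<le> 0" using lower[of "x - y"] by (simp add: ops_simps[OF G])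
    then show "x = y" by simp
  qed
  moreover have "surj G"
  proof (rule surjI)
    fix y :: 'a
    define y' where "y' = complex_of_real (1 / sqrt L) *\<^sub>C y"
    have "\<exists>!x. y' + Z x = x"
      by (rule banach_fix_type[where c = "1/2"])
        (use half in \<open>simp_all add: dist_norm flip: ops_simps(2)[OF Z]\<close>)
    then have "y' + Z (THE x. y' + Z x = x) = (THE x. y' + Z x = x)" by (rule theI')
    then have "(THE x. y' + Z x = x) - Z (THE x. y' + Z x = x) = y'"
      by (metis add_diff_cancel_right')
    then show "G (THE x. complex_of_real (1 / sqrt L) *\<^sub>C y + Z x = x) = y"
      using L unfolding G_def y'_def by (simp add: scaleC_scaleC scaleC_simps flip: of_real_mult)
  qed
  ultimately have "bij G" by (simp add: bij_def)
  show thesis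
    by (rule that[OF G \<open>bij G\<close> ops_inv[OF G \<open>bij G\<close> _ lower] _ nG]) (use L in auto)
qed

section \<open>The defect operator of a contraction\<close>

text \<open>The square root of this operator occurs in the minimal isometric dilation of \<open>C\<close>.  For the
  constructions below the operator itself does as well, and no square root has to be taken.\<close>

definition defect :: "('a::complex_hilbert \<Rightarrow> 'a) \<Rightarrow> 'a \<Rightarrow> 'a"
  where "defect C x = x - C (adj C x)"

lemma contraction_ops: "contraction C \<Longrightarrow> C \<in> ops UNIV UNIV"
  and contraction_le: "contraction C \<Longrightarrow> norm (C x) \<le> norm x"
  by (auto simp: contraction_def)

lemma contraction_funpow_le: "contraction C \<Longrightarrow> norm ((C ^^ n) x) \<le> norm x"
  by (induction n) (auto intro: order_trans[OF contraction_le])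

lemma defect_ops:
  assumes C: "C \<in> ops UNIV UNIV"
  shows "defect C \<in> ops UNIV UNIV"
  using ops_diff[OF ops_ident ops_compose[OF C adj_ops[OF C]]] by (simp add: defect_def[abs_def])

lemma defect_selfadjoint:
  assumes C: "C \<in> ops UNIV UNIV"
  shows "cinner (defect C x) y = cinner x (defect C y)"
proof -
  have "cinner (C (adj C x)) y = cinner (adj C x) (adj C y)" by (rule cinner_adj[OF C])
  also have "\<dots> = cinner x (C (adj C y))" by (rule cinner_adj'[OF C])
  finally show ?thesis by (simp add: defect_def cinner_simps)
qed

text \<open>With \<open>t = s - C\<^sup>* x\<close> the vector on the left is \<open>x + C t\<close>; expand its norm, estimate
  \<open>\<parallel>C t\<parallel> \<le> \<parallel>t\<parallel>\<close> and complete the square.\<close>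

lemma defect_row_contraction:
  assumes C: "contraction C"
  shows "(norm (defect C x + C s))\<^sup>2 \<le> (norm x)\<^sup>2 + (norm s)\<^sup>2"
proof -
  note ops = contraction_ops[OF C]
  define t where "t = s - adj C x"
  have "defect C x + C s = x + C t" by (simp add: defect_def t_def ops_simps[OF ops])
  then have "(norm (defect C x + C s))\<^sup>2 = (norm x)\<^sup>2 + 2 * Re (cinner (adj C x) t) + (norm (C t))\<^sup>2"
    by (simp add: norm_add_sq cinner_adj'[OF ops])
  also have "\<dots> \<le> (norm x)\<^sup>2 + (2 * Re (cinner (adj C x) t) + (norm t)\<^sup>2)"
    using contraction_le[OF C, of t] by (simp add: power_mono)
  also have "2 * Re (cinner (adj C x) t) + (norm t)\<^sup>2 = (norm (adj C x + t))\<^sup>2 - (norm (adj C x))\<^sup>2"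
    by (simp add: norm_add_sq)
  also have "\<dots> \<le> (norm s)\<^sup>2" by (simp add: t_def)
  finally show ?thesis by simp
qed

text \<open>Iterating the row contraction: the sum over \<open>n < N + 1\<close> is \<open>defect C (x 0)\<close> plus \<open>C\<close> applied to
  a sum of the same kind.  Hence \<open>defect C\<close> has its values among the vectors whose orbit under \<open>C\<close>
  admits square-summable combinations.\<close>

lemma defect_sum_bound:
  assumes C: "contraction C"
  shows "(norm (\<Sum>n<N. (C ^^ n) (defect C (x n))))\<^sup>2 \<le> (\<Sum>n<N. (norm (x n))\<^sup>2)"
proof (induction N arbitrary: x)
  case (Suc N)
  note ops = contraction_ops[OF C]
  have "(\<Sum>n<Suc N. (C ^^ n) (defect C (x n)))
      = defect C (x 0) + C (\<Sum>n<N. (C ^^ n) (defect C (x (Suc n))))"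
    by (simp add: sum.lessThan_Suc_shift ops_simps[OF ops] del: sum.lessThan_Suc)
  then have "(norm (\<Sum>n<Suc N. (C ^^ n) (defect C (x n))))\<^sup>2
      \<le> (norm (x 0))\<^sup>2 + (norm (\<Sum>n<N. (C ^^ n) (defect C (x (Suc n)))))\<^sup>2"
    using defect_row_contraction[OF C] by simp
  also have "\<dots> \<le> (norm (x 0))\<^sup>2 + (\<Sum>n<N. (norm (x (Suc n)))\<^sup>2)"
    using Suc.IH[of "\<lambda>n. x (Suc n)"] by simp
  finally show ?case by (simp add: sum.lessThan_Suc_shift del: sum.lessThan_Suc)
qed simp

text \<open>If \<open>y\<close> is orthogonal to all \<open>C\<^sup>n (defect C x)\<close>, then \<open>C\<^sup>*\<close> is isometric along the orbit of
  \<open>y\<close>, so \<open>y\<close> lies in the range of every power of \<open>C\<close>.  The totality of defect orbits is derived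
  from this.\<close>

lemma defect_vanishes_on_adjoint_orbit:
  assumes "\<And>n. defect C ((adj C ^^ n) y) = 0"
  shows "(C ^^ n) ((adj C ^^ n) y) = y"
proof (induction n)
  case (Suc n)
  have "C (adj C ((adj C ^^ n) y)) = (adj C ^^ n) y" using assms[of n] by (simp add: defect_def)
  then have "(C ^^ Suc n) ((adj C ^^ Suc n) y) = (C ^^ n) ((adj C ^^ n) y)"
    by (simp add: funpow_Suc_right del: funpow.simps(2)) (simp flip: funpow_swap1)
  then show ?case using Suc by simp
qed simp

lemma cinner_funpow_adj:
  fixes C :: "'a::complex_hilbert \<Rightarrow> 'a"
  assumes C: "C \<in> ops UNIV UNIV"
  shows "cinner y ((C ^^ n) x) = cinner ((adj C ^^ n) y) x"
proof (induction n arbitrary: x)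
  case (Suc n)
  have "cinner y ((C ^^ Suc n) x) = cinner ((adj C ^^ n) y) (C x)"
    by (simp add: funpow_Suc_right Suc del: funpow.simps(2))
  also have "\<dots> = cinner ((adj C ^^ Suc n) y) x" by (simp add: cinner_adj'[OF C])
  finally show ?case .
qed simp


section \<open>Bessel vectors of a unitary operator\<close>

definition upow :: "('a \<Rightarrow> 'a) \<Rightarrow> int \<Rightarrow> 'a \<Rightarrow> 'a"
  where "upow U n = (if n \<ge> 0 then U ^^ nat n else inv U ^^ nat (- n))"

lemma upow_of_nat [simp]: "upow U (int n) = U ^^ n"
  by (simp add: upow_def)

lemma upow_add_1:
  assumes "bij U" shows "upow U (n + 1) x = U (upow U n x)"
proof (cases "n \<ge> 0")
  case True
  then show ?thesis by (simp add: upow_def nat_add_distrib)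
next
  case False
  then have n: "nat (- n) = Suc (nat (- (n + 1)))" by simp
  have "U (upow U n x) = (inv U ^^ nat (- (n + 1))) x"
    using False unfolding upow_def n by (simp add: bij_is_surj[OF assms] surj_f_inv_f)
  also have "\<dots> = upow U (n + 1) x"
    using False by (cases "n = -1") (simp_all add: upow_def)
  finally show ?thesis by simp
qed

text \<open>Polarisation; the imaginary part of \<open>(x, y)\<close> is the negative of the real part of \<open>(\<i> x, y)\<close>.\<close>

lemma isometry_on_cinner:
  assumes "isometry_on UNIV V" shows "cinner (V x) (V y) = cinner x y"
proof -
  have V: "V \<in> ops UNIV UNIV" and n: "norm (V x) = norm x" for x
    using assms by (auto simp: isometry_on_def)
  have re: "Re (cinner (V x) (V y)) = Re (cinner x y)" for x y
    using norm_add_sq[of "V x" "V y"] norm_add_sq[of x y] by (simp add: n flip: ops_simps(1)[OF V])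
  have "Im z = - Re (\<i> * z)" for z by simp
  then have "Im (cinner u v) = - Re (cinner (\<i> *\<^sub>C u) v)" for u v :: 'a
    by (simp add: cinner_simps)
  then have "Im (cinner (V x) (V y)) = Im (cinner x y)"
    using re[of "\<i> *\<^sub>C x" y] by (simp add: ops_scaleC[OF V])
  with re show ?thesis by (simp add: complex_eq_iff)
qed

lemma isometry_onD:
  assumes "isometry_on UNIV V"
  shows isometry_ops: "V \<in> ops UNIV UNIV" and isometry_norm: "norm (V x) = norm x"
    and isometry_inj: "inj V"
proof -
  show V: "V \<in> ops UNIV UNIV" and n: "norm (V x) = norm x" for x
    using assms by (auto simp: isometry_on_def)
  show "inj V"
  proof (rule injI)
    fix x y assume "V x = V y"
    then have "V (x - y) = 0" by (simp add: ops_simps[OF V])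
    then show "x = y" using n[of "x - y"] by simp
  qed
qed

lemma unitary_onD:
  assumes "unitary_on UNIV U"
  shows "isometry_on UNIV U" "bij U" "inv U \<in> ops UNIV UNIV"
proof -
  show i: "isometry_on UNIV U" using assms by (simp add: unitary_on_def)
  show b: "bij U" using assms isometry_inj[OF i] by (simp add: unitary_on_def bij_def)
  show "inv U \<in> ops UNIV UNIV"
    by (rule ops_inv[OF isometry_ops[OF i] b, of 1]) (simp_all add: isometry_norm[OF i])
qed

lemma cinner_upow:
  assumes U: "unitary_on UNIV U"
  shows "cinner (U x) (upow U (n + 1) y) = cinner x (upow U n y)"
  by (simp add: upow_add_1[OF unitary_onD(2)[OF U]] isometry_on_cinner[OF unitary_onD(1)[OF U]])

lemma cinner_upow_shift:
  assumes U: "unitary_on UNIV U"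
  shows "cinner ((U ^^ m) x) (upow U (int m + n) y) = cinner x (upow U n y)"
proof (induction m)
  case (Suc m)
  have "int (Suc m) + n = int m + n + 1" by simp
  then show ?case using cinner_upow[OF U, of "(U ^^ m) x" "int m + n" y] Suc
    by (simp only: funpow.simps o_apply)
qed simp

text \<open>A Bessel bound for the forward orbit of \<open>r\<close>.  In spectral terms, for unitary \<open>U\<close>, \<open>r\<close> is an absolutely
  continuous vector whose spectral density is bounded by \<open>B\<close>; formulating it through the orbit
  avoids the spectral theorem.\<close>

definition bessel :: "('a::complex_hilbert \<Rightarrow> 'a) \<Rightarrow> 'a \<Rightarrow> real \<Rightarrow> bool"
  where "bessel U r B \<longleftrightarrow> (\<forall>x N. (\<Sum>n<N. (cmod (cinner x ((U ^^ n) r)))\<^sup>2) \<le> B * (norm x)\<^sup>2)"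

text \<open>An estimate for the synthesis operator \<open>a \<mapsto> \<Sum> a n g n\<close> dualises to one for the coefficients
  \<open>(x, g n)\<close>: apply it with these coefficients as \<open>a\<close>.\<close>

lemma bessel_dual:
  fixes g :: "nat \<Rightarrow> 'a::complex_hilbert"
  assumes "B \<ge> 0"
    and bd: "\<And>a N. (norm (\<Sum>n<N. a n *\<^sub>C g n))\<^sup>2 \<le> B * (\<Sum>n<N. (cmod (a n))\<^sup>2)"
  shows "(\<Sum>n<N. (cmod (cinner x (g n)))\<^sup>2) \<le> B * (norm x)\<^sup>2"
proof -
  define t where "t = (\<Sum>n<N. (cmod (cinner x (g n)))\<^sup>2)"
  define v where "v = (\<Sum>n<N. cinner x (g n) *\<^sub>C g n)"
  have t0: "t \<ge> 0" by (simp add: t_def sum_nonneg)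
  have "cinner x v = complex_of_real t"
    by (simp add: v_def t_def cinner_sum_right cinner_simps mult.commute flip: complex_norm_square)
  then have "t \<le> norm x * norm v"
    using cinner_Cauchy_Schwarz[of x v] t0 by simp
  then have "t\<^sup>2 \<le> (norm x)\<^sup>2 * (norm v)\<^sup>2"
    using power_mono[OF _ t0, of "norm x * norm v" 2] by (simp add: power_mult_distrib)
  also have "\<dots> \<le> (norm x)\<^sup>2 * (B * t)"
    unfolding v_def t_def by (intro mult_left_mono bd) simp
  finally have "t * t \<le> t * (B * (norm x)\<^sup>2)" by (simp add: power2_eq_square mult_ac)
  then show ?thesis
    unfolding t_def[symmetric] using t0 \<open>B \<ge> 0\<close> by (cases "t = 0") auto
qed

text \<open>The one-sided bound is two-sided, since a finite set of integers can be moved into the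
  natural numbers by a power of \<open>U\<close>, which preserves inner products.\<close>

lemma bessel_upow:
  assumes U: "unitary_on UNIV U" and r: "bessel U r B" and F: "finite F"
  shows "(\<Sum>n\<in>F. (cmod (cinner x (upow U n r)))\<^sup>2) \<le> B * (norm x)\<^sup>2"
proof -
  obtain m N :: nat where mN: "\<And>n. n \<in> F \<Longrightarrow> 0 \<le> int m + n \<and> int m + n < int N"
  proof -
    have "\<exists>k::nat. \<forall>n\<in>F. \<bar>n\<bar> \<le> int k"
      using finite_imageI[OF F, of abs] by (intro exI[of _ "nat (Max (insert 0 (abs ` F)))"] ballI) auto
    then obtain k :: nat where "\<forall>n\<in>F. \<bar>n\<bar> \<le> int k" by blast
    then show thesis by (intro that[of k "2 * k + 1"]) force
  qed
  have Un: "norm ((U ^^ m) x) = norm x"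
    by (induction m) (simp_all add: isometry_norm[OF unitary_onD(1)[OF U]])
  have "(\<Sum>n\<in>F. (cmod (cinner x (upow U n r)))\<^sup>2)
      = (\<Sum>n\<in>F. (cmod (cinner ((U ^^ m) x) ((U ^^ nat (int m + n)) r)))\<^sup>2)"
  proof (rule sum.cong[OF refl])
    fix n assume "n \<in> F"
    then have "upow U (int m + n) = U ^^ nat (int m + n)" using mN by (simp add: upow_def)
    then show "(cmod (cinner x (upow U n r)))\<^sup>2 = (cmod (cinner ((U ^^ m) x) ((U ^^ nat (int m + n)) r)))\<^sup>2"
      using cinner_upow_shift[OF U, of m x n r] by simp
  qed
  also have "\<dots> = (\<Sum>k\<in>(\<lambda>n. nat (int m + n)) ` F. (cmod (cinner ((U ^^ m) x) ((U ^^ k) r)))\<^sup>2)"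
    by (rule sum.reindex_cong[symmetric, OF _ refl refl]) (use mN in \<open>auto simp: inj_on_def nat_eq_iff2\<close>)
  also have "\<dots> \<le> (\<Sum>k<N. (cmod (cinner ((U ^^ m) x) ((U ^^ k) r)))\<^sup>2)"
    by (rule sum_mono2) (use mN in \<open>force+\<close>)
  also have "\<dots> \<le> B * (norm x)\<^sup>2" using r Un unfolding bessel_def by metis
  finally show ?thesis .
qed

text \<open>The two-sided sequence \<open>((x, U\<^sup>n r))\<^sub>n\<close> as an element of \<open>\<ell>\<^sup>2\<close>, the integers being enumerated
  by \<open>int_decode\<close>.  This operator intertwines \<open>U\<close> with the bilateral shift.  Both the
  operators commuting with \<open>U\<close> and the maps by which an asymptote is tested are built from it.\<close>

definition bilateral_coeffs :: "('a::complex_hilbert \<Rightarrow> 'a) \<Rightarrow> 'a \<Rightarrow> 'a \<Rightarrow> ell2"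
  where "bilateral_coeffs U r x = Abs_hsum (\<lambda>k. cinner x (upow U (int_decode k) r))"

definition bilateral_shift :: "ell2 \<Rightarrow> ell2"
  where "bilateral_shift a = Abs_hsum (\<lambda>k. hsum_nth a (int_encode (int_decode k - 1)))"

lemma inj_int_pred: "inj (\<lambda>k. int_encode (int_decode k - 1))"
  by (rule injI) (metis int_encode_inverse int_decode_inverse diff_add_cancel)

lemma surj_int_pred: "k \<in> range (\<lambda>k. int_encode (int_decode k - 1))"
  by (rule range_eqI[of _ _ "int_encode (int_decode k + 1)"]) simp

lemma hsum_nth_bilateral_shift:
  "hsum_nth (bilateral_shift a) k = hsum_nth a (int_encode (int_decode k - 1))"
  using summable_reindex[OF summable_hsum[of a] inj_int_pred]
  by (simp add: bilateral_shift_def Abs_hsum_inverse o_def)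

lemma isometry_bilateral_shift: "isometry_on UNIV bilateral_shift"
proof -
  have n: "norm (bilateral_shift a) = norm a" for a
  proof -
    have "(norm (bilateral_shift a))\<^sup>2 = (norm a)\<^sup>2"
      using suminf_reindex[OF summable_hsum[of a] inj_int_pred _ ] surj_int_pred
      by (simp add: norm_hsum_sq hsum_nth_bilateral_shift o_def)
    then show ?thesis by (simp add: power2_eq_iff_nonneg)
  qed
  have "bilateral_shift \<in> ops UNIV UNIV"
    unfolding ops_def mem_Collect_eq
    by (intro conjI ballI allI exI[of _ 1] hsum_eqI)
      (simp_all add: hsum_nth_bilateral_shift plus_hsum.rep_eq scaleC_hsum.rep_eq n)
  then show ?thesis using n by (simp add: isometry_on_def)
qed

context
  fixes U :: "'a::complex_hilbert \<Rightarrow> 'a" and r B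
  assumes U: "unitary_on UNIV U" and r: "bessel U r B"
begin

lemma
  shows hsum_nth_bilateral_coeffs:
      "hsum_nth (bilateral_coeffs U r x) k = cinner x (upow U (int_decode k) r)"
    and bilateral_coeffs_ops: "bilateral_coeffs U r \<in> ops UNIV UNIV"
proof -
  have bd: "(\<Sum>k<N. (cmod (cinner x (upow U (int_decode k) r)))\<^sup>2) \<le> B * (norm x)\<^sup>2" for x N
  proof -
    have "(\<Sum>k<N. (cmod (cinner x (upow U (int_decode k) r)))\<^sup>2)
        = (\<Sum>n\<in>int_decode ` {..<N}. (cmod (cinner x (upow U n r)))\<^sup>2)"
      by (rule sum.reindex_cong[symmetric, OF _ refl refl]) (rule inj_int_decode)
    then show ?thesis using bessel_upow[OF U r, of "int_decode ` {..<N}" x] by simp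
  qed
  have summ: "summable (\<lambda>k. (cmod (cinner x (upow U (int_decode k) r)))\<^sup>2)" for x
    by (rule bounded_imp_summable[where B = "B * (norm x)\<^sup>2"])
      (use bd[where N = "Suc _"] in \<open>simp_all add: lessThan_Suc_atMost\<close>)
  show nth: "hsum_nth (bilateral_coeffs U r x) k = cinner x (upow U (int_decode k) r)" for x k
    by (simp add: bilateral_coeffs_def Abs_hsum_inverse summ)
  have "(norm (bilateral_coeffs U r x))\<^sup>2 \<le> B * (norm x)\<^sup>2" for x
    unfolding norm_hsum_sq nth by (rule suminf_le_const[OF summ bd])
  then have "norm (bilateral_coeffs U r x) \<le> sqrt B * norm x" for x
    using real_le_rsqrt[of "norm (bilateral_coeffs U r x)" "B * (norm x)\<^sup>2"] by (simp add: real_sqrt_mult)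
  then show "bilateral_coeffs U r \<in> ops UNIV UNIV"
    unfolding ops_def mem_Collect_eq
    by (intro conjI ballI allI exI[of _ "sqrt B"] hsum_eqI)
      (simp_all add: nth plus_hsum.rep_eq scaleC_hsum.rep_eq cinner_simps scaleC_complex_def)
qed

lemma bilateral_coeffs_intertwines:
  "bilateral_coeffs U r (U x) = bilateral_shift (bilateral_coeffs U r x)"
  by (rule hsum_eqI)
    (simp add: hsum_nth_bilateral_shift hsum_nth_bilateral_coeffs flip: cinner_upow[OF U, of x])

end

text \<open>The orbit of a wandering vector consists of pairwise orthogonal vectors of norm \<open>\<parallel>w\<parallel>\<close>, so
  Pythagoras' theorem gives the bound.\<close>

lemma bessel_wandering:
  assumes U: "unitary_on UNIV U" and w: "\<And>n. n \<ge> 1 \<Longrightarrow> cinner ((U ^^ n) w) w = 0"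
  shows "bessel U w ((norm w)\<^sup>2)"
  unfolding bessel_def
proof (intro allI, rule bessel_dual)
  show "0 \<le> (norm w)\<^sup>2" by simp
  note iso = unitary_onD(1)[OF U]
  have c: "cinner ((U ^^ n) x) ((U ^^ n) y) = cinner x y" for n x y
    by (induction n) (simp_all add: isometry_on_cinner[OF iso])
  have orth: "cinner ((U ^^ m) w) ((U ^^ n) w) = 0" if "m < n" for m n
  proof -
    have "cinner ((U ^^ m) w) ((U ^^ m) ((U ^^ (n - m)) w)) = cnj (cinner ((U ^^ (n - m)) w) w)"
      by (simp only: c) (rule cinner_commute)
    moreover have "(U ^^ m) ((U ^^ (n - m)) w) = (U ^^ n) w"
      using that by (simp flip: funpow_add[THEN fun_cong, unfolded o_apply])
    ultimately show ?thesis using w[of "n - m"] that by simp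
  qed
  show "(norm (\<Sum>n<N. a n *\<^sub>C (U ^^ n) w))\<^sup>2 \<le> (norm w)\<^sup>2 * (\<Sum>n<N. (cmod (a n))\<^sup>2)" for a N
  proof (induction N)
    case (Suc N)
    have "cinner (\<Sum>n<N. a n *\<^sub>C (U ^^ n) w) (a N *\<^sub>C (U ^^ N) w) = 0"
      by (simp add: cinner_sum_left cinner_simps orth)
    moreover have "norm ((U ^^ N) w) = norm w"
      by (induction N) (simp_all add: isometry_norm[OF iso])
    ultimately show ?case using Suc
      by (simp only: sum.lessThan_Suc norm_add_sq norm_scaleC power_mult_distrib distrib_left)
        (simp add: mult.commute)
  qed simp
qed

text \<open>A wandering vector generates a copy of the bilateral shift, which can be mapped into any Bessel
  orbit by an operator of the commutant: the composition of \<open>bilateral_coeffs U w\<close> with the adjoint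
  of \<open>bilateral_coeffs U r\<close> commutes with \<open>U\<close> and maps \<open>w\<close> to a nonzero multiple of \<open>r\<close>.  Hence a
  hyperinvariant subspace with a wandering vector contains all Bessel vectors.\<close>

lemma hyperinvariant_wandering:
  assumes U: "unitary_on UNIV U" and E: "E \<in> Hlat U" and "w \<in> E" "w \<noteq> 0"
    and w: "\<And>n. n \<ge> 1 \<Longrightarrow> cinner ((U ^^ n) w) w = 0" and r: "bessel U r B"
  shows "r \<in> E"
proof -
  note iso = unitary_onD(1)[OF U] and b = unitary_onD(2)[OF U]
  have bw: "bessel U w ((norm w)\<^sup>2)" by (rule bessel_wandering[OF U w])
  note Pr = bilateral_coeffs_ops[OF U r] and Pw = bilateral_coeffs_ops[OF U bw]
  define A where "A x = adj (bilateral_coeffs U r) (bilateral_coeffs U w x)" for x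
  have A: "A \<in> ops UNIV UNIV"
    unfolding A_def by (rule ops_compose[OF adj_ops[OF Pr] Pw])
  have "A (U x) = U (A x)" for x
  proof (rule cinner_eqI)
    fix y
    define y' where "y' = inv U y"
    have y: "y = U y'" by (simp add: y'_def surj_f_inv_f bij_is_surj[OF b])
    have "cinner (A (U x)) y = cinner (A x) y'"
      unfolding A_def y cinner_adj'[OF Pr] bilateral_coeffs_intertwines[OF U r]
        bilateral_coeffs_intertwines[OF U bw]
      by (simp add: isometry_on_cinner[OF isometry_bilateral_shift])
    also have "\<dots> = cinner (U (A x)) y" by (simp add: y isometry_on_cinner[OF iso])
    finally show "cinner y (A (U x)) = cinner y (U (A x))" by (metis cinner_commute)
  qed
  then have "A w \<in> E" using E A \<open>w \<in> E\<close> by (auto simp: Hlat_def)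
  moreover have "A w = complex_of_real ((norm w)\<^sup>2) *\<^sub>C r"
  proof (rule cinner_eqI)
    fix y
    have zero: "cinner w (upow U n w) = 0" if "n \<noteq> 0" for n
    proof (cases "n > 0")
      case True
      then show ?thesis using w[of "nat n"] by (simp add: upow_def cinner_commute[of w])
    next
      case False
      then show ?thesis
        using that w[of "nat (- n)"] cinner_upow_shift[OF U, of "nat (- n)" w n w]
        by (simp add: upow_def)
    qed
    have "cinner (A w) y = (\<Sum>k. cinner w (upow U (int_decode k) w) * cnj (cinner y (upow U (int_decode k) r)))"
      by (simp add: A_def cinner_adj'[OF Pr] cinner_hsum_def cinner_complex_def
          hsum_nth_bilateral_coeffs[OF U r] hsum_nth_bilateral_coeffs[OF U bw])
    also have "\<dots> = (\<Sum>k\<in>{int_encode 0}. cinner w (upow U (int_decode k) w) * cnj (cinner y (upow U (int_decode k) r)))"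
    proof (rule suminf_finite)
      fix k assume "k \<notin> {int_encode 0}"
      then have "int_decode k \<noteq> 0" by (metis int_decode_inverse singletonI)
      then show "cinner w (upow U (int_decode k) w) * cnj (cinner y (upow U (int_decode k) r)) = 0"
        by (simp add: zero)
    qed simp
    also have "\<dots> = complex_of_real ((norm w)\<^sup>2) * cinner r y"
      by (simp add: upow_def cinner_self flip: cinner_commute)
    finally have "cinner (A w) y = cinner (complex_of_real ((norm w)\<^sup>2) *\<^sub>C r) y"
      by (simp add: cinner_simps)
    then show "cinner y (A w) = cinner y (complex_of_real ((norm w)\<^sup>2) *\<^sub>C r)"
      by (metis cinner_commute)
  qed
  ultimately have "(1 / complex_of_real ((norm w)\<^sup>2)) *\<^sub>C complex_of_real ((norm w)\<^sup>2) *\<^sub>C r \<in> E"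
    using E by (auto simp: Hlat_def csubspaces_def)
  then show ?thesis using \<open>w \<noteq> 0\<close> by (simp add: scaleC_scaleC scaleC_simps)
qed

text \<open>Wold: an invariant subspace that is not reducing contains a wandering vector, namely any
  nonzero vector of \<open>N \<ominus> U N\<close>.\<close>

lemma wandering_vector_exists:
  assumes U: "unitary_on UNIV U" and N: "N \<in> csubspaces" and sub: "U ` N \<subseteq> N" and ne: "U ` N \<noteq> N"
  obtains w where "w \<in> N" "w \<noteq> 0" "\<And>n. n \<ge> 1 \<Longrightarrow> cinner ((U ^^ n) w) w = 0"
proof -
  note b = unitary_onD(2)[OF U]
  have "U ` N = {y. inv U y \<in> N}"
    using b by (auto simp: bij_is_inj bij_is_surj surj_f_inv_f intro!: image_eqI[of _ U "inv U _"])
  then have UN: "U ` N \<in> csubspaces" using csubspaces_kernel[OF unitary_onD(3)[OF U] N] by simp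
  obtain x where x: "x \<in> N" "x \<notin> U ` N" using sub ne by blast
  define w where "w = x - proj (U ` N) x"
  have wN: "w \<in> N" unfolding w_def using csubspaces_diff[OF N x(1)] proj_in[OF UN] sub by blast
  have w: "w \<in> orth (U ` N)" unfolding w_def by (rule proj_orth[OF UN])
  have "w \<noteq> 0" using x(2) proj_in[OF UN, of x] by (auto simp: w_def)
  have pow: "(U ^^ n) w \<in> N" for n by (induction n) (use wN sub in auto)
  show thesis
  proof (rule that[OF wN \<open>w \<noteq> 0\<close>])
    fix n :: nat assume "n \<ge> 1"
    then obtain m where "n = Suc m" by (cases n) auto
    then have "(U ^^ n) w \<in> U ` N" using pow[of m] by simp
    then show "cinner ((U ^^ n) w) w = 0" by (rule orthD'[OF w])
  qed
qed


section \<open>Quasiaffinities from a shift into a contraction\<close>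

lemma ops_suminf:
  fixes A :: "nat \<Rightarrow> 'a::complex_hilbert \<Rightarrow> 'b::complex_hilbert"
  assumes A: "\<And>k. A k \<in> ops UNIV UNIV" and bd: "\<And>k f. norm (A k f) \<le> m k * norm f"
    and m: "summable m"
  shows "summable (\<lambda>k. A k f)" and "(\<lambda>f. \<Sum>k. A k f) \<in> ops UNIV UNIV"
proof -
  have sn: "summable (\<lambda>k. norm (A k f))" for f
    by (rule summable_comparison_test'[OF summable_mult2[OF m, of "norm f"]]) (simp add: bd)
  then show s: "summable (\<lambda>k. A k f)" for f by (rule summable_norm_cancel)
  have "norm (\<Sum>k. A k f) \<le> suminf m * norm f" for f
  proof -
    have "norm (\<Sum>k. A k f) \<le> (\<Sum>k. norm (A k f))" by (rule summable_norm[OF sn])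
    also have "\<dots> \<le> (\<Sum>k. m k * norm f)" by (rule suminf_le[OF bd sn summable_mult2[OF m]])
    also have "\<dots> = suminf m * norm f" by (rule suminf_mult2[OF m, symmetric])
    finally show ?thesis .
  qed
  moreover have "(\<Sum>k. A k (f + g)) = (\<Sum>k. A k f) + (\<Sum>k. A k g)" for f g
    by (simp add: ops_simps[OF A] suminf_add[OF s s])
  moreover have "(\<Sum>k. A k (c *\<^sub>C f)) = c *\<^sub>C (\<Sum>k. A k f)" for c f
    unfolding ops_scaleC[OF A] by (rule bounded_linear.suminf[OF bounded_linear_scaleC s, symmetric])
  ultimately show "(\<lambda>f. \<Sum>k. A k f) \<in> ops UNIV UNIV" unfolding ops_def by auto
qed

text \<open>The estimate \<open>defect_sum_bound\<close> applied to a sequence whose first \<open>m\<close> members are replaced by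
  zero controls the tails of the series.\<close>

lemma defect_series_summable:
  assumes C: "contraction C" and x: "summable (\<lambda>n. (norm (x n))\<^sup>2)"
  shows "summable (\<lambda>n. (C ^^ n) (defect C (x n)))"
  unfolding summable_Cauchy
proof (intro allI impI)
  note q = defect_ops[OF contraction_ops[OF C]]
  fix e :: real assume e: "e > 0"
  then obtain N where N: "\<And>m n. m \<ge> N \<Longrightarrow> norm (\<Sum>k=m..<n. (norm (x k))\<^sup>2) < e\<^sup>2"
    using x[unfolded summable_Cauchy, rule_format, of "e\<^sup>2"] by auto
  have "norm (\<Sum>k=m..<n. (C ^^ k) (defect C (x k))) < e" if "m \<ge> N" for m n
  proof -
    let ?x = "\<lambda>k. if k < m then 0 else x k"
    have "(\<Sum>k<n. (C ^^ k) (defect C (?x k))) = (\<Sum>k=m..<n. (C ^^ k) (defect C (?x k)))"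
      by (rule sum.mono_neutral_right)
        (auto simp: ops_simps(3)[OF q] ops_simps(3)[OF ops_funpow[OF contraction_ops[OF C]]])
    moreover have "(\<Sum>k<n. (norm (?x k))\<^sup>2) = (\<Sum>k=m..<n. (norm (?x k))\<^sup>2)"
      by (rule sum.mono_neutral_right) auto
    ultimately have "(norm (\<Sum>k=m..<n. (C ^^ k) (defect C (x k))))\<^sup>2 \<le> (\<Sum>k=m..<n. (norm (x k))\<^sup>2)"
      using defect_sum_bound[OF C, where x = ?x and N = n] by simp
    also have "\<dots> < e\<^sup>2" using N[OF that, of n] by simp
    finally show ?thesis using e by (simp add: power2_less_imp_less)
  qed
  then show "\<exists>N. \<forall>m\<ge>N. \<forall>n. norm (\<Sum>k=m..<n. (C ^^ k) (defect C (x k))) < e" by blast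
qed

lemma adj_isometry:
  assumes S: "isometry_on UNIV S"
  shows adj_isometry_left_inverse: "adj S (S f) = f"
    and norm_defect_isometry: "(norm (defect S f))\<^sup>2 = (norm f)\<^sup>2 - (norm (adj S f))\<^sup>2"
proof -
  note ops = isometry_ops[OF S]
  show "adj S (S f) = f"
    by (rule cinner_eqI) (simp add: isometry_on_cinner[OF S] flip: cinner_adj[OF ops])
  have "cinner f (S (adj S f)) = cinner (adj S f) (adj S f)" by (rule cinner_adj'[OF ops, symmetric])
  then show "(norm (defect S f))\<^sup>2 = (norm f)\<^sup>2 - (norm (adj S f))\<^sup>2"
    using norm_add_sq[of f "- S (adj S f)"]
    by (simp add: defect_def cinner_simps cinner_self isometry_norm[OF S])
qed

text \<open>The quasiaffinity is \<open>Z f = \<Sum>n. C\<^sup>n q (c (S\<^sup>*\<^sup>n f))\<close> with \<open>q = defect C\<close>.  The series converges by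
  \<open>defect_sum_bound\<close>: \<open>c\<close> sees only the component of \<open>S\<^sup>*\<^sup>n f\<close> in the wandering subspace, and the
  squares of these components add up to at most \<open>\<parallel>f\<parallel>\<^sup>2\<close>.  Three observations give the rest.

  \<^item> The recursion \<open>Z f = q (c f) + C (Z (S\<^sup>* f))\<close> together with \<open>c S = 0\<close> gives \<open>Z S = C Z\<close>.

  \<^item> If \<open>Z f = 0\<close>, then \<open>q (c f)\<close>, and with it \<open>c f\<close>, lies in the range of \<open>C\<close>; hence \<open>f = S g\<close>, and
  \<open>Z g = 0\<close> as \<open>C\<close> is injective.  So \<open>f\<close> is divisible by all powers of \<open>S\<close>.

  \<^item> A vector \<open>y\<close> orthogonal to the range of \<open>Z\<close> satisfies \<open>y = C\<^sup>n C\<^sup>*\<^sup>n y\<close>, whence \<open>X y\<close> is in the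
  range of every \<open>S\<^sup>n\<close>.

  The operator \<open>X\<close> gives the injectivity of \<open>C\<close> in the second point and brings in the purity of \<open>S\<close>
  in the third.\<close>

lemma quasiaffine_transform_from_wandering_map:
  fixes S :: "'b::complex_hilbert \<Rightarrow> 'b" and C :: "'a::complex_hilbert \<Rightarrow> 'a"
  assumes S: "isometry_on UNIV S" and pure: "\<And>f. (\<And>n. f \<in> range (S ^^ n)) \<Longrightarrow> f = 0"
    and C: "contraction C" and X0: "\<And>x. X x = 0 \<Longrightarrow> x = 0" and X: "\<And>x. X (C x) = S (X x)"
    and X_ops: "X \<in> ops UNIV UNIV"
    and c: "c \<in> ops UNIV UNIV" and cS: "\<And>f. c (S f) = 0"
    and dense: "\<And>y. (\<And>f. cinner y (c f) = 0) \<Longrightarrow> y = 0"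
    and cC: "\<And>f x. c f = C x \<Longrightarrow> f \<in> range S"
  shows "quasiaffine_transform S C"
proof -
  note Sop = isometry_ops[OF S] and Cop = contraction_ops[OF C]
  note qop = defect_ops[OF Cop] and Ssop = adj_ops[OF Sop]
  obtain B where B: "B > 0" "\<And>f. norm (c f) \<le> B * norm f" using ops_bound[OF c] by blast
  define a where "a f n = c ((adj S ^^ n) f)" for f n
  have a_le: "(\<Sum>n<N. (norm (a f n))\<^sup>2) \<le> B\<^sup>2 * (norm f)\<^sup>2" for f N
  proof -
    have "(norm (a f n))\<^sup>2 \<le> B\<^sup>2 * ((norm ((adj S ^^ n) f))\<^sup>2 - (norm ((adj S ^^ Suc n) f))\<^sup>2)" for n
    proof -
      let ?g = "(adj S ^^ n) f"
      have "c ?g = c (defect S ?g)" by (simp add: defect_def ops_simps[OF c] cS)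
      then have "(norm (a f n))\<^sup>2 \<le> (B * norm (defect S ?g))\<^sup>2"
        unfolding a_def using B(2) by (metis norm_ge_zero power_mono)
      then show ?thesis by (simp add: power_mult_distrib norm_defect_isometry[OF S])
    qed
    then have "(\<Sum>n<N. (norm (a f n))\<^sup>2)
        \<le> (\<Sum>n<N. B\<^sup>2 * ((norm ((adj S ^^ n) f))\<^sup>2 - (norm ((adj S ^^ Suc n) f))\<^sup>2))"
      by (intro sum_mono)
    also have "\<dots> = B\<^sup>2 * ((norm f)\<^sup>2 - (norm ((adj S ^^ N) f))\<^sup>2)"
      by (induction N) (simp_all add: algebra_simps)
    also have "\<dots> \<le> B\<^sup>2 * (norm f)\<^sup>2" by (intro mult_left_mono) auto
    finally show ?thesis .
  qed
  have a_summable: "summable (\<lambda>n. (norm (a f n))\<^sup>2)" for f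
    by (rule bounded_imp_summable[where B = "B\<^sup>2 * (norm f)\<^sup>2"])
      (use a_le[where N = "Suc _"] in \<open>simp_all add: lessThan_Suc_atMost\<close>)
  define t where "t f n = (C ^^ n) (defect C (a f n))" for f n
  have t_summable: "summable (t f)" for f
    unfolding t_def by (rule defect_series_summable[OF C a_summable])
  have t_ops: "(\<lambda>f. t f n) \<in> ops UNIV UNIV" for n
    unfolding t_def a_def
    by (intro ops_compose[OF ops_funpow[OF Cop]] ops_compose[OF qop] ops_compose[OF c] ops_funpow[OF Ssop])
  define Z where "Z f = (\<Sum>n. t f n)" for f
  have "norm (Z f) \<le> B * norm f" for f
  proof -
    have lim: "(\<lambda>N. norm (\<Sum>n<N. t f n)) \<longlonglongrightarrow> norm (Z f)"
      unfolding Z_def by (intro tendsto_norm summable_LIMSEQ t_summable)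
    have "norm (\<Sum>n<N. t f n) \<le> B * norm f" for N
    proof -
      have "(norm (\<Sum>n<N. t f n))\<^sup>2 \<le> (B * norm f)\<^sup>2"
        unfolding t_def power_mult_distrib by (rule order_trans[OF defect_sum_bound[OF C] a_le])
      then show ?thesis using B by (simp add: power2_le_iff_abs_le)
    qed
    then show ?thesis by (intro LIMSEQ_le_const2[OF lim]) auto
  qed
  moreover have "Z (f + g) = Z f + Z g" for f g
    by (simp add: Z_def ops_simps[OF t_ops] suminf_add[OF t_summable t_summable])
  moreover have "Z (b *\<^sub>C f) = b *\<^sub>C Z f" for b f
    unfolding Z_def ops_scaleC[OF t_ops]
    by (rule bounded_linear.suminf[OF bounded_linear_scaleC t_summable, symmetric])
  ultimately have Zop: "Z \<in> ops UNIV UNIV" unfolding ops_def by auto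
  have Z_split: "Z f = defect C (c f) + C (Z (adj S f))" for f
  proof -
    have "t f (Suc n) = C (t (adj S f) n)" for n
      by (simp add: t_def a_def funpow_swap1)
    then have "(\<Sum>n. t f (Suc n)) = C (Z (adj S f))"
      unfolding Z_def by (simp add: bounded_linear.suminf[OF ops_linear[OF Cop] t_summable])
    moreover have "t f 0 = defect C (c f)" by (simp add: t_def a_def)
    ultimately show ?thesis
      using suminf_split_head[OF t_summable[of f]] by (simp add: Z_def[of f] algebra_simps)
  qed
  have inter: "Z (S f) = C (Z f)" for f
    using Z_split[of "S f"] by (simp add: cS ops_simps[OF qop] adj_isometry_left_inverse[OF S])
  have C0: "x = 0" if "C x = 0" for x
  proof -
    have "S (X x) = 0" using X[of x] that by (simp add: ops_simps[OF X_ops])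
    then have "X x = 0" using isometry_norm[OF S, of "X x"] by simp
    then show ?thesis by (rule X0)
  qed
  have Z0: "f = 0" if "Z f = 0" for f
  proof (rule pure)
    fix n
    have "\<exists>g. f = (S ^^ n) g \<and> Z g = 0"
    proof (induction n)
      case 0
      then show ?case using that by simp
    next
      case (Suc n)
      then obtain g where g: "f = (S ^^ n) g" "Z g = 0" by blast
      have "c g = C (adj C (c g) - Z (adj S g))"
        using Z_split[of g] g(2) by (simp add: defect_def ops_simps[OF Cop] algebra_simps)
      then obtain h where h: "g = S h" using cC by blast
      have "Z h = 0" by (rule C0) (use inter[of h] g(2) h in simp)
      moreover have "f = (S ^^ Suc n) h" using g(1) h by (simp add: funpow_swap1)
      ultimately show ?case by blast
    qed
    then show "f \<in> range (S ^^ n)" by blast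
  qed
  have "closure (range Z) = UNIV"
  proof (rule dense_rangeI[OF Zop])
    fix y assume y: "\<And>f. cinner y (Z f) = 0"
    have "defect C ((adj C ^^ n) y) = 0" for n
    proof (rule dense)
      fix f
      let ?g = "defect S f"
      have "adj S ?g = 0" by (simp add: defect_def ops_simps[OF Ssop] adj_isometry_left_inverse[OF S])
      then have "Z ?g = defect C (c ?g)" using Z_split[of ?g] by (simp add: ops_simps[OF Zop] ops_simps[OF Cop])
      also have "c ?g = c f" by (simp add: defect_def ops_simps[OF c] cS)
      finally have Zg: "Z ?g = defect C (c f)" .
      have "Z ((S ^^ n) ?g) = (C ^^ n) (Z ?g)" by (induction n) (simp_all add: inter)
      then have "cinner y ((C ^^ n) (defect C (c f))) = 0" using y[of "(S ^^ n) ?g"] Zg by simp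
      then show "cinner (defect C ((adj C ^^ n) y)) (c f) = 0"
        by (simp add: defect_selfadjoint[OF Cop] cinner_funpow_adj[OF Cop])
    qed
    then have yn: "(C ^^ n) ((adj C ^^ n) y) = y" for n by (rule defect_vanishes_on_adjoint_orbit)
    have "X ((C ^^ n) x) = (S ^^ n) (X x)" for n x by (induction n) (simp_all add: X)
    then have "X y \<in> range (S ^^ n)" for n by (metis yn rangeI)
    then have "X y = 0" by (rule pure)
    then show "y = 0" by (rule X0)
  qed
  then have "quasiaffinity Z" using Zop Z0 ops_simps(3)[OF Zop] by (auto simp: quasiaffinity_def)
  then show ?thesis using inter by (auto simp: quasiaffine_transform_def)
qed

text \<open>Project a countable dense set and normalise.\<close>

lemma dense_sequence_in_subspace:
  fixes D :: "'a::complex_hilbert set"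
  assumes D: "D \<in> csubspaces"
  shows "\<exists>v :: nat \<Rightarrow> 'a. (\<forall>k. v k \<in> D \<and> norm (v k) \<le> 1) \<and>
    (\<forall>y\<in>D. (\<forall>k. cinner y (v k) = 0) \<longrightarrow> y = 0)"
proof -
  obtain A :: "'a set" where A: "countable A" "\<And>S. open S \<Longrightarrow> S \<noteq> {} \<Longrightarrow> \<exists>d\<in>A. d \<in> S"
    using countable_dense_exists by blast
  have "A \<noteq> {}" using A(2)[of UNIV] by auto
  define d where "d = from_nat_into A"
  have rd: "range d = A" unfolding d_def using A(1) \<open>A \<noteq> {}\<close> by (simp add: range_from_nat_into)
  have cl: "closure A = UNIV"
    using A(2)[of "- closure A"] closure_subset[of A] by blast
  define v where "v k = complex_of_real (1 / (1 + norm (proj D (d k)))) *\<^sub>C proj D (d k)" for k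
  show ?thesis
  proof (intro exI[of _ v] conjI allI ballI impI)
    show "v k \<in> D" for k using D proj_in[OF D] by (simp add: v_def csubspaces_def)
    have pos: "1 + norm (proj D (d k)) > 0" for k using norm_ge_zero[of "proj D (d k)"] by linarith
    show "norm (v k) \<le> 1" for k
      using pos[of k] by (simp only: v_def norm_scaleC norm_of_real) (simp add: field_simps)
    fix y assume y: "y \<in> D" and "\<forall>k. cinner y (v k) = 0"
    then have v: "cinner y (v k) = 0" for k by blast
    show "y = 0"
    proof (rule dense_orth_zero[OF cl])
      fix a assume "a \<in> A"
      then obtain k where k: "a = d k" using rd by blast
      have "1 / (1 + norm (proj D a)) \<noteq> 0" using pos[of k] by (simp add: k)
      then have "cinner y (proj D a) = 0"
        using v[of k] by (simp only: v_def k cinner_scaleC_right mult_eq_0_iff complex_cnj_complex_of_real of_real_eq_0_iff) simp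
      moreover have "cinner y (a - proj D a) = 0" by (rule orthD'[OF proj_orth[OF D] y])
      ultimately show "cinner y a = 0" by (simp add: cinner_simps)
    qed
  qed
qed

text \<open>The range of \<open>C\<close> is orthogonal to the vectors \<open>X\<^sup>* e\<^sub>k\<close>, as \<open>X C = S X\<close> and \<open>e\<^sub>k\<close> is orthogonal
  to the range of \<open>S\<close>.  So \<open>c f\<close> should have a nonzero component in their closed span for every
  \<open>f\<close> with a nonzero coordinate, and yet \<open>c\<close> should have dense range.  The coordinates of \<open>f\<close> are split into
  \<open>u\<^sub>k\<close> (even indices) and \<open>v\<^sub>k\<close> (odd indices).  The odd ones produce, with weights \<open>2\<^sup>-\<^sup>k\<close>, a dense subset of
  the orthogonal complement of the span, and both produce the component in the span,
  \<open>X\<^sup>* (\<Sum>k. (4\<^sup>-\<^sup>k u\<^sub>k + 2\<^sup>-\<^sup>k v\<^bsub>i(k)\<^esub>) e\<^sub>k)\<close>, where \<open>i\<close> takes every value infinitely often.  If this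
  vanishes, then \<open>v\<^bsub>i(k)\<^esub> = - 2\<^sup>-\<^sup>k u\<^sub>k\<close> for all \<open>k\<close>; fixing \<open>i(k)\<close> and letting \<open>k\<close> grow gives
  \<open>v = 0\<close> and then \<open>u = 0\<close>.  The different decay rates thus make the two operators on
  \<open>\<ell>\<^sup>2\<close> have ranges that meet only in \<open>0\<close>, although the first has dense range.\<close>

lemma wandering_map_exists:
  fixes S :: "'b::complex_hilbert \<Rightarrow> 'b" and C :: "'a::complex_hilbert \<Rightarrow> 'a" and e :: "nat \<Rightarrow> 'b"
  assumes Xq: "quasiaffinity X" and X: "\<And>x. X (C x) = S (X x)"
    and e: "\<And>j k. cinner (e j) (e k) = (if j = k then 1 else 0)"
    and eS: "\<And>f k. cinner (S f) (e k) = 0"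
    and total: "\<And>f. (\<And>k. cinner f (e k) = 0) \<Longrightarrow> f \<in> range S"
  obtains c where "c \<in> ops UNIV UNIV" "\<And>f. c (S f) = 0"
    "\<And>y. (\<And>f. cinner y (c f) = 0) \<Longrightarrow> y = 0" "\<And>f x. c f = C x \<Longrightarrow> f \<in> range S"
proof -
  have Xop: "X \<in> ops UNIV UNIV" using Xq by (simp add: quasiaffinity_def)
  note Xa = adj_ops[OF Xop]
  have ne: "norm (e k) = 1" for k
  proof -
    have "complex_of_real ((norm (e k))\<^sup>2) = complex_of_real (1\<^sup>2)"
      using e[of k k] by (simp only: cinner_self) simp
    then have "(norm (e k))\<^sup>2 = 1\<^sup>2" by (simp only: of_real_eq_iff)
    then show ?thesis by (subst (asm) power2_eq_iff_nonneg) auto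
  qed
  have fe: "cmod (cinner f (e k)) \<le> norm f" for f k
    using cinner_Cauchy_Schwarz[of f "e k"] by (simp add: ne)
  define D where "D = orth (range (\<lambda>k. adj X (e k)))"
  have D: "y \<in> D \<longleftrightarrow> (\<forall>k. cinner (X y) (e k) = 0)" for y
    by (auto simp: D_def orth_def cinner_adj[OF Xop])
  have "D \<in> csubspaces" unfolding D_def by (rule orth_csubspaces)
  from dense_sequence_in_subspace[OF this] obtain v :: "nat \<Rightarrow> 'a"
    where v_seq: "\<forall>k. v k \<in> D \<and> norm (v k) \<le> 1"
    and v_total: "\<forall>y\<in>D. (\<forall>k. cinner y (v k) = 0) \<longrightarrow> y = 0" by blast
  have vD: "v k \<in> D" and v1: "norm (v k) \<le> 1" for k using v_seq by blast+
  \<comment> \<open>In the notation above this is \<open>i(k)\<close>; each row of the pairing function is infinite.\<close>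
  define row where "row k = fst (prod_decode k)" for k
  define \<beta> where "\<beta> k f = (1/4)^k * cinner f (e (2 * k)) + (1/2)^k * cinner f (e (2 * row k + 1))" for k f
  have coord: "(\<lambda>f. cinner f (e k)) \<in> ops UNIV UNIV" for k
    by (auto simp: ops_UNIV_iff bounded_linear_cinner_left cinner_simps scaleC_complex_def)
  have mult: "(\<lambda>f. g f *\<^sub>C u) \<in> ops UNIV UNIV"
    if g: "g \<in> ops UNIV UNIV" for g :: "'b \<Rightarrow> complex" and u :: "'c::complex_hilbert"
  proof -
    obtain M where M: "\<And>x. cmod (g x) \<le> M * norm x" using ops_bound[OF g] by blast
    show ?thesis
      unfolding ops_def mem_Collect_eq
    proof (intro conjI ballI allI exI[of _ "M * norm u"])
      show "norm (g x *\<^sub>C u) \<le> M * norm u * norm x" for x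
        using mult_right_mono[OF M[of x] norm_ge_zero[of u]] by (simp add: norm_scaleC mult_ac)
    qed (auto simp: ops_simps[OF g] scaleC_add_left scaleC_scaleC scaleC_complex_def)
  qed
  have \<beta>op: "\<beta> k \<in> ops UNIV UNIV" for k
    unfolding \<beta>_def using ops_add[OF ops_scale[OF coord] ops_scale[OF coord]]
    by (simp add: scaleC_complex_def)
  have \<beta>le: "cmod (\<beta> k f) \<le> ((1/4)^k + (1/2)^k) * norm f" for k f
  proof -
    have "cmod (\<beta> k f) \<le> (1/4)^k * cmod (cinner f (e (2 * k))) + (1/2)^k * cmod (cinner f (e (2 * row k + 1)))"
      unfolding \<beta>_def by (rule order_trans[OF norm_triangle_ineq]) (simp add: norm_mult norm_power norm_divide)
    also have "\<dots> \<le> (1/4)^k * norm f + (1/2)^k * norm f"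
      by (intro add_mono mult_left_mono fe) auto
    finally show ?thesis by (simp add: distrib_right)
  qed
  have "summable (\<lambda>k. (1/4::real)^k + (1/2)^k)" by (intro summable_add summable_geometric) auto
  note p_series = ops_suminf[OF mult[OF \<beta>op, of _ "e _"] _ this, unfolded norm_scaleC ne mult_1_right, OF \<beta>le]
  \<comment> \<open>The component in the span is \<open>adj X (p f)\<close>.\<close>
  define p where "p f = (\<Sum>k. \<beta> k f *\<^sub>C e k)" for f
  have pop: "p \<in> ops UNIV UNIV" unfolding p_def by (rule p_series(2))
  have py: "cinner (p f) y = (\<Sum>k. cinner (\<beta> k f *\<^sub>C e k) y)" for f y
    unfolding p_def by (rule bounded_linear.suminf[OF bounded_linear_cinner_left p_series(1)])
  have p_e: "cinner (p f) (e j) = \<beta> j f" for f j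
    unfolding py by (subst suminf_finite[of "{j}"]) (auto simp: cinner_simps e)
  have p_orth: "cinner (p f) y = 0" if "\<And>k. cinner y (e k) = 0" for f y
    unfolding py using that by (simp add: cinner_simps cinner_commute[of _ y])
  define \<gamma> where "\<gamma> k f = (1/2)^k * cinner f (e (2 * k + 1))" for k f
  have \<gamma>op: "\<gamma> k \<in> ops UNIV UNIV" for k
    unfolding \<gamma>_def using ops_scale[OF coord] by (simp add: scaleC_complex_def)
  have \<gamma>le: "norm (\<gamma> k f *\<^sub>C v k) \<le> (1/2)^k * norm f" for k f
  proof -
    have "norm (\<gamma> k f *\<^sub>C v k) \<le> cmod (\<gamma> k f) * 1"
      unfolding norm_scaleC by (intro mult_left_mono v1) simp
    also have "\<dots> \<le> (1/2)^k * norm f"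
      unfolding \<gamma>_def by (simp add: norm_mult norm_power norm_divide mult_left_mono fe)
    finally show ?thesis .
  qed
  have "summable (\<lambda>k. (1/2::real)^k)" by (intro summable_geometric) auto
  note w_series = ops_suminf[OF mult[OF \<gamma>op, of _ "v _"] \<gamma>le this]
  \<comment> \<open>The component orthogonal to the span.\<close>
  define w where "w f = (\<Sum>k. \<gamma> k f *\<^sub>C v k)" for f
  have wop: "w \<in> ops UNIV UNIV" unfolding w_def by (rule w_series(2))
  have wy: "cinner (w f) y = (\<Sum>k. cinner (\<gamma> k f *\<^sub>C v k) y)" for f y
    unfolding w_def by (rule bounded_linear.suminf[OF bounded_linear_cinner_left w_series(1)])
  have wD: "w f \<in> D" for f
    unfolding D cinner_adj[OF Xop] wy using vD by (simp add: D cinner_simps ops_scaleC[OF Xop] flip: cinner_adj[OF Xop])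
  define c where "c f = adj X (p f) + w f" for f
  have cop: "c \<in> ops UNIV UNIV"
    unfolding c_def by (intro ops_add ops_compose[OF Xa pop] wop)
  show thesis
  proof (rule that[OF cop])
    show "c (S f) = 0" for f
      by (simp add: c_def p_def w_def \<beta>_def \<gamma>_def eS scaleC_simps ops_simps[OF Xa])
  next
    fix y assume y: "\<And>f. cinner y (c f) = 0"
    have "cinner (X y) (e k) = 0" for k
    proof -
      have parity: "2 * i \<noteq> Suc (2 * j)" for i j :: nat by presburger
      have "p (e (2 * k)) = (1/4)^k *\<^sub>C e k"
        unfolding p_def by (subst suminf_finite[of "{k}"])
          (auto simp: \<beta>_def e parity scaleC_simps simp flip: scaleC_of_real)
      moreover have "w (e (2 * k)) = 0"
        by (simp add: w_def \<gamma>_def e parity scaleC_simps)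
      ultimately show ?thesis
        using y[of "e (2 * k)"] by (simp add: c_def ops_simps[OF Xa] cinner_simps cinner_adj[OF Xop])
    qed
    then have yD: "y \<in> D" and yX: "cinner (X y) (p f) = 0" for f
      using p_orth[of "X y" f] by (auto simp: D cinner_commute[of "X y"])
    have yw: "cinner y (w f) = 0" for f
      using y[of f] yX[of f] by (simp add: c_def cinner_simps flip: cinner_adj[OF Xop])
    show "y = 0"
    proof (rule v_total[rule_format, OF yD])
      fix k
      have "w (e (2 * k + 1)) = (1/2)^k *\<^sub>C v k"
        unfolding w_def by (subst suminf_finite[of "{k}"]) (auto simp: \<gamma>_def e scaleC_simps)
      then show "cinner y (v k) = 0" using yw[of "e (2 * k + 1)"] by (simp add: cinner_simps)
    qed
  next
    fix f x assume "c f = C x"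
    then have "adj X (p f) = C x - w f" by (simp add: c_def algebra_simps)
    then have "cinner (adj X (p f)) (adj X (p f)) = cinner (adj X (p f)) (C x - w f)"
      by (rule arg_cong)
    also have "\<dots> = cinner (p f) (X (C x)) - cinner (p f) (X (w f))"
      by (simp add: cinner_adj'[OF Xop] ops_simps[OF Xop] cinner_simps)
    also have "cinner (p f) (X (C x)) = 0" unfolding X by (rule p_orth) (rule eS)
    also have "cinner (p f) (X (w f)) = 0" by (rule p_orth) (use wD[of f] in \<open>simp add: D\<close>)
    finally have "adj X (p f) = 0" by (simp add: cinner_self_eq_0)
    then have "p f = 0" by (rule adj_injective[OF Xq])
    then have \<beta>0: "\<beta> k f = 0" for k using p_e[of f k] by (simp add: cinner_simps)
    have odd0: "cinner f (e (2 * i + 1)) = 0" for i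
    proof -
      have "cmod (cinner f (e (2 * i + 1))) \<le> (1/2)^m * norm f" for m
      proof -
        define k where "k = prod_encode (i, m)"
        have "row k = i" by (simp add: row_def k_def)
        then have "(1/2)^k * cinner f (e (2 * i + 1)) = - ((1/4)^k * cinner f (e (2 * k)))"
          using \<beta>0[of k] by (simp add: \<beta>_def add_eq_0_iff)
        then have "cmod ((1/2)^k * cinner f (e (2 * i + 1))) = cmod ((1/4)^k * cinner f (e (2 * k)))"
          by simp
        then have "(1/2)^k * cmod (cinner f (e (2 * i + 1))) = (1/4)^k * cmod (cinner f (e (2 * k)))"
          by (simp add: norm_mult norm_power norm_divide)
        also have "\<dots> = (1/2)^k * ((1/2)^k * cmod (cinner f (e (2 * k))))"
          by (simp flip: power_mult_distrib mult.assoc)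
        finally have "cmod (cinner f (e (2 * i + 1))) = (1/2)^k * cmod (cinner f (e (2 * k)))" by simp
        also have "\<dots> \<le> (1/2)^m * norm f"
          by (intro mult_mono power_decreasing fe) (auto simp: k_def le_prod_encode_2)
        finally show ?thesis .
      qed
      moreover have "(\<lambda>m. (1/2)^m * norm f) \<longlonglongrightarrow> 0 * norm f"
        by (intro tendsto_mult tendsto_const LIMSEQ_power_zero) simp
      ultimately have "cmod (cinner f (e (2 * i + 1))) \<le> 0 * norm f"
        by (intro LIMSEQ_le_const[where a = "cmod (cinner f (e (2 * i + 1)))"]) auto
      then show ?thesis by simp
    qed
    have even0: "cinner f (e (2 * k)) = 0" for k using \<beta>0[of k] odd0[of "row k"] by (simp add: \<beta>_def)
    show "f \<in> range S"
    proof (rule total)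
      show "cinner f (e k) = 0" for k
        using even0[of "k div 2"] odd0[of "k div 2"] by (cases "even k") (auto elim!: evenE oddE)
    qed
  qed
qed

section \<open>The shift of infinite multiplicity\<close>

lemma taylor_0: "taylor (hardy_fun 0) n = 0"
  by (metis hardy_coeffs.rep_eq hardy_coeffs_zero zero_hsum.rep_eq)

lemma mult_z_add: "mult_z (f + g) = mult_z f + mult_z g"
  and mult_z_scaleC: "mult_z (c *\<^sub>C f) = c *\<^sub>C mult_z f"
  by (transfer, simp add: fun_eq_iff algebra_simps)+

lemma taylor_mult_z_hardy:
  "taylor (hardy_fun (mult_z f)) 0 = 0" "taylor (hardy_fun (mult_z f)) (Suc n) = taylor (hardy_fun f) n"
  by (simp_all add: mult_z.rep_eq taylor_mult_z hardy_holomorphic)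

lemma hardy_of_coeffs: "\<exists>f. \<forall>n. taylor (hardy_fun f) n = hsum_nth a n"
  by (metis surj_hardy_coeffs surjD hardy_coeffs.rep_eq)

lemma mult_z_surj:
  assumes "taylor (hardy_fun f) 0 = 0" shows "\<exists>g. f = mult_z g"
proof -
  have "summable (\<lambda>n. (cmod (taylor (hardy_fun f) (Suc n)))\<^sup>2)"
    using summable_hardy[of f] by (subst summable_Suc_iff)
  then obtain g where g: "\<And>n. taylor (hardy_fun g) n = taylor (hardy_fun f) (Suc n)"
    using hardy_of_coeffs[of "Abs_hsum (\<lambda>n. taylor (hardy_fun f) (Suc n))"]
    by (auto simp: Abs_hsum_inverse)
  have "taylor (hardy_fun f) n = taylor (hardy_fun (mult_z g)) n" for n
    by (cases n) (simp_all add: assms taylor_mult_z_hardy g)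
  then show ?thesis using hardy_eqI by blast
qed

lemma isometry_S_inf: "isometry_on UNIV S_inf"
proof -
  have n: "norm (S_inf f) = norm f" for f
  proof -
    have "(norm (S_inf f))\<^sup>2 = (norm f)\<^sup>2" by (simp add: norm_hsum_sq S_inf.rep_eq norm_mult_z)
    then show ?thesis by (simp add: power2_eq_iff_nonneg)
  qed
  have "S_inf \<in> ops UNIV UNIV"
    unfolding ops_def mem_Collect_eq
    by (intro conjI ballI allI exI[of _ 1] hsum_eqI)
      (simp_all add: S_inf.rep_eq plus_hsum.rep_eq scaleC_hsum.rep_eq mult_z_add mult_z_scaleC n)
  with n show ?thesis by (simp add: isometry_on_def)
qed

lemma S_inf_pure:
  assumes "\<And>n. f \<in> range (S_inf ^^ n)" shows "f = 0"
proof -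
  have z: "taylor (hardy_fun (hsum_nth ((S_inf ^^ n) g) k)) m = 0" if "m < n" for n m g k
    using that
  proof (induction n arbitrary: m)
    case (Suc n)
    then show ?case by (cases m) (simp_all add: S_inf.rep_eq taylor_mult_z_hardy)
  qed simp
  have "taylor (hardy_fun (hsum_nth f k)) m = taylor (hardy_fun 0) m" for k m
    using assms[of "Suc m"] z[of m "Suc m"] by (auto simp: taylor_0)
  then have "hsum_nth f k = 0" for k by (rule hardy_eqI)
  then show ?thesis by (intro hsum_eqI) (simp add: zero_hsum.rep_eq)
qed

lemma S_inf_wandering_basis:
  obtains e :: "nat \<Rightarrow> hardy hsum" where
    "\<And>f k. cinner f (e k) = taylor (hardy_fun (hsum_nth f k)) 0"
    "\<And>j k. cinner (e j) (e k) = (if j = k then 1 else 0)"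
proof -
  have "summable (\<lambda>n. (cmod (if n = 0 then 1 else 0))\<^sup>2)"
    by (rule summable_finite[of "{0::nat}"]) auto
  then obtain one where one: "\<And>n. taylor (hardy_fun one) n = (if n = 0 then 1 else 0)"
    using hardy_of_coeffs[of "Abs_hsum (\<lambda>n. if n = 0 then 1 else 0)"] by (auto simp: Abs_hsum_inverse)
  have c1: "cinner f one = taylor (hardy_fun f) 0" for f
    unfolding cinner_hardy_def by (subst suminf_finite[of "{0}"]) (auto simp: one)
  define e where "e k = Abs_hsum (\<lambda>j. if j = k then one else 0)" for k :: nat
  have e: "hsum_nth (e k) j = (if j = k then one else 0)" for k j
  proof -
    have "summable (\<lambda>j. (norm (if j = k then one else 0))\<^sup>2)"
      by (rule summable_finite[of "{k}"]) auto
    then show ?thesis by (simp add: e_def Abs_hsum_inverse)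
  qed
  have ce: "cinner f (e k) = taylor (hardy_fun (hsum_nth f k)) 0" for f k
    unfolding cinner_hsum_def by (subst suminf_finite[of "{k}"]) (auto simp: e c1 cinner_simps)
  show thesis by (rule that[OF ce]) (auto simp: ce e one taylor_0)
qed

lemma range_S_inf:
  assumes "\<And>k. taylor (hardy_fun (hsum_nth f k)) 0 = 0" shows "f \<in> range S_inf"
proof -
  obtain g where g: "\<And>k. hsum_nth f k = mult_z (g k)" using mult_z_surj[OF assms] by metis
  have "summable (\<lambda>k. (norm (g k))\<^sup>2)" using summable_hsum[of f] by (simp add: g norm_mult_z)
  then have "f = S_inf (Abs_hsum g)" by (intro hsum_eqI) (simp add: S_inf.rep_eq g Abs_hsum_inverse)
  then show ?thesis by blast
qed

text \<open>The constant functions \<open>1\<close> in the coordinates of \<open>H\<^sup>2\<^sub>\<infinity>\<close> form an orthonormal basis of the wandering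
  subspace of the shift; infinitely many of them are what the construction of \<open>c\<close> requires.\<close>

lemma S_inf_quasiaffine_transform:
  fixes C :: "'a::complex_hilbert \<Rightarrow> 'a"
  assumes C: "contraction C" and X: "quasiaffinity X" "\<And>x. X (C x) = S_inf (X x)"
  shows "quasiaffine_transform S_inf C"
proof -
  obtain e :: "nat \<Rightarrow> hardy hsum" where
    e: "\<And>f k. cinner f (e k) = taylor (hardy_fun (hsum_nth f k)) 0"
    and on: "\<And>j k. cinner (e j) (e k) = (if j = k then 1 else 0)"
    by (rule S_inf_wandering_basis) blast
  have eS: "cinner (S_inf f) (e k) = 0" for f k
    by (simp add: e S_inf.rep_eq taylor_mult_z_hardy)
  have total: "f \<in> range S_inf" if "\<And>k. cinner f (e k) = 0" for f
    using that range_S_inf by (simp add: e)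
  show ?thesis
  proof (rule wandering_map_exists[of X C S_inf e])
    fix c
    assume c: "c \<in> ops UNIV UNIV" "\<And>f. c (S_inf f) = 0"
      "\<And>y. (\<And>f. cinner y (c f) = 0) \<Longrightarrow> y = 0" "\<And>f x. c f = C x \<Longrightarrow> f \<in> range S_inf"
    show ?thesis
    proof (rule quasiaffine_transform_from_wandering_map[of S_inf C X c])
      show "f = 0" if "\<And>n. f \<in> range (S_inf ^^ n)" for f using that by (rule S_inf_pure)
      show "x = 0" if "X x = 0" for x using X(1) that by (auto simp: quasiaffinity_def)
      show "X \<in> ops UNIV UNIV" using X(1) by (simp add: quasiaffinity_def)
      show "y = 0" if "\<And>f. cinner y (c f) = 0" for y using that by (rule c(3))
      show "f \<in> range S_inf" if "c f = C x" for f x using that by (rule c(4))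
    qed (fact isometry_S_inf C X(2) c(1) c(2))+
  qed (fact X on eS | erule total)+
qed


section \<open>Contractions similar to upper triangular operators\<close>

lemma ops_fst: "fst \<in> ops UNIV UNIV" and ops_snd: "snd \<in> ops UNIV UNIV"
  by (auto simp: ops_UNIV_iff bounded_linear_fst bounded_linear_snd scaleC_prod_def)

lemma ops_Pair:
  "f \<in> ops UNIV UNIV \<Longrightarrow> g \<in> ops UNIV UNIV \<Longrightarrow> (\<lambda>x. (f x, g x)) \<in> ops UNIV UNIV"
  by (auto simp: ops_UNIV_iff scaleC_prod_def intro: bounded_linear_Pair)

lemma norm_Pair_sq: "(norm (a, b))\<^sup>2 = (norm a)\<^sup>2 + (norm b)\<^sup>2"
  by (simp add: norm_Pair)

text \<open>The identity \<open>eq\<close> says that \<open>T\<close> preserves the seminorm \<open>(\<parallel>h\<parallel>\<^sup>2 + \<parallel>X0 x\<parallel>\<^sup>2)\<^sup>1\<^sup>/\<^sup>2\<close>.  Adding the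
  term \<open>L \<parallel>x\<parallel>\<^sup>2\<close>, which \<open>T\<close> does not increase, turns it into an equivalent Hilbert norm for which \<open>T\<close>
  is a contraction; \<open>renorming_operator\<close> realises this norm by a similarity.\<close>

lemma similar_to_contraction_triangular:
  fixes T :: "'a::complex_hilbert \<times> 'h::complex_hilbert \<Rightarrow> 'a \<times> 'h"
    and X0 :: "'h \<Rightarrow> 'k::complex_hilbert"
  assumes T: "T \<in> ops UNIV UNIV" and T0: "contraction T0" and snd: "\<And>p. snd (T p) = T0 (snd p)"
    and X0: "X0 \<in> ops UNIV UNIV"
    and eq: "\<And>p. (norm (fst (T p)))\<^sup>2 + (norm (X0 (T0 (snd p))))\<^sup>2 = (norm (fst p))\<^sup>2 + (norm (X0 (snd p)))\<^sup>2"
  shows "similar_to_contraction T"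
proof -
  obtain G :: "'h \<Rightarrow> 'h" and L where G: "G \<in> ops UNIV UNIV" "bij G" "inv G \<in> ops UNIV UNIV" "L \<ge> 0"
    and nG: "\<And>x. (norm (G x))\<^sup>2 = L * (norm x)\<^sup>2 + (norm (X0 x))\<^sup>2"
    using renorming_operator[OF X0] by blast
  define \<Theta> where "\<Theta> p = (fst p, G (snd p))" for p :: "'a \<times> 'h"
  define \<Xi> where "\<Xi> p = (fst p, inv G (snd p))" for p :: "'a \<times> 'h"
  have i: "\<Theta> (\<Xi> p) = p" "\<Xi> (\<Theta> p) = p" for p
    using G(2) by (simp_all add: \<Theta>_def \<Xi>_def bij_is_surj surj_f_inv_f bij_is_inj)
  have \<Theta>: "\<Theta> \<in> ops UNIV UNIV" unfolding \<Theta>_def by (intro ops_Pair ops_compose[OF G(1)] ops_fst ops_snd)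
  have \<Xi>: "\<Xi> \<in> ops UNIV UNIV" unfolding \<Xi>_def by (intro ops_Pair ops_compose[OF G(3)] ops_fst ops_snd)
  have bij: "bij \<Theta>" by (rule o_bij[of \<Xi>]) (auto simp: i)
  have inv: "inv \<Theta> = \<Xi>" by (rule inv_equality) (simp_all add: i)
  define C where "C p = \<Theta> (T (\<Xi> p))" for p
  have "C \<in> ops UNIV UNIV" unfolding C_def by (intro ops_compose[OF \<Theta>] ops_compose[OF T] \<Xi>)
  moreover have "norm (C p) \<le> norm p" for p
  proof -
    define q where "q = \<Xi> p"
    have p: "p = \<Theta> q" by (simp add: q_def i)
    have n: "(norm (\<Theta> u))\<^sup>2 = (norm (fst u))\<^sup>2 + (norm (X0 (snd u)))\<^sup>2 + L * (norm (snd u))\<^sup>2" for u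
      by (simp add: \<Theta>_def norm_Pair_sq nG)
    have "(norm (C p))\<^sup>2 = (norm (\<Theta> (T q)))\<^sup>2" by (simp add: C_def q_def)
    also have "\<dots> = (norm (fst q))\<^sup>2 + (norm (X0 (snd q)))\<^sup>2 + L * (norm (T0 (snd q)))\<^sup>2"
      unfolding n snd eq ..
    also have "\<dots> \<le> (norm p)\<^sup>2"
      unfolding p n using contraction_le[OF T0] G(4) by (intro add_left_mono mult_left_mono power_mono) auto
    finally show ?thesis by (simp add: power2_le_iff_abs_le)
  qed
  ultimately have "contraction C" by (simp add: contraction_def)
  moreover have "similar T C"
    unfolding similar_def using \<Theta> bij \<Xi> by (auto simp: inv C_def i)
  ultimately show ?thesis by (auto simp: similar_to_contraction_def)
qed

lemma quasiaffinity_compose: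
  assumes A: "quasiaffinity A" and B: "quasiaffinity B"
  shows "quasiaffinity (\<lambda>x. A (B x))"
proof -
  have Ao: "A \<in> ops UNIV UNIV" and Bo: "B \<in> ops UNIV UNIV"
    using A B by (simp_all add: quasiaffinity_def)
  have "closure (range (\<lambda>x. A (B x))) = UNIV"
  proof (rule dense_rangeI[OF ops_compose[OF Ao Bo]])
    fix y assume y: "\<And>x. cinner y (A (B x)) = 0"
    have "adj A y = 0"
    proof (rule dense_orth_zero)
      show "closure (range B) = UNIV" using B by (simp add: quasiaffinity_def)
      show "cinner (adj A y) b = 0" if "b \<in> range B" for b
        using that y by (auto simp: cinner_adj'[OF Ao])
    qed
    then show "y = 0" by (rule adj_injective[OF A])
  qed
  moreover have "x = 0" if "A (B x) = 0" for x
    using that A B unfolding quasiaffinity_def by blast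
  ultimately show ?thesis
    using ops_compose[OF Ao Bo] by (auto simp: quasiaffinity_def ops_simps[OF Ao] ops_simps[OF Bo])
qed

lemma quasiaffinity_bij:
  assumes "A \<in> ops UNIV UNIV" "bij A" shows "quasiaffinity A"
proof -
  have "x = 0" if "A x = 0" for x
    using that injD[OF bij_is_inj[OF assms(2)], of x 0] by (simp add: ops_simps[OF assms(1)])
  then show ?thesis
    using assms by (auto simp: quasiaffinity_def bij_is_surj ops_simps[OF assms(1)])
qed

lemma quasisimilar_S_inf:
  fixes T :: "'a::complex_hilbert \<Rightarrow> 'a"
  assumes T: "similar_to_contraction T" and Q: "quasiaffinity Q" "\<And>x. Q (T x) = S_inf (Q x)"
  shows "quasisimilar T S_inf"
proof -
  obtain C :: "'a \<Rightarrow> 'a" and \<Theta> where C: "contraction C" and \<Theta>: "\<Theta> \<in> ops UNIV UNIV" "bij \<Theta>"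
    and i: "inv \<Theta> \<in> ops UNIV UNIV" and \<Theta>T: "\<And>x. \<Theta> (T x) = C (\<Theta> x)"
    using T by (auto simp: similar_to_contraction_def similar_def)
  have ii: "\<Theta> (inv \<Theta> x) = x" "inv \<Theta> (\<Theta> x) = x" for x
    using \<Theta>(2) by (simp_all add: bij_is_surj surj_f_inv_f bij_is_inj)
  have iq: "quasiaffinity (inv \<Theta>)" using i bij_imp_bij_inv[OF \<Theta>(2)] by (rule quasiaffinity_bij)
  have iT: "inv \<Theta> (C x) = T (inv \<Theta> x)" for x using \<Theta>T[of "inv \<Theta> x"] by (metis ii)
  have "quasiaffine_transform S_inf C"
    by (rule S_inf_quasiaffine_transform[OF C quasiaffinity_compose[OF Q(1) iq]]) (simp add: iT Q(2))
  then obtain Z where Z: "quasiaffinity Z" "\<And>x. Z (S_inf x) = C (Z x)"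
    by (auto simp: quasiaffine_transform_def)
  have "quasiaffine_transform S_inf T"
    unfolding quasiaffine_transform_def
    using quasiaffinity_compose[OF iq Z(1)] by (intro exI[of _ "\<lambda>x. inv \<Theta> (Z x)"]) (auto simp: Z(2) iT)
  moreover have "quasiaffine_transform T S_inf"
    using Q by (auto simp: quasiaffine_transform_def)
  ultimately show ?thesis by (simp add: quasisimilar_def)
qed

section \<open>Unitary summands of isometric asymptotes\<close>

lemma csubspaces_INT: "(\<And>i. A i \<in> csubspaces) \<Longrightarrow> (\<Inter>i. A i) \<in> csubspaces"
  by (auto simp: csubspaces_def)

text \<open>A linear isometry has complete, hence closed, range.\<close>

lemma isometry_range_csubspaces:
  assumes V: "V \<in> ops UNIV UNIV" and n: "\<And>x. norm (V x) = norm x"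
  shows "range V \<in> csubspaces"
proof -
  have "closed (range V)"
  proof (rule complete_imp_closed, rule complete_isometric_image[of 1])
    show "bounded_linear V" by (rule ops_linear[OF V])
  qed (simp_all add: n complete_UNIV)
  then show ?thesis
    unfolding csubspaces_def mem_Collect_eq
    using rangeI[of V "0::'a"] rangeI[of V "_ + _"] rangeI[of V "_ *\<^sub>C _"]
    by (auto simp: ops_simps[OF V])
qed

text \<open>By Wold's decomposition the intersection of the ranges of the powers reduces an isometry to
  a unitary operator.\<close>

lemma has_unitary_summandI:
  assumes V: "isometry_on UNIV V" and v: "v \<noteq> 0" "\<And>n. v \<in> range (V ^^ n)"
  shows "has_unitary_summand V"
proof -
  note Vop = isometry_ops[OF V]
  define L where "L = (\<Inter>n. range (V ^^ n))"
  have pow: "norm ((V ^^ n) x) = norm x" for n x by (induction n) (simp_all add: isometry_norm[OF V])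
  have L: "L \<in> csubspaces"
    unfolding L_def by (intro csubspaces_INT isometry_range_csubspaces ops_funpow[OF Vop] pow)
  have VL: "V ` L = L"
  proof
    show "V ` L \<subseteq> L"
    proof (clarsimp simp: L_def)
      fix x n assume "\<forall>n. x \<in> range (V ^^ n)"
      then obtain y where "x = (V ^^ n) y" by blast
      then have "V x = (V ^^ n) (V y)" by (simp add: funpow_swap1)
      then show "V x \<in> range (V ^^ n)" by blast
    qed
    show "L \<subseteq> V ` L"
    proof
      fix x assume x: "x \<in> L"
      then have "x \<in> range (V ^^ 1)" unfolding L_def by blast
      then obtain y where y: "x = V y" by auto
      have "y \<in> range (V ^^ n)" for n
      proof -
        have "x \<in> range (V ^^ Suc n)" using x unfolding L_def by blast
        then obtain z where "V y = V ((V ^^ n) z)" using y by auto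
        then show ?thesis using isometry_inj[OF V] by (auto dest: injD)
      qed
      then show "x \<in> V ` L" using y by (auto simp: L_def)
    qed
  qed
  have restr: "V \<in> ops A A" if "V ` A \<subseteq> A" for A
    using that Vop unfolding ops_def by auto
  have "V z \<in> orth L" if z: "z \<in> orth L" for z
  proof -
    have "cinner (V z) l = 0" if "l \<in> L" for l
    proof -
      obtain l' where "l' \<in> L" "l = V l'" using VL \<open>l \<in> L\<close> by blast
      then show ?thesis using orthD[OF z] by (simp add: isometry_on_cinner[OF V])
    qed
    then show ?thesis by (simp add: orth_def)
  qed
  then have "isometry_on (orth L) V"
    using restr[of "orth L"] by (auto simp: isometry_on_def isometry_norm[OF V])
  moreover have "unitary_on L V"
    using restr[of L] VL by (auto simp: unitary_on_def isometry_on_def isometry_norm[OF V])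
  moreover have "L \<noteq> {0}" using v by (auto simp: L_def)
  ultimately show ?thesis unfolding has_unitary_summand_def using L by blast
qed

text \<open>Here \<open>C\<^bsub>\<cdot>0\<^esub>\<close> excludes nonzero vectors along whose orbit the adjoint is isometric.\<close>

lemma defect_orbit_total:
  assumes R: "contraction R" and C0: "class_C0_dot (adj R)"
    and u: "\<And>n x. cinner u ((R ^^ n) (defect R x)) = 0"
  shows "u = 0"
proof -
  note Rop = contraction_ops[OF R]
  have "defect R ((adj R ^^ n) u) = 0" for n
  proof -
    have "cinner (defect R ((adj R ^^ n) u)) x = 0" for x
      using u[of n x] by (simp add: cinner_funpow_adj[OF Rop] defect_selfadjoint[OF Rop])
    then show ?thesis using cinner_self_eq_0 by blast
  qed
  then have "(R ^^ n) ((adj R ^^ n) u) = u" for n by (rule defect_vanishes_on_adjoint_orbit)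
  then have "norm u \<le> norm ((adj R ^^ n) u)" for n
    using contraction_funpow_le[OF R] by metis
  moreover have "(\<lambda>n. norm ((adj R ^^ n) u)) \<longlonglongrightarrow> 0" using C0 by (simp add: class_C0_dot_def)
  ultimately have "norm u \<le> 0" by (intro LIMSEQ_le_const) auto
  then show ?thesis by simp
qed

context
  fixes R :: "'k::complex_hilbert \<Rightarrow> 'k" and U :: "'g::complex_hilbert \<Rightarrow> 'g" and Y
  assumes R: "contraction R" and Y: "Y \<in> ops UNIV UNIV" and YR: "\<And>y. Y (R y) = U (Y y)"
begin

lemma intertwiner_funpow: "Y ((R ^^ n) y) = (U ^^ n) (Y y)"
  by (induction n) (simp_all add: YR)

text \<open>The Bessel vectors that are available: an intertwining operator maps the orbits of the values of
  the defect operator to Bessel orbits.\<close>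

lemma bessel_defect: "\<exists>B. bessel U (Y (defect R x)) B"
proof -
  obtain b where b: "b > 0" "\<And>y. norm (Y y) \<le> b * norm y" using ops_bound[OF Y] by blast
  note q = defect_ops[OF contraction_ops[OF R]] and Rn = ops_funpow[OF contraction_ops[OF R]]
  have "(norm (\<Sum>n<N. a n *\<^sub>C (U ^^ n) (Y (defect R x))))\<^sup>2 \<le> (b\<^sup>2 * (norm x)\<^sup>2) * (\<Sum>n<N. (cmod (a n))\<^sup>2)" for a N
  proof -
    have "(\<Sum>n<N. a n *\<^sub>C (U ^^ n) (Y (defect R x))) = Y (\<Sum>n<N. (R ^^ n) (defect R (a n *\<^sub>C x)))"
      by (simp add: ops_simps(6,7)[OF Y] ops_scaleC[OF q] ops_scaleC[OF Rn] intertwiner_funpow)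
    then have "(norm (\<Sum>n<N. a n *\<^sub>C (U ^^ n) (Y (defect R x))))\<^sup>2
        \<le> (b * norm (\<Sum>n<N. (R ^^ n) (defect R (a n *\<^sub>C x))))\<^sup>2"
      using b(2) by (simp add: power_mono)
    also have "\<dots> \<le> b\<^sup>2 * (\<Sum>n<N. (norm (a n *\<^sub>C x))\<^sup>2)"
      unfolding power_mult_distrib by (intro mult_left_mono defect_sum_bound[OF R]) simp
    also have "\<dots> = (b\<^sup>2 * (norm x)\<^sup>2) * (\<Sum>n<N. (cmod (a n))\<^sup>2)"
      by (simp add: norm_scaleC power_mult_distrib sum_distrib_left mult_ac)
    finally show ?thesis .
  qed
  from bessel_dual[OF _ this]
  have "bessel U (Y (defect R x)) (b\<^sup>2 * (norm x)\<^sup>2)" unfolding bessel_def by simp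
  then show ?thesis ..
qed

text \<open>Otherwise \<open>N\<close>, and so \<open>E\<close>, contains a wandering vector.  Then \<open>E\<close> contains all Bessel
  vectors, in particular all \<open>Y (defect R x)\<close>; as the orbits of these are total in the range of \<open>Y\<close>,
  the preimage of \<open>E\<close> under \<open>Y\<close> would be everything.\<close>

lemma invariant_subspace_reducing:
  assumes C0: "class_C0_dot (adj R)" and U: "unitary_on UNIV U" and E: "E \<in> Hlat U"
    and proper: "{y. Y y \<in> E} \<noteq> UNIV"
    and N: "N \<in> csubspaces" "N \<subseteq> E" "U ` N \<subseteq> N"
  shows "U ` N = N"
proof (rule ccontr)
  assume "U ` N \<noteq> N"
  from wandering_vector_exists[OF U N(1,3) this] obtain w
    where w: "w \<in> N" "w \<noteq> 0" "\<forall>n\<ge>1. cinner ((U ^^ n) w) w = 0" by blast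
  have Esub: "E \<in> csubspaces" using E by (simp add: Hlat_def)
  have "U ` E \<subseteq> E" using E isometry_ops[OF unitary_onD(1)[OF U]] by (auto simp: Hlat_def)
  then have Un: "(U ^^ n) g \<in> E" if "g \<in> E" for n g
    using that by (induction n) auto
  have "Y (defect R x) \<in> E" for x
  proof -
    obtain B where B: "bessel U (Y (defect R x)) B" using bessel_defect by blast
    show ?thesis
      by (rule hyperinvariant_wandering[OF U E _ w(2) _ B]) (use w N(2) in auto)
  qed
  then have *: "(R ^^ n) (defect R x) \<in> {y. Y y \<in> E}" for n x by (simp add: intertwiner_funpow Un)
  have M: "{y. Y y \<in> E} \<in> csubspaces" by (rule csubspaces_kernel[OF Y Esub])
  have "u = 0" if "u \<in> orth {y. Y y \<in> E}" for u
    by (rule defect_orbit_total[OF R C0]) (rule orthD[OF that *])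
  then have "orth {y. Y y \<in> E} \<subseteq> {0}" by blast
  then have "orth (orth {y. Y y \<in> E}) = UNIV" unfolding orth_def[of "orth _"] by (auto simp: cinner_simps)
  then show False using orth_orth[OF M] proper by simp
qed

text \<open>Every nonzero vector in the range of \<open>Y\<close> is detected by the Fourier coefficients with respect
  to some Bessel vector, again because defect vectors have total orbits.\<close>

lemma bilateral_coeffs_separate:
  assumes C0: "class_C0_dot (adj R)" and U: "unitary_on UNIV U" and y: "Y y \<noteq> 0"
  obtains r B where "bessel U r B" "bilateral_coeffs U r (Y y) \<noteq> 0"
proof (rule ccontr)
  assume "\<not> thesis"
  with that have z: "bilateral_coeffs U r (Y y) = 0" if "bessel U r B" for r B using that by blast
  have "adj Y (Y y) = 0"
  proof (rule defect_orbit_total[OF R C0])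
    fix n x
    obtain B where B: "bessel U (Y (defect R x)) B" using bessel_defect by blast
    have "cinner (Y y) (upow U (int n) (Y (defect R x))) = 0"
      using hsum_nth_bilateral_coeffs[OF U B, of "Y y" "int_encode (int n)"] z[OF B]
      by (simp add: zero_hsum.rep_eq)
    then show "cinner (adj Y (Y y)) ((R ^^ n) (defect R x)) = 0"
      by (simp add: cinner_adj'[OF Y] intertwiner_funpow)
  qed
  then have "cinner (Y y) (Y y) = 0" by (simp add: cinner_adj[OF Y] cinner_simps)
  with y show False by (simp add: cinner_self_eq_0)
qed

end

text \<open>By \<open>eq\<close> and \<open>lim\<close> the upper limit of \<open>\<parallel>T\<^sup>n (h, x)\<parallel>\<^sup>2\<close> is at most
  \<open>\<parallel>h\<parallel>\<^sup>2 + \<parallel>X0 x\<parallel>\<^sup>2 + \<parallel>P x\<parallel>\<^sup>2\<close>.  Since \<open>\<parallel>X p\<parallel> = \<parallel>X (T\<^sup>n p)\<parallel>\<close>, the operator \<open>X\<close> is bounded with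
  respect to the seminorm given by this expression and extends to the completion.  By the hypothesis \<open>approx\<close> the completion contains a copy
  \<open>{(0, 0, g) | g \<in> N}\<close> of \<open>N\<close>, on which the extension intertwines \<open>U\<close> with \<open>V\<close>.  As \<open>U\<close> maps \<open>N\<close>
  onto itself, the image of \<open>N\<close> lies in the range of every power of \<open>V\<close>.  It is nonzero: the universal
  property of the asymptote lets \<open>\<Phi> P\<close> factor through \<open>X\<close>, and \<open>\<Phi>\<close> does not vanish on \<open>N\<close>.\<close>

lemma unitary_summand_of_asymptote:
  fixes T :: "'a::complex_hilbert \<times> 'h::complex_hilbert \<Rightarrow> 'a \<times> 'h"
    and X0 :: "'h \<Rightarrow> 'k::complex_hilbert" and P :: "'h \<Rightarrow> 'g::complex_hilbert"
    and X :: "'a \<times> 'h \<Rightarrow> 'v::complex_hilbert"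
  assumes snd: "\<And>p. snd (T p) = T0 (snd p)"
    and X0: "X0 \<in> ops UNIV UNIV"
    and eq: "\<And>p. (norm (fst (T p)))\<^sup>2 + (norm (X0 (T0 (snd p))))\<^sup>2 = (norm (fst p))\<^sup>2 + (norm (X0 (snd p)))\<^sup>2"
    and P: "P \<in> ops UNIV UNIV" and PT: "\<And>x. P (T0 x) = U (P x)"
    and lim: "\<And>x. (\<lambda>n. (norm ((T0 ^^ n) x))\<^sup>2) \<longlonglongrightarrow> (norm (P x))\<^sup>2"
    and U: "U \<in> ops UNIV UNIV" and UN: "U ` N = N"
    and approx: "\<And>g. g \<in> N \<Longrightarrow> \<exists>x. (\<lambda>k. X0 (x k)) \<longlonglongrightarrow> 0 \<and> (\<lambda>k. P (x k)) \<longlonglongrightarrow> g"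
    and \<Phi>: "\<Phi> \<in> ops UNIV UNIV" "\<And>g. \<Phi> (U g) = B (\<Phi> g)" and B: "isometry_on UNIV B"
    and g0: "g0 \<in> N" "\<Phi> g0 \<noteq> (0::ell2)"
    and asy: "isometric_asymptote T X V"
  shows "has_unitary_summand V"
proof -
  have V: "isometry_on UNIV V" and X: "X \<in> ops UNIV UNIV" and XT: "X (T p) = V (X p)" for p
    using asy unfolding isometric_asymptote_def by blast+
  obtain b where b: "b > 0" "\<And>p. norm (X p) \<le> b * norm p" using ops_bound[OF X] by blast
  have sndn: "snd ((T ^^ n) p) = (T0 ^^ n) (snd p)" for n p by (induction n) (simp_all add: snd)
  have inv: "(norm (fst ((T ^^ n) p)))\<^sup>2 + (norm (X0 (snd ((T ^^ n) p))))\<^sup>2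
      = (norm (fst p))\<^sup>2 + (norm (X0 (snd p)))\<^sup>2" for n p
    by (induction n) (simp_all add: snd eq)
  have XTn: "X ((T ^^ n) p) = (V ^^ n) (X p)" for n p by (induction n) (simp_all add: XT)
  have Vn: "norm ((V ^^ n) v) = norm v" for n v by (induction n) (simp_all add: isometry_norm[OF V])
  have bound: "norm (X p) \<le> b * (norm (fst p) + norm (X0 (snd p)) + norm (P (snd p)))" for p
  proof -
    have "(norm (X p))\<^sup>2 \<le> b\<^sup>2 * ((norm (fst p))\<^sup>2 + (norm (X0 (snd p)))\<^sup>2 + (norm ((T0 ^^ n) (snd p)))\<^sup>2)" for n
    proof -
      have "norm (X p) \<le> b * norm ((T ^^ n) p)" using b(2)[of "(T ^^ n) p"] by (simp add: XTn Vn)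
      then have "(norm (X p))\<^sup>2 \<le> (b * norm ((T ^^ n) p))\<^sup>2" by (rule power_mono) simp
      then have "(norm (X p))\<^sup>2 \<le> b\<^sup>2 * (norm ((T ^^ n) p))\<^sup>2" by (simp only: power_mult_distrib)
      also have "(norm ((T ^^ n) p))\<^sup>2 = (norm (fst ((T ^^ n) p)))\<^sup>2 + (norm ((T0 ^^ n) (snd p)))\<^sup>2"
        using norm_Pair_sq[of "fst ((T ^^ n) p)" "snd ((T ^^ n) p)"]
        by (simp only: prod.collapse) (simp only: sndn)
      also have "(norm (fst ((T ^^ n) p)))\<^sup>2 \<le> (norm (fst p))\<^sup>2 + (norm (X0 (snd p)))\<^sup>2"
        unfolding inv[of n p, symmetric] by simp
      finally show ?thesis by (simp add: mult_left_mono)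
    qed
    then have "(norm (X p))\<^sup>2 \<le> b\<^sup>2 * ((norm (fst p))\<^sup>2 + (norm (X0 (snd p)))\<^sup>2 + (norm (P (snd p)))\<^sup>2)"
      by (intro LIMSEQ_le_const[OF tendsto_mult[OF tendsto_const tendsto_add[OF tendsto_const lim]]]) auto
    also have "\<dots> \<le> b\<^sup>2 * (norm (fst p) + norm (X0 (snd p)) + norm (P (snd p)))\<^sup>2"
      by (intro mult_left_mono) (simp_all add: power2_sum)
    also have "\<dots> = (b * (norm (fst p) + norm (X0 (snd p)) + norm (P (snd p))))\<^sup>2"
      by (simp add: power_mult_distrib)
    finally show ?thesis by (rule power2_le_imp_le) (use b(1) in simp)
  qed
  have X_null: "(\<lambda>k. X (p k)) \<longlonglongrightarrow> 0"
    if "(\<lambda>k. fst (p k)) \<longlonglongrightarrow> 0" "(\<lambda>k. X0 (snd (p k))) \<longlonglongrightarrow> 0" "(\<lambda>k. P (snd (p k))) \<longlonglongrightarrow> 0" for p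
  proof (rule Lim_null_comparison)
    have "(\<lambda>k. b * (norm (fst (p k)) + norm (X0 (snd (p k))) + norm (P (snd (p k)))))
        \<longlonglongrightarrow> b * (norm (0::'a) + norm (0::'k) + norm (0::'g))"
      by (intro tendsto_intros that)
    then show "(\<lambda>k. b * (norm (fst (p k)) + norm (X0 (snd (p k))) + norm (P (snd (p k))))) \<longlonglongrightarrow> 0"
      by simp
  qed (use bound in auto)
  \<comment> \<open>The graph of the extension of \<open>X\<close> to the copy of \<open>N\<close> in the completion.\<close>
  define rel where "rel g v \<longleftrightarrow> (\<exists>x. (\<lambda>k. X0 (x k)) \<longlonglongrightarrow> 0 \<and> (\<lambda>k. P (x k)) \<longlonglongrightarrow> g
      \<and> (\<lambda>k. X (0, x k)) \<longlonglongrightarrow> v)" for g v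
  have sub: "X (0, x) - X (0, y) = X (0, x - y)" for x y
    by (simp flip: ops_simps(2)[OF X])
  have rel_ex: "\<exists>v. rel g v" if "g \<in> N" for g
  proof -
    obtain x where x: "(\<lambda>k. X0 (x k)) \<longlonglongrightarrow> 0" "(\<lambda>k. P (x k)) \<longlonglongrightarrow> g"
      using approx[OF \<open>g \<in> N\<close>] by blast
    have "Cauchy (\<lambda>k. X (0, x k))"
    proof (rule metric_CauchyI)
      fix e :: real assume e: "e > 0"
      then have e2: "e / (2 * b) > 0" using b(1) by simp
      obtain n1 where n1: "\<And>j k. j \<ge> n1 \<Longrightarrow> k \<ge> n1 \<Longrightarrow> dist (X0 (x j)) (X0 (x k)) < e / (2 * b)"
        using metric_CauchyD[OF LIMSEQ_imp_Cauchy[OF x(1)] e2] by blast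
      obtain n2 where n2: "\<And>j k. j \<ge> n2 \<Longrightarrow> k \<ge> n2 \<Longrightarrow> dist (P (x j)) (P (x k)) < e / (2 * b)"
        using metric_CauchyD[OF LIMSEQ_imp_Cauchy[OF x(2)] e2] by blast
      have "dist (X (0, x j)) (X (0, x k)) < e" if "j \<ge> max n1 n2" "k \<ge> max n1 n2" for j k
      proof -
        have "dist (X (0, x j)) (X (0, x k)) \<le> b * (dist (X0 (x j)) (X0 (x k)) + dist (P (x j)) (P (x k)))"
          using bound[of "(0, x j - x k)"] by (simp add: dist_norm sub ops_simps[OF X0] ops_simps[OF P])
        also have "\<dots> < b * (e / (2 * b) + e / (2 * b))"
          using b(1) n1[of j k] n2[of j k] that by (intro mult_strict_left_mono add_strict_mono) auto
        also have "\<dots> = e" using b(1) by (simp add: field_simps)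
        finally show ?thesis .
      qed
      then show "\<exists>M. \<forall>m\<ge>M. \<forall>n\<ge>M. dist (X (0, x m)) (X (0, x n)) < e" by blast
    qed
    then show ?thesis using x unfolding rel_def Cauchy_convergent_iff convergent_def by blast
  qed
  have rel_unique: "v = v'" if vv: "rel g v" "rel g v'" for g v v'
  proof -
    obtain x where x: "(\<lambda>k. X0 (x k)) \<longlonglongrightarrow> 0" "(\<lambda>k. P (x k)) \<longlonglongrightarrow> g" "(\<lambda>k. X (0, x k)) \<longlonglongrightarrow> v"
      using vv(1) by (auto simp: rel_def)
    obtain y where y: "(\<lambda>k. X0 (y k)) \<longlonglongrightarrow> 0" "(\<lambda>k. P (y k)) \<longlonglongrightarrow> g" "(\<lambda>k. X (0, y k)) \<longlonglongrightarrow> v'"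
      using vv(2) by (auto simp: rel_def)
    have "(\<lambda>k. X (0, x k - y k)) \<longlonglongrightarrow> 0"
      using tendsto_diff[OF x(1) y(1)] tendsto_diff[OF x(2) y(2)]
      by (intro X_null) (simp_all add: ops_simps[OF X0] ops_simps[OF P])
    moreover have "(\<lambda>k. X (0, x k - y k)) \<longlonglongrightarrow> v - v'"
      using tendsto_diff[OF x(3) y(3)] by (simp add: sub)
    ultimately have "0 = v - v'" by (rule LIMSEQ_unique)
    then show ?thesis by simp
  qed
  have rel_step: "rel (U g) (V v)" if gv: "rel g v" for g v
  proof -
    obtain x where x: "(\<lambda>k. X0 (x k)) \<longlonglongrightarrow> 0" "(\<lambda>k. P (x k)) \<longlonglongrightarrow> g" "(\<lambda>k. X (0, x k)) \<longlonglongrightarrow> v"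
      using gv by (auto simp: rel_def)
    have sq: "(norm (fst (T (0, x k))))\<^sup>2 + (norm (X0 (T0 (x k))))\<^sup>2 = (norm (X0 (x k)))\<^sup>2" for k
      using eq[of "(0, x k)"] by simp
    have le: "norm (X0 (T0 (x k))) \<le> norm (X0 (x k))" "norm (fst (T (0, x k))) \<le> norm (X0 (x k))" for k
      by (rule power2_le_imp_le[OF _ norm_ge_zero], unfold sq[symmetric], simp)+
    have n0: "(\<lambda>k. norm (X0 (x k))) \<longlonglongrightarrow> 0" using tendsto_norm[OF x(1)] by simp
    have a: "(\<lambda>k. X0 (T0 (x k))) \<longlonglongrightarrow> 0" "(\<lambda>k. fst (T (0, x k))) \<longlonglongrightarrow> 0"
      by (rule Lim_null_comparison[OF _ n0], use le in simp)+
    \<comment> \<open>\<open>T\<close> maps \<open>(0, x)\<close> to \<open>(0, T0 x)\<close> up to a first component that is controlled by \<open>X0 x\<close>.\<close>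
    have "(\<lambda>k. X (fst (T (0, x k)), 0)) \<longlonglongrightarrow> 0"
      by (rule X_null) (simp_all add: a ops_simps[OF X0] ops_simps[OF P])
    moreover have "(\<lambda>k. X (T (0, x k))) \<longlonglongrightarrow> V v"
      unfolding XT by (rule ops_tendsto[OF isometry_ops[OF V] x(3)])
    ultimately have "(\<lambda>k. X (T (0, x k)) - X (fst (T (0, x k)), 0)) \<longlonglongrightarrow> V v - 0" by (intro tendsto_diff)
    moreover have "X (T (0, x k)) - X (fst (T (0, x k)), 0) = X (0, T0 (x k))" for k
    proof -
      have "T (0, x k) - (fst (T (0, x k)), 0) = (0, T0 (x k))"
        using snd[of "(0, x k)"] by (simp add: prod_eq_iff)
      then show ?thesis by (metis ops_simps(2)[OF X])
    qed
    ultimately have "(\<lambda>k. X (0, T0 (x k))) \<longlonglongrightarrow> V v" by simp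
    moreover have "(\<lambda>k. P (T0 (x k))) \<longlonglongrightarrow> U g" unfolding PT by (rule ops_tendsto[OF U x(2)])
    ultimately show ?thesis using a(1) by (auto simp: rel_def)
  qed
  have range: "v \<in> range (V ^^ n)" if "g \<in> N" "rel g v" for g v n
    using that
  proof (induction n arbitrary: g v)
    case (Suc n)
    obtain g' where g': "g' \<in> N" "g = U g'" using UN Suc.prems(1) by blast
    obtain v' where v': "rel g' v'" using rel_ex[OF g'(1)] by blast
    have "v = V v'" using rel_unique[OF Suc.prems(2)] rel_step[OF v'] g'(2) by simp
    moreover have "v' \<in> range (V ^^ n)" by (rule Suc.IH[OF g'(1) v'])
    ultimately show ?case by auto
  qed simp
  have "\<exists>!Z. Z \<in> ops UNIV UNIV \<and> (\<forall>u. Z (V u) = B (Z u)) \<and> (\<forall>p. \<Phi> (P (snd p)) = Z (X p))"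
  proof -
    have "(UNIV :: ell2 set) \<in> csubspaces" by (simp add: csubspaces_def)
    moreover have "(\<lambda>p. \<Phi> (P (snd p))) \<in> ops UNIV UNIV"
      by (intro ops_compose[OF \<Phi>(1)] ops_compose[OF P] ops_snd)
    moreover have "\<forall>p. \<Phi> (P (snd (T p))) = B (\<Phi> (P (snd p)))" by (simp add: snd PT \<Phi>(2))
    ultimately show ?thesis using asy B unfolding isometric_asymptote_def by blast
  qed
  then obtain Z where Z: "Z \<in> ops UNIV UNIV" "\<And>p. \<Phi> (P (snd p)) = Z (X p)" by blast
  obtain v0 where v0: "rel g0 v0" using rel_ex[OF g0(1)] by blast
  then obtain x where x: "(\<lambda>k. P (x k)) \<longlonglongrightarrow> g0" "(\<lambda>k. X (0, x k)) \<longlonglongrightarrow> v0" by (auto simp: rel_def)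
  have "(\<lambda>k. \<Phi> (P (x k))) \<longlonglongrightarrow> \<Phi> g0" by (rule ops_tendsto[OF \<Phi>(1) x(1)])
  moreover have "(\<lambda>k. \<Phi> (P (x k))) \<longlonglongrightarrow> Z v0"
    using ops_tendsto[OF Z(1) x(2)] by (simp flip: Z(2))
  ultimately have "\<Phi> g0 = Z v0" by (rule LIMSEQ_unique)
  then have "v0 \<noteq> 0" using g0(2) by (auto simp: ops_simps[OF Z(1)])
  then show ?thesis by (rule has_unitary_summandI[OF V]) (rule range[OF g0(1) v0])
qed


theorem theorem5p3:
  fixes R :: "'k::complex_hilbert \<Rightarrow> 'k"
    and T0 :: "'h::complex_hilbert \<Rightarrow> 'h"
    and U :: "'g::complex_hilbert \<Rightarrow> 'g"
    and Y :: "'k \<Rightarrow> 'g"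
    and E :: "'g set"
    and M K0 :: "'k set"
    and R0 :: "'k \<Rightarrow> 'k"
    and J :: "'h \<Rightarrow> 'k"
    and c :: real
    and X0 :: "'h \<Rightarrow> 'k"
    and K :: "'k \<Rightarrow> hardy hsum"
    and T :: "hardy hsum \<times> 'h \<Rightarrow> hardy hsum \<times> 'h"
  assumes "contraction R" and "class_C10 R"
    and "contraction T0" and "class_C10 T0"
    and "unitary_on UNIV U"
    and "unitary_asymptote R Y U"
    and "E \<in> Hlat U"
    and M: "M = {y. Y y \<in> E}" and "M \<noteq> {0}" and "M \<noteq> UNIV"
    and K0: "K0 = orth M"
    and R0: "R0 = (\<lambda>y. proj K0 (R y))"
    and "quasiaffinity J" and "\<And>x. J (T0 x) = R (J x)"
    and "unitary_asymptote T0 (Y \<circ> J) U"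
    and "quasianalytic T0 (Y \<circ> J) U"
    and "\<And>y1 y2. (\<lambda>n. cinner ((R ^^ n) y1) ((R ^^ n) y2)) \<longlonglongrightarrow> cinner (Y y1) (Y y2)"
    and "\<And>x1 x2. (\<lambda>n. cinner ((T0 ^^ n) x1) ((T0 ^^ n) x2)) \<longlonglongrightarrow> cinner (Y (J x1)) (Y (J x2))"
    and "0 < c" and "c < 1"
    and X0: "X0 = (\<lambda>x. c *\<^sub>R proj K0 (J x))"
    and "K \<in> ops K0 UNIV"
    and "unitarily_equiv (UNIV \<times> K0) (\<lambda>(h, y). (S_inf h + K y, R0 y)) UNIV S_inf"
    and T: "T = (\<lambda>(h, x). (S_inf h + K (X0 x), T0 x))"
  shows "similar_to_contraction T \<and> quasisimilar T S_inf \<and>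
    (\<forall>(X :: hardy hsum \<times> 'h \<Rightarrow> 'v::complex_hilbert) V.
       isometric_asymptote T X V \<longrightarrow> has_unitary_summand V)"
proof -
  note R = \<open>contraction R\<close> and T0 = \<open>contraction T0\<close> and U = \<open>unitary_on UNIV U\<close> and E = \<open>E \<in> Hlat U\<close>
    and JT = \<open>\<And>x. J (T0 x) = R (J x)\<close>
  note Rop = contraction_ops[OF R] and T0op = contraction_ops[OF T0]
    and Uop = isometry_ops[OF unitary_onD(1)[OF U]]
  have Y: "Y \<in> ops UNIV UNIV" and YR: "Y (R y) = U (Y y)" for y
    using \<open>unitary_asymptote R Y U\<close> unfolding unitary_asymptote_def by blast+
  have C1: "class_C1_dot R" and C0: "class_C0_dot (adj R)"
    using \<open>class_C10 R\<close> by (simp_all add: class_C10_def)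
  have J: "J \<in> ops UNIV UNIV" and Jdense: "closure (range J) = UNIV"
    using \<open>quasiaffinity J\<close> by (simp_all add: quasiaffinity_def)
  have Esub: "E \<in> csubspaces" using E by (simp add: Hlat_def)
  have UE: "U g \<in> E" if "g \<in> E" for g using E Uop that by (auto simp: Hlat_def)
  have Msub: "M \<in> csubspaces" unfolding M by (rule csubspaces_kernel[OF Y Esub])
  have RM: "R y \<in> M" if "y \<in> M" for y using that by (simp add: M YR UE)
  have K0sub: "K0 \<in> csubspaces" unfolding K0 by (rule orth_csubspaces)
  have oK0: "orth K0 = M" unfolding K0 by (rule orth_orth[OF Msub])
  note pop = proj_ops[OF K0sub]
  have pM: "proj K0 m = 0" if "m \<in> M" for m
    by (rule proj_eqI[OF K0sub]) (use K0sub that in \<open>auto simp: oK0 csubspaces_def\<close>)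
  have pid: "proj K0 y = y" if "y \<in> K0" for y
    by (rule proj_eqI[OF K0sub that]) (use Msub in \<open>auto simp: oK0 csubspaces_def\<close>)
  have pmM: "y - proj K0 y \<in> M" for y using proj_orth[OF K0sub, of y] by (simp add: oK0)

  \<comment> \<open>The vector \<open>y - proj K0 y\<close> is in \<open>M\<close>, which \<open>R\<close> leaves invariant; hence the projection
    onto the orthogonal complement of \<open>M\<close> annihilates its image.\<close>
  have pR: "proj K0 (R (proj K0 y)) = proj K0 (R y)" for y
    using pM[OF RM[OF pmM[of y]]] by (simp add: ops_simps[OF Rop] ops_simps[OF pop])
  have X0C: "X0 = (\<lambda>x. complex_of_real c *\<^sub>C proj K0 (J x))" by (simp add: X0 scaleC_of_real)
  have X0op: "X0 \<in> ops UNIV UNIV" unfolding X0C by (intro ops_scale ops_compose[OF pop] J)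
  have X0K: "X0 x \<in> K0" for x using K0sub proj_in[OF K0sub] by (simp add: X0C csubspaces_def)
  have X0T: "X0 (T0 x) = R0 (X0 x)" for x
    by (simp add: X0C R0 JT pR ops_simps[OF Rop] ops_simps[OF pop])
  have E_proper: "E \<noteq> UNIV" using \<open>M \<noteq> UNIV\<close> M by auto
  \<comment> \<open>If \<open>X0 x = 0\<close>, then \<open>J x \<in> M\<close>, so \<open>Y (J x) \<in> E\<close>, and quasianalyticity applies.\<close>
  have X0inj: "x = 0" if "X0 x = 0" for x
  proof -
    have "proj K0 (J x) = 0" using that \<open>0 < c\<close> by (simp add: X0)
    then have "x \<in> {x. (Y \<circ> J) x \<in> E}" using pmM[of "J x"] by (simp add: M)
    also have "\<dots> = {0}" using \<open>quasianalytic T0 (Y \<circ> J) U\<close> E E_proper by (auto simp: quasianalytic_def)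
    finally show ?thesis by simp
  qed

  obtain W where W: "W \<in> ops (UNIV \<times> K0) UNIV" and Wn: "\<And>p. p \<in> UNIV \<times> K0 \<Longrightarrow> norm (W p) = norm p"
    and Wsurj: "W ` (UNIV \<times> K0) = UNIV"
    and WS: "\<And>p. p \<in> UNIV \<times> K0 \<Longrightarrow> W ((\<lambda>(h, y). (S_inf h + K y, R0 y)) p) = S_inf (W p)"
    using \<open>unitarily_equiv _ _ _ _\<close> unfolding unitarily_equiv_def by blast
  have R0K: "R0 y \<in> K0" for y by (simp add: R0 proj_in[OF K0sub])
  \<comment> \<open>The upper triangular operator with entries \<open>S_inf\<close>, \<open>K\<close>, \<open>R0\<close> is an isometry, being unitarily
    equivalent to \<open>S_inf\<close>.\<close>
  have iso: "(norm (S_inf h + K y))\<^sup>2 + (norm (R0 y))\<^sup>2 = (norm h)\<^sup>2 + (norm y)\<^sup>2" if "y \<in> K0" for h y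
  proof -
    have "norm (S_inf h + K y, R0 y) = norm (h, y)"
      using Wn[of "(S_inf h + K y, R0 y)"] Wn[of "(h, y)"] WS[of "(h, y)"] that
      by (simp add: R0K isometry_norm[OF isometry_S_inf])
    then show ?thesis by (metis norm_Pair_sq)
  qed
  have eq: "(norm (fst (T p)))\<^sup>2 + (norm (X0 (T0 (snd p))))\<^sup>2 = (norm (fst p))\<^sup>2 + (norm (X0 (snd p)))\<^sup>2" for p
    using iso[OF X0K, of "fst p" "snd p"] by (simp add: T X0T split_beta)
  have snd: "snd (T p) = T0 (snd p)" for p by (simp add: T split_beta)

  have KX0: "(\<lambda>x. K (X0 x)) \<in> ops UNIV UNIV"
  proof -
    obtain k where "\<forall>y\<in>K0. norm (K y) \<le> k * norm y" using \<open>K \<in> ops K0 UNIV\<close> unfolding ops_def by blast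
    then have k: "norm (K y) \<le> k * norm y" if "y \<in> K0" for y using that by blast
    obtain b where b: "b > 0" "\<And>x. norm (X0 x) \<le> b * norm x" using ops_bound[OF X0op] by blast
    have "norm (K (X0 x)) \<le> (\<bar>k\<bar> * b) * norm x" for x
    proof -
      have "norm (K (X0 x)) \<le> k * norm (X0 x)" by (rule k[OF X0K])
      also have "\<dots> \<le> \<bar>k\<bar> * (b * norm x)" using b(2)[of x] by (intro mult_mono) auto
      finally show ?thesis by simp
    qed
    moreover have "K (X0 (x + y)) = K (X0 x) + K (X0 y)" "K (X0 (a *\<^sub>C x)) = a *\<^sub>C K (X0 x)" for x y a
      using \<open>K \<in> ops K0 UNIV\<close> X0K by (auto simp: ops_def ops_simps[OF X0op])
    ultimately show ?thesis unfolding ops_def by auto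
  qed
  have Top: "T \<in> ops UNIV UNIV"
  proof -
    have "(\<lambda>p. (S_inf (fst p) + K (X0 (snd p)), T0 (snd p))) \<in> ops UNIV UNIV"
      by (intro ops_Pair ops_add ops_compose[OF isometry_ops[OF isometry_S_inf] ops_fst]
          ops_compose[OF KX0 ops_snd] ops_compose[OF T0op ops_snd])
    then show ?thesis by (simp add: T split_beta')
  qed
  have sim: "similar_to_contraction T"
    by (rule similar_to_contraction_triangular[OF Top T0 snd X0op eq])

  \<comment> \<open>\<open>I \<oplus> X0\<close> intertwines \<open>T\<close> with that operator, and \<open>W\<close> identifies the latter with \<open>S_inf\<close>.\<close>
  define Q where "Q p = W (fst p, X0 (snd p))" for p
  have Wadd: "W (p + q) = W p + W q" if "p \<in> UNIV \<times> K0" "q \<in> UNIV \<times> K0" for p q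
    using W that by (auto simp: ops_def)
  have Wscale: "W (a *\<^sub>C p) = a *\<^sub>C W p" if "p \<in> UNIV \<times> K0" for a p
    using W that by (auto simp: ops_def)
  have nQ: "norm (Q p) = norm (fst p, X0 (snd p))" for p by (simp add: Q_def Wn X0K)
  have IX0: "(\<lambda>p. (fst p :: hardy hsum, X0 (snd p))) \<in> ops UNIV UNIV"
    by (intro ops_Pair ops_compose[OF X0op] ops_fst ops_snd)
  have Qop: "Q \<in> ops UNIV UNIV"
  proof -
    obtain b where "\<And>p :: hardy hsum \<times> 'h. norm (fst p, X0 (snd p)) \<le> b * norm p"
      using ops_bound[OF IX0] by blast
    moreover have "Q (p + q) = Q p + Q q" for p q
      unfolding Q_def using Wadd[of "(fst p, X0 (snd p))" "(fst q, X0 (snd q))"]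
      by (simp add: X0K ops_simps[OF X0op])
    moreover have "Q (a *\<^sub>C p) = a *\<^sub>C Q p" for a p
      unfolding Q_def using Wscale[of "(fst p, X0 (snd p))" a]
      by (simp add: X0K ops_simps[OF X0op] scaleC_prod_def)
    ultimately show ?thesis
      unfolding ops_def mem_Collect_eq nQ by (intro conjI ballI allI exI[of _ b]) auto
  qed
  have "p = 0" if "Q p = 0" for p
  proof -
    have "(fst p, X0 (snd p)) = 0" using nQ[of p] that by (metis norm_eq_zero)
    then show ?thesis using X0inj[of "snd p"] by (simp add: prod_eq_iff)
  qed
  moreover have "closure (range Q) = UNIV"
  proof (rule dense_rangeI[OF Qop])
    fix z assume z: "\<And>p. cinner z (Q p) = 0"
    have "z \<in> W ` (UNIV \<times> K0)" by (simp add: Wsurj)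
    then obtain h y where hy: "y \<in> K0" "z = W (h, y)" by auto
    obtain f where f: "\<forall>n. f n \<in> range J" "f \<longlonglongrightarrow> y"
      using Jdense closure_sequential[of y "range J"] by auto
    then have "\<forall>n. \<exists>a. f n = J a" by blast
    then obtain x where x: "\<And>n. f n = J (x n)" by metis
    define x' where "x' n = (1 / c) *\<^sub>R x n" for n
    have "X0 (x' n) = proj K0 (f n)" for n
      using \<open>0 < c\<close> by (simp add: X0 x'_def x ops_simps[OF J] ops_simps[OF pop])
    moreover have "(\<lambda>n. proj K0 (f n)) \<longlonglongrightarrow> y"
      using ops_tendsto[OF pop f(2)] by (simp add: pid[OF hy(1)])
    ultimately have lim: "(\<lambda>n. X0 (x' n)) \<longlonglongrightarrow> y" by simp
    have yK: "y - X0 (x' n) \<in> K0" for n by (rule csubspaces_diff[OF K0sub hy(1) X0K])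
    have "z - Q (h, x' n) = W (0, y - X0 (x' n))" for n
      using Wadd[of "(0, y - X0 (x' n))" "(h, X0 (x' n))"] yK[of n] X0K by (simp add: hy Q_def)
    then have "norm (z - Q (h, x' n)) = norm (y - X0 (x' n))" for n
      using Wn[of "(0, y - X0 (x' n))"] yK[of n] by (simp add: norm_Pair)
    moreover have "(\<lambda>n. norm (y - X0 (x' n))) \<longlonglongrightarrow> norm (y - y)" by (intro tendsto_intros lim)
    ultimately have "(\<lambda>n. norm (z - Q (h, x' n))) \<longlonglongrightarrow> 0" by simp
    then have "(\<lambda>n. Q (h, x' n)) \<longlonglongrightarrow> z"
      by (simp add: tendsto_iff dist_norm norm_minus_commute)
    then have "(\<lambda>n. cinner z (Q (h, x' n))) \<longlonglongrightarrow> cinner z z" by (rule tendsto_cinner_right)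
    then have "cinner z z = 0" by (simp add: z LIMSEQ_const_iff)
    then show "z = 0" by (simp add: cinner_self_eq_0)
  qed
  ultimately have Qq: "quasiaffinity Q" using Qop by (auto simp: quasiaffinity_def ops_simps[OF Qop])
  have QT: "Q (T p) = S_inf (Q p)" for p
    unfolding Q_def using WS[of "(fst p, X0 (snd p))"] by (simp add: X0K T X0T split_beta)
  have qs: "quasisimilar T S_inf" by (rule quasisimilar_S_inf[OF sim Qq QT])

  have "has_unitary_summand V"
    if asy: "isometric_asymptote T X V" for X :: "hardy hsum \<times> 'h \<Rightarrow> 'v" and V
  proof -
    define P where "P x = Y (J x)" for x
    have P: "P \<in> ops UNIV UNIV" unfolding P_def by (rule ops_compose[OF Y J])
    have PT: "P (T0 x) = U (P x)" for x by (simp add: P_def JT YR)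
    have lim: "(\<lambda>n. (norm ((T0 ^^ n) x))\<^sup>2) \<longlonglongrightarrow> (norm (P x))\<^sup>2" for x
      using tendsto_Re[OF \<open>\<And>x1 x2. (\<lambda>n. cinner ((T0 ^^ n) x1) ((T0 ^^ n) x2)) \<longlonglongrightarrow> _ x1 x2\<close>, of x x]
      by (simp add: cinner_self P_def)
    \<comment> \<open>On this part of the asymptote of \<open>R\<close> the component \<open>X0\<close> is invisible: vectors \<open>y\<close> of \<open>M\<close> are
      limits of vectors \<open>J x\<close>, whose projections to the complement of \<open>M\<close> then tend to \<open>0\<close>.\<close>
    define N where "N = closure (Y ` M)"
    have N: "N \<in> csubspaces"
      unfolding N_def
    proof (rule csubspaces_closure)
      show "0 \<in> Y ` M" using Msub by (auto simp: csubspaces_def ops_simps[OF Y] intro!: image_eqI[of _ Y 0])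
      show "u + v \<in> Y ` M" if "u \<in> Y ` M" "v \<in> Y ` M" for u v
        using that Msub by (auto simp: csubspaces_def simp flip: ops_simps(1)[OF Y])
      show "a *\<^sub>C u \<in> Y ` M" if "u \<in> Y ` M" for a u
        using that Msub by (auto simp: csubspaces_def simp flip: ops_scaleC[OF Y])
    qed
    have NE: "N \<subseteq> E"
      unfolding N_def by (rule closure_minimal) (use Esub in \<open>auto simp: M csubspaces_def\<close>)
    have UN: "U ` N \<subseteq> N"
      unfolding N_def
    proof (rule image_closure_subset)
      show "continuous_on (closure (Y ` M)) U" by (rule linear_continuous_on[OF ops_linear[OF Uop]])
      show "U ` (Y ` M) \<subseteq> closure (Y ` M)"
        using closure_subset[of "Y ` M"] RM by (auto simp flip: YR)
    qed simp
    have red: "U ` N = N"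
      using invariant_subspace_reducing[OF R Y YR C0 U E _ N NE UN] \<open>M \<noteq> UNIV\<close> by (simp add: M)
    have approx: "\<exists>x. (\<lambda>k. X0 (x k)) \<longlonglongrightarrow> 0 \<and> (\<lambda>k. P (x k)) \<longlonglongrightarrow> g" if g: "g \<in> N" for g
    proof -
      obtain f where f: "\<forall>k. f k \<in> Y ` M" "f \<longlonglongrightarrow> g"
        using g unfolding N_def closure_sequential by blast
      then have "\<forall>k. \<exists>y\<in>M. f k = Y y" by blast
      then obtain y where y: "\<And>k. y k \<in> M" "\<And>k. f k = Y (y k)" by metis
      have "\<exists>x. dist (J x) (y k) < inverse (real (Suc k))" for k
      proof -
        have "y k \<in> closure (range J)" by (simp add: Jdense)
        then show ?thesis unfolding closure_approachable by (auto dest: spec[of _ "inverse (real (Suc k))"])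
      qed
      then obtain x where x: "\<And>k. dist (J (x k)) (y k) < inverse (real (Suc k))" by metis
      have d: "(\<lambda>k. J (x k) - y k) \<longlonglongrightarrow> 0"
        by (rule Lim_null_comparison[OF _ LIMSEQ_inverse_real_of_nat])
          (use x in \<open>auto simp: dist_norm intro!: always_eventually less_imp_le\<close>)
      have "(\<lambda>k. c *\<^sub>R proj K0 (J (x k) - y k)) \<longlonglongrightarrow> c *\<^sub>R proj K0 0"
        by (intro tendsto_intros ops_tendsto[OF pop d])
      then have "(\<lambda>k. X0 (x k)) \<longlonglongrightarrow> 0" by (simp add: X0 ops_simps[OF pop] pM[OF y(1)])
      moreover have "(\<lambda>k. Y (J (x k) - y k) + f k) \<longlonglongrightarrow> Y 0 + g"
        by (intro tendsto_add ops_tendsto[OF Y d] f(2))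
      then have "(\<lambda>k. P (x k)) \<longlonglongrightarrow> g" by (simp add: y(2) P_def ops_simps[OF Y])
      ultimately show ?thesis by blast
    qed
    obtain y where y: "y \<in> M" "y \<noteq> 0" using \<open>M \<noteq> {0}\<close> Msub by (auto simp: csubspaces_def)
    have "Y y \<noteq> 0"
    proof
      assume "Y y = 0"
      have "(\<lambda>n. (norm ((R ^^ n) y))\<^sup>2) \<longlonglongrightarrow> 0"
        using tendsto_Re[OF \<open>\<And>y1 y2. (\<lambda>n. cinner ((R ^^ n) y1) ((R ^^ n) y2)) \<longlonglongrightarrow> _ y1 y2\<close>, of y y]
        by (simp add: cinner_self \<open>Y y = 0\<close>)
      then have lim0: "(\<lambda>n. norm ((R ^^ n) y)) \<longlonglongrightarrow> 0"
        using tendsto_real_sqrt by fastforce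
      have "(INF n. norm ((R ^^ n) y)) \<le> norm ((R ^^ n) y)" for n
        by (rule cINF_lower) (auto intro: bdd_belowI[of _ 0])
      then have "(INF n. norm ((R ^^ n) y)) \<le> 0" by (intro LIMSEQ_le_const[OF lim0]) auto
      then show False using C1 y(2) by (force simp: class_C1_dot_def)
    qed
    from bilateral_coeffs_separate[OF R Y YR C0 U this] obtain r B
      where r: "bessel U r B" and nz: "bilateral_coeffs U r (Y y) \<noteq> 0" by blast
    have "Y y \<in> N" using y(1) closure_subset[of "Y ` M"] by (auto simp: N_def)
    show ?thesis
      by (rule unitary_summand_of_asymptote[OF snd X0op eq P PT lim Uop red _
            bilateral_coeffs_ops[OF U r] bilateral_coeffs_intertwines[OF U r]
            isometry_bilateral_shift \<open>Y y \<in> N\<close> nz asy]) (rule approx)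
  qed
  with sim qs show ?thesis by blast
qed

end
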